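(* Let $K=l_0\,p\,\|b\|_\infty$, let $g\in L^\infty(U)$ satisfy $\|g\|_\infty<\frac1{l_0}\left(\frac1{2^pK}\right)^{\frac1{p-1}}$, choose $0<c_0<1$ and set $\varepsilon_0:=\left(\frac{(1-c_0)^p}{2^pK}\right)^{\frac1{p-1}}$. Let $\mathcal{A}$ be the admissible set for $X$ and, for $\omega\in\mathcal{A}$, let $u_\omega(x)=u(x,\omega)$ be the corresponding solution (both defined in the context). Let $m\in\mathbb{N}$ and suppose that $$\sum_{j=1}^\infty\frac{(m+j-1)!}{(m-1)!\,j!}\,(l_0\|f\|_\infty)^j\ \mathbb{E}_{\mathcal{A}}\big[\,|\mu_\omega|^j\,\big]<+\infty .$$ Then $\mathbb{E}_{\mathcal{A}}[|u|^m(x,\omega)]\in L^\infty(U)$ and $$\mathbb{E}_{\mathcal{A}}\left[\big\||u|^m(\cdot,\omega)\big\|_{L^\infty(U)}\right]<\infty .$$ In particular, $\mathbb{E}_{\mathcal{A}}[u(x,\omega)]\in L^\infty(U)$.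
   Context: Let $n\ge3$, $p>1$, and let $U\subset\mathbb{R}^n$ be a bounded domain with diameter $d_U$; put $l_0:=\frac{d_U^2}{2(n-2)}$. $(\Omega,\mathcal{F},\mathbb{P})$ is a complete probability space. $\mathcal{M}(U)$ is the space of (signed) Radon measures on $U$ of finite total variation, with total variation norm denoted $|\mu|$ and its Borel $\sigma$-algebra. $X:\Omega\to\mathcal{M}(U)$ is a (Borel) random variable, $\mu_\omega:=X(\omega)$. $f\in BC(\mathbb{R}^n)$ (bounded continuous real functions) and $b\in L^\infty(U)$ are fixed, both nonzero, with $\|f\|_\infty:=\sup_{\mathbb{R}^n}|f|$ and $\|\cdot\|_\infty$ the essential supremum norm on $L^\infty(U)$. The random potential is $V_\omega(x):=\int_U f(x-y)\,d\mu_\omega(y)$, $x\in U$. The problem considered is $$-\Delta u+V_\omega(x)u=b(x)u|u|^{p-1}+g(x)\ \text{ in }U,\qquad u=0\ \text{ on }\partial U.$$ $G$ is the Green function of $-\Delta$ in $U$ with zero Dirichlet boundary condition, which satisfies $0\le G(x,y)\le\frac{1}{n\alpha_n(n-2)}|x-y|^{2-n}$ ($\alpha_n$ = volume of the unit ball of $\mathbb{R}^n$), and $H(\varphi)(x):=\int_U G(x,y)\varphi(y)\,dy$ for $\varphi\in L^\infty(U)$. An integral solution of the problem is a function $u\in L^\infty(U)$ satisfying $u=H(g)-H(V_\omega u)+H(bu|u|^{p-1})$. Set $\tau_\omega:=l_0\|f\|_\infty|\mu_\omega|$. Basic existence result: if $\varepsilon>0$ satisfies $0\le\tau_\omega<1$,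 $\frac{2^pK\varepsilon^{p-1}}{(1-\tau_\omega)^{p-1}}+\tau_\omega<1$ and $\|g\|_\infty\le\varepsilon/l_0$, then there is a unique integral solution $u_\omega$ with $\|u_\omega\|_\infty\le\frac{2\varepsilon}{1-\tau_\omega}$. The admissible set $\mathcal{A}$ for $X$ is the set of $\omega\in\Omega$ for which the problem has a unique solution $u(\cdot,\omega)$ given by this existence result with $\varepsilon=\varepsilon_0$, i.e. the set of $\omega$ for which its hypotheses hold with $\varepsilon=\varepsilon_0$; $u(\cdot,\omega)$ is then that unique solution. For a measurable $A\subset\Omega$, $\mathbb{E}_A[Y]:=\int_A Y(\omega)\,d\mathbb{P}(\omega)$; for real $Y$ this is the usual integral, and for $Y$ with values in the Banach space $L^\infty(U)$ (such as $\omega\mapsto u(\cdot,\omega)$ and $\omega\mapsto|u|^m(\cdot,\omega)=|u(\cdot,\omega)|^m$) it is the Bochner integral. *)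

theory Defs
  imports "HOL-Probability.Probability"
begin

section \<open>The space \<open>L\<^sup>\<infinity>(U)\<close>\<close>

text \<open>Elements of \<open>L\<^sup>\<infinity>(U)\<close> are represented by functions on the whole space of which only the
  values on \<open>U\<close> matter, up to null sets; equality in \<open>L\<^sup>\<infinity>(U)\<close> is equality almost everywhere
  on \<open>U\<close>, and all notions below are invariant under it.\<close>

definition Linf :: "'a::euclidean_space set \<Rightarrow> ('a \<Rightarrow> real) set" where
  "Linf U = {\<phi> \<in> borel_measurable (lebesgue_on U). esssup (lebesgue_on U) (\<lambda>x. ereal \<bar>\<phi> x\<bar>) < \<infinity>}"

definition Linf_norm :: "'a::euclidean_space set \<Rightarrow> ('a \<Rightarrow> real) \<Rightarrow> real" where
  "Linf_norm U \<phi> = real_of_ereal (esssup (lebesgue_on U) (\<lambda>x. ereal \<bar>\<phi> x\<bar>))"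

section \<open>Bochner integral with values in \<open>L\<^sup>\<infinity>(U)\<close>\<close>

text \<open>The Bochner integral of the library is restricted to second countable spaces, which excludes
  \<open>L\<^sup>\<infinity>(U)\<close>. The definitions below are the usual ones, for a finite measure \<open>M\<close>.\<close>

definition Linf_simple :: "'w measure \<Rightarrow> 'a::euclidean_space set \<Rightarrow> ('w \<Rightarrow> 'a \<Rightarrow> real) \<Rightarrow> bool" where
  "Linf_simple M U s \<longleftrightarrow> simple_function M s \<and> s \<in> space M \<rightarrow> Linf U"

definition Linf_simple_integral :: "'w measure \<Rightarrow> ('w \<Rightarrow> 'a::euclidean_space \<Rightarrow> real) \<Rightarrow> 'a \<Rightarrow> real" where
  "Linf_simple_integral M s = (\<lambda>x. \<Sum>\<phi>\<in>s ` space M. measure M (s -` {\<phi>} \<inter> space M) * \<phi> x)"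

definition Linf_strongly_measurable ::
    "'w measure \<Rightarrow> 'a::euclidean_space set \<Rightarrow> ('w \<Rightarrow> 'a \<Rightarrow> real) \<Rightarrow> bool" where
  "Linf_strongly_measurable M U F \<longleftrightarrow> F \<in> space M \<rightarrow> Linf U \<and>
    (\<exists>s. (\<forall>i::nat. Linf_simple M U (s i)) \<and>
      (AE \<omega> in M. (\<lambda>i. Linf_norm U (\<lambda>x. F \<omega> x - s i \<omega> x)) \<longlonglongrightarrow> 0))"

definition has_Linf_bochner_integral ::
    "'w measure \<Rightarrow> 'a::euclidean_space set \<Rightarrow> ('w \<Rightarrow> 'a \<Rightarrow> real) \<Rightarrow> ('a \<Rightarrow> real) \<Rightarrow> bool" where
  "has_Linf_bochner_integral M U F h \<longleftrightarrow> Linf_strongly_measurable M U F \<and> h \<in> Linf U \<and>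
    (\<exists>s. (\<forall>i::nat. Linf_simple M U (s i)) \<and>
      (\<lambda>i. \<integral>\<^sup>+\<omega>. ennreal (Linf_norm U (\<lambda>x. F \<omega> x - s i \<omega> x)) \<partial>M) \<longlonglongrightarrow> 0 \<and>
      (\<lambda>i. Linf_norm U (\<lambda>x. h x - Linf_simple_integral M (s i) x)) \<longlonglongrightarrow> 0)"

section \<open>Signed Radon measures on \<open>U\<close>\<close>

text \<open>A signed measure on \<open>U\<close> is a countably additive real set function on the Borel subsets of
  \<open>U\<close>, extended by \<open>0\<close> to all other sets so that equal measures are equal functions.\<close>

definition variation_sums :: "('a::euclidean_space set \<Rightarrow> real) \<Rightarrow> 'a set \<Rightarrow> real set" where
  "variation_sums \<mu> A = {\<Sum>B\<in>D. \<bar>\<mu> B\<bar> | D. finite D \<and> partition_on A D \<and> D \<subseteq> sets borel}"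

definition variation :: "('a::euclidean_space set \<Rightarrow> real) \<Rightarrow> 'a set \<Rightarrow> real" where
  "variation \<mu> A = Sup (variation_sums \<mu> A)"

definition signed_radon :: "'a::euclidean_space set \<Rightarrow> ('a set \<Rightarrow> real) set" where
  "signed_radon U = {\<mu>.
     (\<forall>A. A \<notin> sets (restrict_space borel U) \<longrightarrow> \<mu> A = 0) \<and>
     (\<forall>A::nat \<Rightarrow> 'a set. range A \<subseteq> sets (restrict_space borel U) \<and> disjoint_family A \<longrightarrow>
        (\<lambda>i. \<mu> (A i)) sums \<mu> (\<Union>i. A i)) \<and>
     bdd_above (variation_sums \<mu> U) \<and>
     (\<forall>A \<in> sets (restrict_space borel U). \<forall>e>0.
        \<exists>C. compact C \<and> C \<subseteq> A \<and> variation \<mu> (A - C) < e)}"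

abbreviation (input) tv_norm :: "'a::euclidean_space set \<Rightarrow> ('a set \<Rightarrow> real) \<Rightarrow> real" where
  "tv_norm U \<mu> \<equiv> variation \<mu> U"

text \<open>Metric spaces in the library require a distance that is nonnegative everywhere, hence the
  default value off the space.\<close>

definition tv_dist :: "'a::euclidean_space set \<Rightarrow> ('a set \<Rightarrow> real) \<Rightarrow> ('a set \<Rightarrow> real) \<Rightarrow> real" where
  "tv_dist U \<mu> \<nu> = (if \<mu> \<in> signed_radon U \<and> \<nu> \<in> signed_radon U
                     then tv_norm U (\<lambda>A. \<mu> A - \<nu> A) else 0)"

lemma Metric_space_signed_radon:
  assumes U: "U \<in> sets borel"
  shows "Metric_space (signed_radon U) (tv_dist U)"
proof -
  define Q where "Q = {D. finite D \<and> partition_on U D \<and> D \<subseteq> sets borel}"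
  have vs: "variation_sums \<mu> U = (\<lambda>D. \<Sum>B\<in>D. \<bar>\<mu> B\<bar>) ` Q" for \<mu>
    unfolding variation_sums_def Q_def by auto
  have Qne: "Q \<noteq> {}"
  proof (cases "U = {}")
    case True
    then have "{} \<in> Q" by (simp add: Q_def partition_on_def)
    then show ?thesis by auto
  next
    case False
    then have "{U} \<in> Q" using U by (simp add: Q_def partition_on_def)
    then show ?thesis by auto
  qed
  have up: "(\<Sum>B\<in>D. \<bar>\<mu> B\<bar>) \<le> tv_norm U \<mu>" if "D \<in> Q" "bdd_above (variation_sums \<mu> U)" for D \<mu>
    unfolding variation_def using that by (intro cSup_upper) (auto simp: vs)
  have least: "tv_norm U \<mu> \<le> c" if "\<And>D. D \<in> Q \<Longrightarrow> (\<Sum>B\<in>D. \<bar>\<mu> B\<bar>) \<le> c" for c \<mu>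
    unfolding variation_def vs using that Qne by (intro cSUP_least) auto
  have bdd: "bdd_above (variation_sums \<mu> U)" if "\<mu> \<in> signed_radon U" for \<mu>
    using that by (simp add: signed_radon_def)
  have tri: "bdd_above (variation_sums (\<lambda>A. \<alpha> A + \<beta> A) U) \<and>
      tv_norm U (\<lambda>A. \<alpha> A + \<beta> A) \<le> tv_norm U \<alpha> + tv_norm U \<beta>"
    if a: "bdd_above (variation_sums \<alpha> U)" and b: "bdd_above (variation_sums \<beta> U)" for \<alpha> \<beta>
  proof -
    have *: "(\<Sum>B\<in>D. \<bar>\<alpha> B + \<beta> B\<bar>) \<le> tv_norm U \<alpha> + tv_norm U \<beta>" if "D \<in> Q" for D
    proof -
      have "(\<Sum>B\<in>D. \<bar>\<alpha> B + \<beta> B\<bar>) \<le> (\<Sum>B\<in>D. \<bar>\<alpha> B\<bar> + \<bar>\<beta> B\<bar>)"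
        by (intro sum_mono) simp
      with up[OF that a] up[OF that b] show ?thesis by (simp add: sum.distrib)
    qed
    have "bdd_above (variation_sums (\<lambda>A. \<alpha> A + \<beta> A) U)"
      unfolding vs using * by (intro bdd_aboveI) auto
    with least[OF *] show ?thesis by blast
  qed
  have neg: "variation_sums (\<lambda>A. \<alpha> A - \<beta> A) U = variation_sums (\<lambda>A. \<beta> A - \<alpha> A) U" for \<alpha> \<beta>
    unfolding vs by (simp add: abs_minus_commute)
  have negb: "bdd_above (variation_sums (\<lambda>A. - \<beta> A) U)" if "bdd_above (variation_sums \<beta> U)" for \<beta>
    using that unfolding vs by simp
  have dbdd: "bdd_above (variation_sums (\<lambda>A. \<mu> A - \<nu> A) U)"
    if "\<mu> \<in> signed_radon U" "\<nu> \<in> signed_radon U" for \<mu> \<nu>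
    using tri[OF bdd[OF that(1)] negb[OF bdd[OF that(2)]]] by simp
  have Qsum: "0 \<le> (\<Sum>B\<in>D. \<bar>\<alpha> B\<bar>)" for D and \<alpha> :: "'a set \<Rightarrow> real"
    by (intro sum_nonneg) simp
  show ?thesis
  proof
    fix \<mu> \<nu> :: "'a set \<Rightarrow> real"
    show "tv_dist U \<mu> \<nu> = tv_dist U \<nu> \<mu>"
      unfolding tv_dist_def variation_def using neg[of \<mu> \<nu>] by auto
  next
    fix \<mu> \<nu> \<xi> assume m: "\<mu> \<in> signed_radon U" "\<nu> \<in> signed_radon U" "\<xi> \<in> signed_radon U"
    show "tv_dist U \<mu> \<xi> \<le> tv_dist U \<mu> \<nu> + tv_dist U \<nu> \<xi>"
      using tri[OF dbdd[OF m(1,2)] dbdd[OF m(2,3)]] m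
      by (simp add: tv_dist_def)
  next
    fix \<mu> \<nu> :: "'a set \<Rightarrow> real"
    show "0 \<le> tv_dist U \<mu> \<nu>"
    proof (cases "\<mu> \<in> signed_radon U \<and> \<nu> \<in> signed_radon U")
      case True
      obtain D where "D \<in> Q" using Qne by blast
      with up[of D "\<lambda>A. \<mu> A - \<nu> A"] dbdd[of \<mu> \<nu>] True Qsum[of "\<lambda>A. \<mu> A - \<nu> A" D] show ?thesis
        unfolding tv_dist_def by (simp del: sum_abs_ge_zero)
    qed (auto simp: tv_dist_def)
  next
    fix \<mu> \<nu> assume m: "\<mu> \<in> signed_radon U" "\<nu> \<in> signed_radon U"
    show "tv_dist U \<mu> \<nu> = 0 \<longleftrightarrow> \<mu> = \<nu>"
    proof
      assume "\<mu> = \<nu>"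
      then show "tv_dist U \<mu> \<nu> = 0"
        using Qne by (simp add: tv_dist_def variation_def vs)
    next
      assume z: "tv_dist U \<mu> \<nu> = 0"
      show "\<mu> = \<nu>"
      proof
        fix A
        show "\<mu> A = \<nu> A"
        proof (cases "A \<in> sets (restrict_space borel U) \<and> A \<noteq> {}")
          case True
          then have A: "A \<in> sets borel" "A \<subseteq> U" "A \<noteq> {}"
            using U by (auto simp: sets_restrict_space_iff)
          define D where "D = {A, U - A} - {{}}"
          have "D \<in> Q" using A U by (auto simp: Q_def D_def partition_on_def disjoint_def)
          from up[OF this dbdd[OF m]] z m have "(\<Sum>B\<in>D. \<bar>\<mu> B - \<nu> B\<bar>) \<le> 0"
            by (simp add: tv_dist_def)
          moreover have "\<bar>\<mu> A - \<nu> A\<bar> \<le> (\<Sum>B\<in>D. \<bar>\<mu> B - \<nu> B\<bar>)"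
            using A by (intro member_le_sum) (auto simp: D_def)
          ultimately show ?thesis by simp
        next
          case False
          have "\<kappa> {} = 0" if "\<kappa> \<in> signed_radon U" for \<kappa>
          proof -
            have "(\<lambda>i::nat. \<kappa> {}) sums \<kappa> (\<Union>i::nat. {})"
              using that unfolding signed_radon_def
              by (auto simp: disjoint_family_on_def dest!: spec[of _ "\<lambda>_. {}"])
            then have "(\<lambda>i::nat. \<kappa> {}) \<longlonglongrightarrow> 0" by (intro summable_LIMSEQ_zero sums_summable)
            then show ?thesis by (simp add: LIMSEQ_const_iff)
          qed
          from this[OF m(1)] this[OF m(2)] False m show ?thesis by (auto simp: signed_radon_def)
        qed
      qed
    qed
  qed
qed

definition borel_signed_radon :: "'a::euclidean_space set \<Rightarrow> ('a set \<Rightarrow> real) measure" where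
  "borel_signed_radon U =
     sigma (signed_radon U) {S. openin (Metric_space.mtopology (signed_radon U) (tv_dist U)) S}"

text \<open>Integration against \<open>\<mu>\<close> via the Jordan decomposition \<open>\<mu>\<^sup>\<plusminus> = (\<bar>\<mu>\<bar> \<plusminus> \<mu>) / 2\<close>.\<close>

definition pos_variation :: "'a::euclidean_space set \<Rightarrow> ('a set \<Rightarrow> real) \<Rightarrow> 'a measure" where
  "pos_variation U \<mu> = measure_of U (sets (restrict_space borel U))
     (\<lambda>A. ennreal ((variation \<mu> A + \<mu> A) / 2))"

definition neg_variation :: "'a::euclidean_space set \<Rightarrow> ('a set \<Rightarrow> real) \<Rightarrow> 'a measure" where
  "neg_variation U \<mu> = measure_of U (sets (restrict_space borel U))
     (\<lambda>A. ennreal ((variation \<mu> A - \<mu> A) / 2))"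

definition signed_integral ::
    "'a::euclidean_space set \<Rightarrow> ('a set \<Rightarrow> real) \<Rightarrow> ('a \<Rightarrow> real) \<Rightarrow> real" where
  "signed_integral U \<mu> \<phi> = (\<integral>y. \<phi> y \<partial>pos_variation U \<mu>) - (\<integral>y. \<phi> y \<partial>neg_variation U \<mu>)"

section \<open>The Dirichlet Green function\<close>

text \<open>Fundamental solution of \<open>-\<Delta>\<close> in dimension at least 3; the value at \<open>0\<close> is irrelevant.\<close>

definition fund_sol :: "'a::euclidean_space \<Rightarrow> real" where
  "fund_sol z = 1 / (real DIM('a) * unit_ball_vol (real DIM('a)) * (real DIM('a) - 2))
                  * (1 / norm z ^ (DIM('a) - 2))"

definition subharmonic_on :: "'a::euclidean_space set \<Rightarrow> ('a \<Rightarrow> real) \<Rightarrow> bool" where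
  "subharmonic_on U v \<longleftrightarrow> continuous_on U v \<and>
     (\<forall>a r. 0 < r \<and> cball a r \<subseteq> U \<longrightarrow>
        v a \<le> (\<integral>y. v y \<partial>lebesgue_on (cball a r)) / measure lebesgue (cball a r))"

text \<open>Perron solution of \<open>\<Delta>h = 0\<close> in \<open>U\<close>, \<open>h = \<psi>\<close> on the boundary. No boundary regularity of
  \<open>U\<close> is assumed, so the Dirichlet problem need not be classically solvable; when it is, the
  Perron solution is the classical one.\<close>

definition perron_solution :: "'a::euclidean_space set \<Rightarrow> ('a \<Rightarrow> real) \<Rightarrow> 'a \<Rightarrow> real" where
  "perron_solution U \<psi> y =
     (SUP v \<in> {v. continuous_on (closure U) v \<and> subharmonic_on U v \<and> (\<forall>z\<in>frontier U. v z \<le> \<psi> z)}. v y)"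

definition green :: "'a::euclidean_space set \<Rightarrow> 'a \<Rightarrow> 'a \<Rightarrow> real" where
  "green U x y = fund_sol (y - x) - perron_solution U (\<lambda>z. fund_sol (z - x)) y"

definition green_op :: "'a::euclidean_space set \<Rightarrow> ('a \<Rightarrow> real) \<Rightarrow> 'a \<Rightarrow> real" where
  "green_op U \<phi> x = (\<integral>y. green U x y * \<phi> y \<partial>lebesgue_on U)"

section \<open>The random problem\<close>

definition l0 :: "'a::euclidean_space set \<Rightarrow> real" where
  "l0 U = (diameter U)\<^sup>2 / (2 * (real DIM('a) - 2))"

definition potential ::
    "'a::euclidean_space set \<Rightarrow> ('a \<Rightarrow>\<^sub>C real) \<Rightarrow> ('a set \<Rightarrow> real) \<Rightarrow> 'a \<Rightarrow> real" where
  "potential U f \<mu> x = signed_integral U \<mu> (\<lambda>y. apply_bcontfun f (x - y))"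

definition integral_solution ::
    "'a::euclidean_space set \<Rightarrow> real \<Rightarrow> ('a \<Rightarrow> real) \<Rightarrow> ('a \<Rightarrow> real) \<Rightarrow> ('a \<Rightarrow> real) \<Rightarrow> ('a \<Rightarrow> real) \<Rightarrow> bool"
  where
  "integral_solution U p b g V u \<longleftrightarrow> u \<in> Linf U \<and>
     (AE x in lebesgue_on U. u x = green_op U g x - green_op U (\<lambda>y. V y * u y) x
                                   + green_op U (\<lambda>y. b y * u y * \<bar>u y\<bar> powr (p - 1)) x)"

definition tau :: "'a::euclidean_space set \<Rightarrow> ('a \<Rightarrow>\<^sub>C real) \<Rightarrow> ('a set \<Rightarrow> real) \<Rightarrow> real" where
  "tau U f \<mu> = l0 U * norm f * tv_norm U \<mu>"

definition admissible_set ::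
    "'w measure \<Rightarrow> ('w \<Rightarrow> 'a::euclidean_space set \<Rightarrow> real) \<Rightarrow> 'a set \<Rightarrow> real \<Rightarrow> ('a \<Rightarrow>\<^sub>C real) \<Rightarrow>
     real \<Rightarrow> ('a \<Rightarrow> real) \<Rightarrow> real \<Rightarrow> 'w set" where
  "admissible_set P X U p f K g \<epsilon> = {\<omega> \<in> space P.
     0 \<le> tau U f (X \<omega>) \<and> tau U f (X \<omega>) < 1 \<and>
     2 powr p * K * \<epsilon> powr (p - 1) / (1 - tau U f (X \<omega>)) powr (p - 1) + tau U f (X \<omega>) < 1 \<and>
     Linf_norm U g \<le> \<epsilon> / l0 U}"

end

theory Submission
  imports Defs
begin

text \<open>On the admissible set the choice of \<open>\<epsilon>\<^sub>0\<close> forces \<open>\<tau> < c\<^sub>0\<close>, hence \<open>\<parallel>u\<parallel>\<^sub>\<infinity> \<le> 2 \<epsilon>\<^sub>0 / (1 - c\<^sub>0)\<close>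
  uniformly in \<open>\<omega>\<close>, so only strong measurability of \<open>\<omega> \<mapsto> u(\<cdot>, \<omega>)\<close> is at stake. The space of
  measures is not separable, but \<open>u\<close> depends on \<open>\<mu>\<close> only through the potential \<open>f * \<mu>\<close>: the
  fixed point equation, a contraction with constant \<open>(1 + c\<^sub>0) / 2\<close>, makes \<open>u\<close> a Lipschitz function
  of the potential for the sup norm, and the potentials of bounded variation norm form an
  equicontinuous, hence totally bounded, family. So \<open>u\<close> and \<open>\<bar>u\<bar>\<^sup>m\<close> are uniform limits of simple
  functions. The contraction constant rests on \<open>0 \<le> G(x, y) \<le> \<Phi>(y - x)\<close> for the Perron Green function,
  obtained by comparing a subfunction \<open>v\<close> with \<open>\<Phi> + \<eta> (R\<^sup>2 - \<bar>y - x\<bar>\<^sup>2)\<close>, whose Laplacian is negative.\<close>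

section \<open>The space \<open>L\<^sup>\<infinity>(U)\<close>\<close>

lemma Linf_measurable [measurable_dest]: "\<phi> \<in> Linf U \<Longrightarrow> \<phi> \<in> borel_measurable (lebesgue_on U)"
  by (simp add: Linf_def)

lemma AE_abs_le_Linf_norm:
  assumes "\<phi> \<in> Linf U"
  shows "AE x in lebesgue_on U. \<bar>\<phi> x\<bar> \<le> Linf_norm U \<phi>"
  using esssup_AE[of "\<lambda>x. ereal \<bar>\<phi> x\<bar>" "lebesgue_on U"]
proof eventually_elim
  case (elim x)
  moreover have "esssup (lebesgue_on U) (\<lambda>x. ereal \<bar>\<phi> x\<bar>) < \<infinity>"
    using assms by (simp add: Linf_def)
  ultimately show ?case
    unfolding Linf_norm_def by (cases "esssup (lebesgue_on U) (\<lambda>x. ereal \<bar>\<phi> x\<bar>)") auto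
qed

lemma esssup_abs_le:
  assumes "\<phi> \<in> borel_measurable (lebesgue_on U)" "AE x in lebesgue_on U. \<bar>\<phi> x\<bar> \<le> c"
  shows "esssup (lebesgue_on U) (\<lambda>x. ereal \<bar>\<phi> x\<bar>) \<le> ereal c"
  using assms by (intro esssup_I) auto

lemma LinfI:
  assumes "\<phi> \<in> borel_measurable (lebesgue_on U)" "AE x in lebesgue_on U. \<bar>\<phi> x\<bar> \<le> c"
  shows "\<phi> \<in> Linf U"
  using assms(1) order.strict_trans1[OF esssup_abs_le[OF assms], of \<infinity>] by (simp add: Linf_def)

lemma Linf_norm_le:
  assumes "\<phi> \<in> borel_measurable (lebesgue_on U)" "AE x in lebesgue_on U. \<bar>\<phi> x\<bar> \<le> c" "0 \<le> c"
  shows "Linf_norm U \<phi> \<le> c"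
  using esssup_abs_le[OF assms(1,2)] assms(3) unfolding Linf_norm_def
  by (cases "esssup (lebesgue_on U) (\<lambda>x. ereal \<bar>\<phi> x\<bar>)") auto

lemma Linf_norm_nonneg [simp]: "0 \<le> Linf_norm U \<phi>"
proof (cases "(\<lambda>x. ereal \<bar>\<phi> x\<bar>) \<in> borel_measurable (lebesgue_on U)")
  case measurable: True
  show ?thesis
  proof (cases "emeasure (lebesgue_on U) (space (lebesgue_on U)) = 0")
    case True
    then show ?thesis
      using esssup_zero_space[OF True measurable] by (simp add: Linf_norm_def)
  next
    case False
    then have "0 = esssup (lebesgue_on U) (\<lambda>x. 0 :: ereal)"
      by (intro esssup_const[symmetric])
    also have "\<dots> \<le> esssup (lebesgue_on U) (\<lambda>x. ereal \<bar>\<phi> x\<bar>)"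
      by (intro esssup_mono) auto
    finally show ?thesis
      by (simp add: Linf_norm_def real_of_ereal_pos)
  qed
qed (simp add: Linf_norm_def esssup_non_measurable top_ereal_def)

lemma Linf_const: "(\<lambda>_. c) \<in> Linf U"
  by (rule LinfI[of _ _ "\<bar>c\<bar>"]) auto

lemma Linf_diff:
  assumes "\<phi> \<in> Linf U" "\<psi> \<in> Linf U"
  shows "(\<lambda>x. \<phi> x - \<psi> x) \<in> Linf U"
proof (rule LinfI)
  show "AE x in lebesgue_on U. \<bar>\<phi> x - \<psi> x\<bar> \<le> Linf_norm U \<phi> + Linf_norm U \<psi>"
    using AE_abs_le_Linf_norm[OF assms(1)] AE_abs_le_Linf_norm[OF assms(2)]
    by eventually_elim auto
qed (use assms in measurable)

lemma Linf_norm_diff_commute: "Linf_norm U (\<lambda>x. \<phi> x - \<psi> x) = Linf_norm U (\<lambda>x. \<psi> x - \<phi> x)"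
  by (simp add: Linf_norm_def abs_minus_commute)

lemma Linf_norm_diff_triangle:
  assumes "\<phi> \<in> Linf U" "\<psi> \<in> Linf U" "\<xi> \<in> Linf U"
  shows "Linf_norm U (\<lambda>x. \<phi> x - \<xi> x)
    \<le> Linf_norm U (\<lambda>x. \<phi> x - \<psi> x) + Linf_norm U (\<lambda>x. \<psi> x - \<xi> x)"
proof (rule Linf_norm_le)
  show "AE x in lebesgue_on U. \<bar>\<phi> x - \<xi> x\<bar>
      \<le> Linf_norm U (\<lambda>x. \<phi> x - \<psi> x) + Linf_norm U (\<lambda>x. \<psi> x - \<xi> x)"
    using AE_abs_le_Linf_norm[OF Linf_diff[OF assms(1,2)]]
      AE_abs_le_Linf_norm[OF Linf_diff[OF assms(2,3)]]
    by eventually_elim auto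
qed (use assms in \<open>auto intro!: borel_measurable_diff Linf_measurable\<close>)

lemma Linf_norm_reverse_triangle:
  assumes "\<phi> \<in> Linf U" "\<psi> \<in> Linf U"
  shows "\<bar>Linf_norm U \<phi> - Linf_norm U \<psi>\<bar> \<le> Linf_norm U (\<lambda>x. \<phi> x - \<psi> x)"
  using Linf_norm_diff_triangle[OF assms Linf_const[of 0]]
    Linf_norm_diff_triangle[OF assms(2,1) Linf_const[of 0]]
  by (simp add: Linf_norm_diff_commute[of U \<psi>])

lemma abs_lim_diff_le_of_Cauchy:
  fixes a \<epsilon> :: "nat \<Rightarrow> real"
  assumes Cauchy: "\<And>i j. \<bar>a i - a j\<bar> \<le> \<epsilon> i + \<epsilon> j" and \<epsilon>: "\<epsilon> \<longlonglongrightarrow> 0"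
  shows "\<bar>lim a - a i\<bar> \<le> \<epsilon> i"
proof -
  have "Cauchy a"
  proof (rule metric_CauchyI)
    fix r :: real
    assume "0 < r"
    then obtain N where N: "\<And>i. N \<le> i \<Longrightarrow> \<epsilon> i < r / 2"
      using order_tendstoD(2)[OF \<epsilon>, of "r / 2"] by (auto simp: eventually_sequentially)
    have "dist (a i) (a j) < r" if "N \<le> i" "N \<le> j" for i j
      using Cauchy[of i j] N[OF that(1)] N[OF that(2)] by (simp add: dist_real_def)
    then show "\<exists>N. \<forall>i\<ge>N. \<forall>j\<ge>N. dist (a i) (a j) < r"
      by blast
  qed
  then have lim: "a \<longlonglongrightarrow> lim a"
    by (simp add: Cauchy_convergent_iff convergent_LIMSEQ_iff)
  have "\<bar>lim a - a i\<bar> \<le> 0 + \<epsilon> i"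
  proof (rule LIMSEQ_le)
    show "(\<lambda>j. \<bar>a j - a i\<bar>) \<longlonglongrightarrow> \<bar>lim a - a i\<bar>"
      by (intro tendsto_intros lim)
    show "(\<lambda>j. \<epsilon> j + \<epsilon> i) \<longlonglongrightarrow> 0 + \<epsilon> i"
      by (intro tendsto_intros \<epsilon>)
  qed (use Cauchy in blast)
  then show ?thesis by simp
qed

lemma Linf_complete:
  assumes I: "\<And>i::nat. I i \<in> Linf U"
    and Cauchy: "\<And>i j. Linf_norm U (\<lambda>x. I i x - I j x) \<le> \<epsilon> i + \<epsilon> j"
    and \<epsilon>: "\<epsilon> \<longlonglongrightarrow> 0"
  obtains h where "h \<in> Linf U" "\<And>i. Linf_norm U (\<lambda>x. h x - I i x) \<le> \<epsilon> i"
proof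
  define h where "h x = lim (\<lambda>i. I i x)" for x
  have \<epsilon>_nonneg: "0 \<le> \<epsilon> i" for i
    using order.trans[OF Linf_norm_nonneg Cauchy[of i i]] by simp
  have h_measurable: "h \<in> borel_measurable (lebesgue_on U)"
    unfolding h_def using I by (intro borel_measurable_lim_metric Linf_measurable)
  have "AE x in lebesgue_on U. \<forall>i j. \<bar>I i x - I j x\<bar> \<le> \<epsilon> i + \<epsilon> j"
    unfolding AE_all_countable
  proof (intro allI)
    fix i j
    show "AE x in lebesgue_on U. \<bar>I i x - I j x\<bar> \<le> \<epsilon> i + \<epsilon> j"
      using AE_abs_le_Linf_norm[OF Linf_diff[OF I[of i] I[of j]]]
      by eventually_elim (use Cauchy[of i j] in linarith)
  qed
  then have rate: "AE x in lebesgue_on U. \<bar>h x - I i x\<bar> \<le> \<epsilon> i" for i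
    unfolding h_def by eventually_elim (intro abs_lim_diff_le_of_Cauchy \<epsilon>, blast)
  show "Linf_norm U (\<lambda>x. h x - I i x) \<le> \<epsilon> i" for i
    by (intro Linf_norm_le rate borel_measurable_diff h_measurable Linf_measurable[OF I] \<epsilon>_nonneg)
  show "h \<in> Linf U"
  proof (rule LinfI[OF h_measurable])
    show "AE x in lebesgue_on U. \<bar>h x\<bar> \<le> Linf_norm U (I 0) + \<epsilon> 0"
      using rate[of 0] AE_abs_le_Linf_norm[OF I[of 0]] by eventually_elim linarith
  qed
qed

section \<open>Bochner integrability of uniform limits of simple functions\<close>

lemma Linf_simple_in_Linf: "Linf_simple M U s \<Longrightarrow> \<omega> \<in> space M \<Longrightarrow> s \<omega> \<in> Linf U"
  by (auto simp: Linf_simple_def)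

lemma
  assumes "finite_measure M" "Linf_simple M U s"
  shows integrable_Linf_simple: "integrable M (\<lambda>\<omega>. s \<omega> x)"
    and Linf_simple_integral_eq: "Linf_simple_integral M s x = (\<integral>\<omega>. s \<omega> x \<partial>M)"
proof -
  interpret finite_measure M by fact
  have simple: "simple_function M s"
    using assms by (simp add: Linf_simple_def)
  have simple_integrable: "Bochner_Integration.simple_bochner_integrable M (\<lambda>\<omega>. s \<omega> x)"
    using simple_function_compose1[OF simple, of "\<lambda>\<phi>. \<phi> x"]
    by (simp add: simple_bochner_integrable.simps)
  then show "integrable M (\<lambda>\<omega>. s \<omega> x)"
    by (rule integrableI_simple_bochner_integrable)
  have "Bochner_Integration.simple_bochner_integral M (\<lambda>\<omega>. s \<omega> x) =
      (\<Sum>\<phi>\<in>s ` space M. measure M {\<omega> \<in> space M. s \<omega> = \<phi>} *\<^sub>R \<phi> x)"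
    by (rule simple_bochner_integral_partition[OF simple_integrable simple]) auto
  then show "Linf_simple_integral M s x = (\<integral>\<omega>. s \<omega> x \<partial>M)"
    by (simp add: simple_bochner_integrable_eq_integral[OF simple_integrable] Linf_simple_integral_def
        vimage_def Int_def conj_commute)
qed

lemma Linf_simple_integral_in_Linf:
  assumes "Linf_simple M U s"
  shows "Linf_simple_integral M s \<in> Linf U"
proof (rule LinfI)
  have values_in_Linf: "\<phi> \<in> Linf U" if "\<phi> \<in> s ` space M" for \<phi>
    using assms that by (auto simp: Linf_simple_def)
  show "Linf_simple_integral M s \<in> borel_measurable (lebesgue_on U)"
    unfolding Linf_simple_integral_def
    by (intro borel_measurable_sum borel_measurable_times borel_measurable_const
        values_in_Linf[THEN Linf_measurable])
  have "AE x in lebesgue_on U. \<forall>\<phi>\<in>s ` space M. \<bar>\<phi> x\<bar> \<le> Linf_norm U \<phi>"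
    using assms values_in_Linf
    by (intro AE_finite_allI AE_abs_le_Linf_norm) (auto simp: Linf_simple_def dest: simple_functionD)
  then show "AE x in lebesgue_on U. \<bar>Linf_simple_integral M s x\<bar> \<le>
      (\<Sum>\<phi>\<in>s ` space M. measure M (s -` {\<phi>} \<inter> space M) * Linf_norm U \<phi>)"
  proof eventually_elim
    case (elim x)
    then show ?case
      unfolding Linf_simple_integral_def
      by (intro order.trans[OF sum_abs] sum_mono) (auto simp: abs_mult intro!: mult_left_mono)
  qed
qed

lemma Linf_norm_simple_integral_diff_le:
  assumes M: "finite_measure M" and s: "Linf_simple M U s" and t: "Linf_simple M U t"
    and diff: "\<And>\<omega>. \<omega> \<in> space M \<Longrightarrow> Linf_norm U (\<lambda>x. s \<omega> x - t \<omega> x) \<le> e" and "0 \<le> e"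
  shows "Linf_norm U (\<lambda>x. Linf_simple_integral M s x - Linf_simple_integral M t x)
    \<le> e * measure M (space M)"
proof (rule Linf_norm_le)
  interpret finite_measure M by fact
  have "AE x in lebesgue_on U. \<forall>q\<in>(\<lambda>\<omega>. (s \<omega>, t \<omega>)) ` space M. \<bar>fst q x - snd q x\<bar> \<le> e"
  proof (rule AE_finite_allI)
    show "finite ((\<lambda>\<omega>. (s \<omega>, t \<omega>)) ` space M)"
      using s t by (intro simple_functionD(1) simple_function_Pair) (auto simp: Linf_simple_def)
    fix q
    assume "q \<in> (\<lambda>\<omega>. (s \<omega>, t \<omega>)) ` space M"
    then obtain \<omega> where \<omega>: "\<omega> \<in> space M" and q: "q = (s \<omega>, t \<omega>)" by auto
    have "(\<lambda>x. s \<omega> x - t \<omega> x) \<in> Linf U"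
      using \<omega> s t by (intro Linf_diff Linf_simple_in_Linf)
    from AE_abs_le_Linf_norm[OF this] show "AE x in lebesgue_on U. \<bar>fst q x - snd q x\<bar> \<le> e"
      by eventually_elim (use diff[OF \<omega>] in \<open>simp add: q\<close>)
  qed
  then show "AE x in lebesgue_on U.
      \<bar>Linf_simple_integral M s x - Linf_simple_integral M t x\<bar> \<le> e * measure M (space M)"
  proof eventually_elim
    case (elim x)
    note integrable = integrable_Linf_simple[OF M s, of x] integrable_Linf_simple[OF M t, of x]
    have "\<bar>\<integral>\<omega>. s \<omega> x - t \<omega> x \<partial>M\<bar> \<le> (\<integral>\<omega>. \<bar>s \<omega> x - t \<omega> x\<bar> \<partial>M)"
      by (rule integral_abs_bound)
    also have "\<dots> \<le> (\<integral>\<omega>. e \<partial>M)"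
      using integrable elim by (intro integral_mono) auto
    finally show ?case
      using integrable by (simp add: Linf_simple_integral_eq[OF M s] Linf_simple_integral_eq[OF M t]
          mult.commute)
  qed
qed (use \<open>0 \<le> e\<close> in \<open>auto intro!: Linf_measurable Linf_diff Linf_simple_integral_in_Linf s t\<close>)

definition Linf_uniformly_approximable ::
    "'w measure \<Rightarrow> 'a::euclidean_space set \<Rightarrow> ('w \<Rightarrow> 'a \<Rightarrow> real) \<Rightarrow> bool" where
  "Linf_uniformly_approximable M U F \<longleftrightarrow> F \<in> space M \<rightarrow> Linf U \<and>
    (\<forall>e>0. \<exists>s. Linf_simple M U s \<and> (\<forall>\<omega>\<in>space M. Linf_norm U (\<lambda>x. F \<omega> x - s \<omega> x) \<le> e))"

lemma Linf_uniformly_approximable_in_Linf: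
  "Linf_uniformly_approximable M U F \<Longrightarrow> \<omega> \<in> space M \<Longrightarrow> F \<omega> \<in> Linf U"
  by (auto simp: Linf_uniformly_approximable_def)

lemma Linf_uniformly_approximableE:
  assumes "Linf_uniformly_approximable M U F"
  obtains s where "\<And>i. Linf_simple M U (s i)"
    "\<And>i \<omega>. \<omega> \<in> space M \<Longrightarrow> Linf_norm U (\<lambda>x. F \<omega> x - s i \<omega> x) \<le> inverse (real (Suc i))"
proof -
  have "\<forall>i. \<exists>s. Linf_simple M U s \<and>
      (\<forall>\<omega>\<in>space M. Linf_norm U (\<lambda>x. F \<omega> x - s \<omega> x) \<le> inverse (real (Suc i)))"
    using assms unfolding Linf_uniformly_approximable_def
    by (intro allI) (erule conjE, erule allE, erule mp, simp)
  then show thesis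
    using that by metis
qed

lemma Linf_uniformly_approximable_of_cells:
  assumes F: "F \<in> space M \<rightarrow> Linf U"
    and cells: "\<And>e. 0 < e \<Longrightarrow> \<exists>c :: 'w \<Rightarrow> 'c. simple_function M c \<and>
      (\<forall>\<omega>\<in>space M. \<forall>\<omega>'\<in>space M. c \<omega> = c \<omega>' \<longrightarrow> Linf_norm U (\<lambda>x. F \<omega> x - F \<omega>' x) \<le> e)"
  shows "Linf_uniformly_approximable M U F"
  unfolding Linf_uniformly_approximable_def
proof (intro conjI F allI impI)
  fix e :: real
  assume "0 < e"
  from cells[OF this] obtain c :: "'w \<Rightarrow> 'c" where c: "simple_function M c"
    and close: "\<And>\<omega> \<omega>'. \<omega> \<in> space M \<Longrightarrow> \<omega>' \<in> space M \<Longrightarrow> c \<omega> = c \<omega>' \<Longrightarrow>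
      Linf_norm U (\<lambda>x. F \<omega> x - F \<omega>' x) \<le> e"
    by blast
  define representative where "representative q = (SOME \<omega>. \<omega> \<in> space M \<and> c \<omega> = q)" for q
  have rep: "representative (c \<omega>) \<in> space M \<and> c (representative (c \<omega>)) = c \<omega>"
    if "\<omega> \<in> space M" for \<omega>
    unfolding representative_def
    by (rule someI[where P="\<lambda>\<omega>'. \<omega>' \<in> space M \<and> c \<omega>' = c \<omega>"]) (use that in simp)
  have "Linf_simple M U (\<lambda>\<omega>. F (representative (c \<omega>)))"
    using F rep simple_function_compose1[OF c, of "\<lambda>q. F (representative q)"]
    by (auto simp: Linf_simple_def)
  moreover have "Linf_norm U (\<lambda>x. F \<omega> x - F (representative (c \<omega>)) x) \<le> e" if "\<omega> \<in> space M" for \<omega>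
    using close[OF that] rep[OF that] by metis
  ultimately show "\<exists>s. Linf_simple M U s \<and> (\<forall>\<omega>\<in>space M. Linf_norm U (\<lambda>x. F \<omega> x - s \<omega> x) \<le> e)"
    by (intro exI[of _ "\<lambda>\<omega>. F (representative (c \<omega>))"]) simp
qed

lemma Linf_uniformly_approximable_Lipschitz:
  fixes F G :: "'w \<Rightarrow> 'a::euclidean_space \<Rightarrow> real"
  assumes F: "Linf_uniformly_approximable M U F" and G: "G \<in> space M \<rightarrow> Linf U"
    and Lipschitz: "\<And>\<omega> \<omega>'. \<omega> \<in> space M \<Longrightarrow> \<omega>' \<in> space M \<Longrightarrow>
      Linf_norm U (\<lambda>x. G \<omega> x - G \<omega>' x) \<le> L * Linf_norm U (\<lambda>x. F \<omega> x - F \<omega>' x)"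
  shows "Linf_uniformly_approximable M U G"
proof (rule Linf_uniformly_approximable_of_cells[OF G])
  fix e :: real
  assume "0 < e"
  define \<delta> where "\<delta> = e / (2 * (\<bar>L\<bar> + 1))"
  have "0 < \<delta>" and \<delta>: "\<bar>L\<bar> * (2 * \<delta>) \<le> e"
    using \<open>0 < e\<close> by (auto simp: \<delta>_def field_simps)
  then obtain s where s: "Linf_simple M U s"
    and F_s: "\<And>\<omega>. \<omega> \<in> space M \<Longrightarrow> Linf_norm U (\<lambda>x. F \<omega> x - s \<omega> x) \<le> \<delta>"
    using F unfolding Linf_uniformly_approximable_def by blast
  have "Linf_norm U (\<lambda>x. G \<omega> x - G \<omega>' x) \<le> e"
    if \<omega>: "\<omega> \<in> space M" "\<omega>' \<in> space M" and "s \<omega> = s \<omega>'" for \<omega> \<omega>'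
  proof -
    have "Linf_norm U (\<lambda>x. F \<omega> x - F \<omega>' x)
        \<le> Linf_norm U (\<lambda>x. F \<omega> x - s \<omega> x) + Linf_norm U (\<lambda>x. s \<omega> x - F \<omega>' x)"
      using \<omega> by (intro Linf_norm_diff_triangle Linf_uniformly_approximable_in_Linf[OF F]
          Linf_simple_in_Linf[OF s])
    also have "\<dots> \<le> 2 * \<delta>"
      using F_s[OF \<omega>(1)] F_s[OF \<omega>(2)] \<open>s \<omega> = s \<omega>'\<close> by (simp add: Linf_norm_diff_commute[of U "s \<omega>'"])
    finally have "\<bar>L\<bar> * Linf_norm U (\<lambda>x. F \<omega> x - F \<omega>' x) \<le> \<bar>L\<bar> * (2 * \<delta>)"
      by (intro mult_left_mono) auto
    moreover have "L * Linf_norm U (\<lambda>x. F \<omega> x - F \<omega>' x) \<le> \<bar>L\<bar> * Linf_norm U (\<lambda>x. F \<omega> x - F \<omega>' x)"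
      by (intro mult_right_mono) auto
    ultimately show ?thesis
      using Lipschitz[OF \<omega>] \<delta> by linarith
  qed
  then show "\<exists>c :: 'w \<Rightarrow> 'a \<Rightarrow> real. simple_function M c \<and> (\<forall>\<omega>\<in>space M. \<forall>\<omega>'\<in>space M.
      c \<omega> = c \<omega>' \<longrightarrow> Linf_norm U (\<lambda>x. G \<omega> x - G \<omega>' x) \<le> e)"
    using s by (intro exI[of _ s]) (simp add: Linf_simple_def)
qed

lemma Linf_uniformly_approximable_imp_strongly_measurable:
  assumes "Linf_uniformly_approximable M U F"
  shows "Linf_strongly_measurable M U F"
proof -
  from assms obtain s where s: "\<And>i. Linf_simple M U (s i)"
    and F_s: "\<And>i \<omega>. \<omega> \<in> space M \<Longrightarrow> Linf_norm U (\<lambda>x. F \<omega> x - s i \<omega> x) \<le> inverse (real (Suc i))"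
    by (rule Linf_uniformly_approximableE) blast
  have "(\<lambda>i. Linf_norm U (\<lambda>x. F \<omega> x - s i \<omega> x)) \<longlonglongrightarrow> 0" if "\<omega> \<in> space M" for \<omega>
    by (rule tendsto_sandwich[OF _ _ tendsto_const LIMSEQ_inverse_real_of_nat])
      (simp_all add: F_s[OF that] del: of_nat_Suc)
  then show ?thesis
    using assms s unfolding Linf_strongly_measurable_def Linf_uniformly_approximable_def
    by (intro conjI exI[of _ s]) (auto intro: AE_I2)
qed

lemma has_Linf_bochner_integral_uniformly_approximable:
  assumes M: "finite_measure M" and F: "Linf_uniformly_approximable M U F"
  shows "\<exists>h\<in>Linf U. has_Linf_bochner_integral M U F h"
proof -
  interpret finite_measure M by fact
  define \<epsilon> where "\<epsilon> i = inverse (real (Suc i))" for i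
  have \<epsilon>_mult_tendsto: "(\<lambda>i. \<epsilon> i * measure M (space M)) \<longlonglongrightarrow> 0"
    unfolding \<epsilon>_def using tendsto_mult_left_zero[OF LIMSEQ_inverse_real_of_nat] .
  from F obtain s where s: "\<And>i. Linf_simple M U (s i)"
    and F_s: "\<And>i \<omega>. \<omega> \<in> space M \<Longrightarrow> Linf_norm U (\<lambda>x. F \<omega> x - s i \<omega> x) \<le> \<epsilon> i"
    unfolding \<epsilon>_def by (rule Linf_uniformly_approximableE) blast
  have L1_le: "(\<integral>\<^sup>+\<omega>. ennreal (Linf_norm U (\<lambda>x. F \<omega> x - s i \<omega> x)) \<partial>M)
      \<le> ennreal (\<epsilon> i * measure M (space M))" for i
  proof -
    have "(\<integral>\<^sup>+\<omega>. ennreal (Linf_norm U (\<lambda>x. F \<omega> x - s i \<omega> x)) \<partial>M) \<le> (\<integral>\<^sup>+\<omega>. ennreal (\<epsilon> i) \<partial>M)"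
      using F_s by (intro nn_integral_mono ennreal_leI)
    also have "\<dots> = ennreal (\<epsilon> i * measure M (space M))"
      by (simp add: emeasure_eq_measure \<epsilon>_def ennreal_mult)
    finally show ?thesis .
  qed
  have L1: "(\<lambda>i. \<integral>\<^sup>+\<omega>. ennreal (Linf_norm U (\<lambda>x. F \<omega> x - s i \<omega> x)) \<partial>M) \<longlonglongrightarrow> 0"
    using tendsto_ennrealI[OF \<epsilon>_mult_tendsto] unfolding ennreal_0
    by (rule tendsto_sandwich[OF _ _ tendsto_const, rotated 2]) (simp_all add: L1_le)
  have "Linf_norm U (\<lambda>x. s i \<omega> x - s j \<omega> x) \<le> \<epsilon> i + \<epsilon> j" if \<omega>: "\<omega> \<in> space M" for i j \<omega>
    using Linf_norm_diff_triangle[OF Linf_simple_in_Linf[OF s[of i] \<omega>]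
        Linf_uniformly_approximable_in_Linf[OF F \<omega>] Linf_simple_in_Linf[OF s[of j] \<omega>]]
      F_s[OF \<omega>, of i] F_s[OF \<omega>, of j]
    by (simp add: Linf_norm_diff_commute[of U "s i \<omega>"])
  then have Cauchy: "Linf_norm U (\<lambda>x. Linf_simple_integral M (s i) x - Linf_simple_integral M (s j) x)
      \<le> \<epsilon> i * measure M (space M) + \<epsilon> j * measure M (space M)" for i j
    unfolding distrib_right[symmetric]
    by (intro Linf_norm_simple_integral_diff_le M s) (auto simp: \<epsilon>_def)
  obtain h where h: "h \<in> Linf U"
    and rate: "\<And>i. Linf_norm U (\<lambda>x. h x - Linf_simple_integral M (s i) x) \<le> \<epsilon> i * measure M (space M)"
    using Linf_complete[OF Linf_simple_integral_in_Linf[OF s] Cauchy \<epsilon>_mult_tendsto] by blast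
  have "(\<lambda>i. Linf_norm U (\<lambda>x. h x - Linf_simple_integral M (s i) x)) \<longlonglongrightarrow> 0"
    by (rule tendsto_sandwich[OF _ _ tendsto_const \<epsilon>_mult_tendsto]) (auto simp: rate)
  then show ?thesis
    using h L1 s Linf_uniformly_approximable_imp_strongly_measurable[OF F]
    unfolding has_Linf_bochner_integral_def by blast
qed

lemma integrable_Linf_norm_uniformly_approximable:
  assumes M: "finite_measure M" and F: "Linf_uniformly_approximable M U F"
  shows "integrable M (\<lambda>\<omega>. Linf_norm U (F \<omega>))"
proof -
  interpret finite_measure M by fact
  from F obtain s where s: "\<And>i. Linf_simple M U (s i)"
    and F_s: "\<And>i \<omega>. \<omega> \<in> space M \<Longrightarrow> Linf_norm U (\<lambda>x. F \<omega> x - s i \<omega> x) \<le> inverse (real (Suc i))"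
    by (rule Linf_uniformly_approximableE) blast
  have s_measurable: "simple_function M (\<lambda>\<omega>. Linf_norm U (s i \<omega>))" for i
    using s[of i] simple_function_compose1[of M "s i" "Linf_norm U"] by (simp add: Linf_simple_def)
  have norm_close: "\<bar>Linf_norm U (F \<omega>) - Linf_norm U (s i \<omega>)\<bar> \<le> inverse (real (Suc i))"
    if "\<omega> \<in> space M" for i \<omega>
    using Linf_norm_reverse_triangle[OF Linf_uniformly_approximable_in_Linf[OF F that]
        Linf_simple_in_Linf[OF s that]] F_s[OF that] by (rule order.trans)
  have norm_measurable: "(\<lambda>\<omega>. Linf_norm U (F \<omega>)) \<in> borel_measurable M"
  proof (rule borel_measurable_LIMSEQ_real)
    show "(\<lambda>\<omega>. Linf_norm U (s i \<omega>)) \<in> borel_measurable M" for i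
      by (rule borel_measurable_simple_function[OF s_measurable])
    fix \<omega>
    assume "\<omega> \<in> space M"
    then have "(\<lambda>i. Linf_norm U (s i \<omega>) - Linf_norm U (F \<omega>)) \<longlonglongrightarrow> 0"
      by (intro tendsto_rabs_zero_cancel[OF
            tendsto_sandwich[OF _ _ tendsto_const LIMSEQ_inverse_real_of_nat]])
        (simp_all add: norm_close abs_minus_commute[of "Linf_norm U (s _ \<omega>)"] del: of_nat_Suc)
    then show "(\<lambda>i. Linf_norm U (s i \<omega>)) \<longlonglongrightarrow> Linf_norm U (F \<omega>)"
      by (simp add: LIM_zero_iff)
  qed
  have "Linf_norm U (F \<omega>) \<le> Max ((\<lambda>\<omega>. Linf_norm U (s 0 \<omega>)) ` space M) + 1"
    if "\<omega> \<in> space M" for \<omega>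
    using norm_close[OF that, of 0] Max_ge[OF simple_functionD(1)[OF s_measurable[of 0]] imageI[OF that]]
    by simp
  then have "AE \<omega> in M. norm (Linf_norm U (F \<omega>)) \<le> Max ((\<lambda>\<omega>. Linf_norm U (s 0 \<omega>)) ` space M) + 1"
    by (intro AE_I2) simp
  then show ?thesis
    using norm_measurable by (rule integrable_const_bound)
qed

section \<open>Signed measures and their total variation\<close>

lemma variation_uminus: "variation (\<lambda>A. - \<mu> A) = variation \<mu>"
  by (simp add: variation_def[abs_def] variation_sums_def)

lemma variation_sumsI:
  assumes "finite D" "partition_on A D" "D \<subseteq> sets borel"
  shows "(\<Sum>B\<in>D. \<bar>\<mu> B\<bar>) \<in> variation_sums \<mu> A"
  using assms by (auto simp: variation_sums_def)

lemma variation_least: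
  assumes "A \<in> sets borel"
    and "\<And>D. finite D \<Longrightarrow> partition_on A D \<Longrightarrow> D \<subseteq> sets borel \<Longrightarrow> (\<Sum>B\<in>D. \<bar>\<mu> B\<bar>) \<le> c"
  shows "variation \<mu> A \<le> c"
  unfolding variation_def
proof (rule cSup_least)
  have "partition_on A ({A} - {{}})"
    by (auto simp: partition_on_def disjoint_def)
  then show "variation_sums \<mu> A \<noteq> {}"
    using variation_sumsI[of "{A} - {{}}" A \<mu>] assms(1) by auto
qed (use assms(2) in \<open>auto simp: variation_sums_def\<close>)

locale signed_measure_on =
  fixes U :: "'a::euclidean_space set" and \<mu> :: "'a set \<Rightarrow> real"
  assumes domain_borel: "U \<in> sets borel"
    and sums_disjoint_UN: "\<And>A :: nat \<Rightarrow> 'a set. range A \<subseteq> sets (restrict_space borel U) \<Longrightarrow>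
      disjoint_family A \<Longrightarrow> (\<lambda>i. \<mu> (A i)) sums \<mu> (\<Union>i. A i)"
    and bdd_above_variation_sums_domain: "bdd_above (variation_sums \<mu> U)"
begin

lemma measurable_iff: "A \<in> sets (restrict_space borel U) \<longleftrightarrow> A \<in> sets borel \<and> A \<subseteq> U"
  using domain_borel by (auto simp: sets_restrict_space_iff)

lemma measure_empty: "\<mu> {} = 0"
proof -
  have "(\<lambda>i::nat. \<mu> {}) sums \<mu> (\<Union>i::nat. {})"
    by (rule sums_disjoint_UN) (auto simp: disjoint_family_on_def)
  then have "(\<lambda>i::nat. \<mu> {}) \<longlonglongrightarrow> 0"
    by (intro summable_LIMSEQ_zero sums_summable)
  then show ?thesis by (simp add: LIMSEQ_const_iff)
qed

lemma disjoint_sum_abs_le_variation_sum: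
  assumes D: "finite D" "disjoint D" "D \<subseteq> sets borel" "\<Union>D \<subseteq> A" and A: "A \<in> sets borel"
  obtains s where "s \<in> variation_sums \<mu> A" "(\<Sum>B\<in>D. \<bar>\<mu> B\<bar>) \<le> s"
proof
  define E where "E = insert (A - \<Union>D) D"
  have "disjoint E"
    using D(2) by (auto simp: E_def disjoint_def)
  moreover have "\<Union>E = A"
    using D(4) by (auto simp: E_def)
  ultimately have "partition_on A (E - {{}})"
    by (auto simp: partition_on_def disjoint_def)
  moreover have "E \<subseteq> sets borel"
    using D A by (auto simp: E_def intro!: sets.Diff sets.finite_Union)
  ultimately show "(\<Sum>B\<in>E - {{}}. \<bar>\<mu> B\<bar>) \<in> variation_sums \<mu> A"
    using D(1) by (intro variation_sumsI) (auto simp: E_def)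
  have "(\<Sum>B\<in>E - {{}}. \<bar>\<mu> B\<bar>) = (\<Sum>B\<in>E. \<bar>\<mu> B\<bar>)"
    using D(1) measure_empty by (intro sum.mono_neutral_left) (auto simp: E_def)
  moreover have "(\<Sum>B\<in>D. \<bar>\<mu> B\<bar>) \<le> (\<Sum>B\<in>E. \<bar>\<mu> B\<bar>)"
    using D(1) by (intro sum_mono2) (auto simp: E_def)
  ultimately show "(\<Sum>B\<in>D. \<bar>\<mu> B\<bar>) \<le> (\<Sum>B\<in>E - {{}}. \<bar>\<mu> B\<bar>)"
    by simp
qed

lemma bdd_above_variation_sums:
  assumes A: "A \<in> sets (restrict_space borel U)"
  shows "bdd_above (variation_sums \<mu> A)"
proof -
  obtain c where c: "\<And>s. s \<in> variation_sums \<mu> U \<Longrightarrow> s \<le> c"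
    using bdd_above_variation_sums_domain by (auto simp: bdd_above_def)
  have "(\<Sum>B\<in>D. \<bar>\<mu> B\<bar>) \<le> c" if "finite D" "partition_on A D" "D \<subseteq> sets borel" for D
  proof -
    have "disjoint D" "\<Union>D \<subseteq> U"
      using that A by (auto simp: partition_on_def measurable_iff)
    from disjoint_sum_abs_le_variation_sum[OF that(1) this(1) that(3) this(2) domain_borel]
    obtain s where "s \<in> variation_sums \<mu> U" "(\<Sum>B\<in>D. \<bar>\<mu> B\<bar>) \<le> s" .
    with c show ?thesis by force
  qed
  then show ?thesis
    by (intro bdd_aboveI[of _ c]) (auto simp: variation_sums_def)
qed

lemma sum_abs_le_variation:
  assumes A: "A \<in> sets (restrict_space borel U)"
    and D: "finite D" "disjoint D" "D \<subseteq> sets borel" "\<Union>D \<subseteq> A"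
  shows "(\<Sum>B\<in>D. \<bar>\<mu> B\<bar>) \<le> variation \<mu> A"
proof -
  have "A \<in> sets borel" using A by (simp add: measurable_iff)
  from disjoint_sum_abs_le_variation_sum[OF D this]
  obtain s where s: "s \<in> variation_sums \<mu> A" "(\<Sum>B\<in>D. \<bar>\<mu> B\<bar>) \<le> s" .
  have "s \<le> variation \<mu> A"
    unfolding variation_def using s(1) bdd_above_variation_sums[OF A] by (rule cSup_upper)
  with s(2) show ?thesis by simp
qed

lemma partition_sum_abs_le_variation:
  assumes "A \<in> sets (restrict_space borel U)" "finite D" "partition_on A D" "D \<subseteq> sets borel"
  shows "(\<Sum>B\<in>D. \<bar>\<mu> B\<bar>) \<le> variation \<mu> A"
  using assms partition_onD1[OF assms(3)] partition_onD2[OF assms(3)]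
  by (intro sum_abs_le_variation) simp_all

lemma sum_abs_le_variation_family:
  assumes A: "A \<in> sets (restrict_space borel U)"
    and B: "finite I" "disjoint_family_on B I" "\<And>i. i \<in> I \<Longrightarrow> B i \<in> sets borel" "\<And>i. i \<in> I \<Longrightarrow> B i \<subseteq> A"
  shows "(\<Sum>i\<in>I. \<bar>\<mu> (B i)\<bar>) \<le> variation \<mu> A"
proof -
  have "\<mu> (B i) = 0" if "i \<in> I" "j \<in> I" "i \<noteq> j" "B i = B j" for i j
    using disjoint_family_onD[OF B(2) that(1-3)] that(4) measure_empty by simp
  then have "(\<Sum>i\<in>I. \<bar>\<mu> (B i)\<bar>) = (\<Sum>C\<in>B ` I. \<bar>\<mu> C\<bar>)"
    using B(1) by (subst sum.reindex_nontrivial) (auto simp: comp_def)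
  also have "\<dots> \<le> variation \<mu> A"
    using B disjoint_family_on_disjoint_image[OF B(2)]
    by (intro sum_abs_le_variation A) auto
  finally show ?thesis .
qed

lemma abs_le_variation:
  assumes "A \<in> sets (restrict_space borel U)"
  shows "\<bar>\<mu> A\<bar> \<le> variation \<mu> A"
  using sum_abs_le_variation[OF assms, of "{A}"] assms by (simp add: measurable_iff)

lemma variation_nonneg: "A \<in> sets (restrict_space borel U) \<Longrightarrow> 0 \<le> variation \<mu> A"
  using abs_le_variation[of A] by simp

lemma variation_superadditive:
  assumes A: "A \<in> sets (restrict_space borel U)" and B: "B \<in> sets (restrict_space borel U)"
    and disjnt: "A \<inter> B = {}"
  shows "variation \<mu> A + variation \<mu> B \<le> variation \<mu> (A \<union> B)"
proof -
  have sum_le: "(\<Sum>C\<in>D. \<bar>\<mu> C\<bar>) + (\<Sum>C\<in>E. \<bar>\<mu> C\<bar>) \<le> variation \<mu> (A \<union> B)"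
    if D: "finite D" "partition_on A D" "D \<subseteq> sets borel"
      and E: "finite E" "partition_on B E" "E \<subseteq> sets borel" for D E
  proof -
    have "C = {}" if "C \<in> D" "C \<in> E" for C
    proof -
      have "C \<subseteq> A" "C \<subseteq> B"
        using that D(2) E(2) by (auto simp: partition_on_def)
      then show ?thesis using disjnt by blast
    qed
    then have "D \<inter> E = {}"
      using D(2) by (auto simp: partition_on_def)
    then have "(\<Sum>C\<in>D. \<bar>\<mu> C\<bar>) + (\<Sum>C\<in>E. \<bar>\<mu> C\<bar>) = (\<Sum>C\<in>D \<union> E. \<bar>\<mu> C\<bar>)"
      using D(1) E(1) by (intro sum.union_disjoint[symmetric])
    also have "\<dots> \<le> variation \<mu> (A \<union> B)"
      using D E disjnt
      by (intro sum_abs_le_variation sets.Un A B disjoint_union) (auto simp: partition_on_def)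
    finally show ?thesis .
  qed
  have "variation \<mu> A \<le> variation \<mu> (A \<union> B) - variation \<mu> B"
  proof (rule variation_least)
    fix D
    assume D: "finite D" "partition_on A D" "D \<subseteq> sets borel"
    have "variation \<mu> B \<le> variation \<mu> (A \<union> B) - (\<Sum>C\<in>D. \<bar>\<mu> C\<bar>)"
      using sum_le[OF D] B by (intro variation_least) (auto simp: measurable_iff algebra_simps)
    then show "(\<Sum>C\<in>D. \<bar>\<mu> C\<bar>) \<le> variation \<mu> (A \<union> B) - variation \<mu> B" by simp
  qed (use A in \<open>simp add: measurable_iff\<close>)
  then show ?thesis by simp
qed

lemma variation_mono:
  assumes A: "A \<in> sets (restrict_space borel U)" and B: "B \<in> sets (restrict_space borel U)"
    and "A \<subseteq> B"
  shows "variation \<mu> A \<le> variation \<mu> B"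
proof -
  have "A \<union> (B - A) = B" using \<open>A \<subseteq> B\<close> by blast
  moreover have "B - A \<in> sets (restrict_space borel U)" using B A by (rule sets.Diff)
  ultimately show ?thesis
    using variation_superadditive[OF A, of "B - A"] variation_nonneg[of "B - A"] by auto
qed

lemma sum_variation_le:
  fixes A :: "nat \<Rightarrow> 'a set"
  assumes A: "range A \<subseteq> sets (restrict_space borel U)" "disjoint_family A"
  shows "(\<Sum>i<n. variation \<mu> (A i)) \<le> variation \<mu> (\<Union>i<n. A i)"
proof (induction n)
  case 0
  then show ?case using variation_nonneg[of "{}"] by simp
next
  case (Suc n)
  have "A i \<inter> A n = {}" if "i < n" for i
    using that by (intro disjoint_family_onD[OF A(2)]) auto
  then have "(\<Union>i<n. A i) \<inter> A n = {}" by blast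
  then have "variation \<mu> (\<Union>i<n. A i) + variation \<mu> (A n) \<le> variation \<mu> ((\<Union>i<n. A i) \<union> A n)"
    using A(1) by (intro variation_superadditive) auto
  also have "(\<Union>i<n. A i) \<union> A n = (\<Union>i<Suc n. A i)"
    by (auto simp: less_Suc_eq)
  finally show ?case using Suc by simp
qed

lemma
  fixes A :: "nat \<Rightarrow> 'a set"
  assumes A: "range A \<subseteq> sets (restrict_space borel U)" "disjoint_family A"
  shows summable_variation: "summable (\<lambda>i. variation \<mu> (A i))"
    and suminf_variation_le: "(\<Sum>i. variation \<mu> (A i)) \<le> variation \<mu> (\<Union>i. A i)"
proof -
  have UN: "(\<Union>i. A i) \<in> sets (restrict_space borel U)"
    using A(1) by (intro sets.countable_UN) auto
  have partial: "(\<Sum>i<n. variation \<mu> (A i)) \<le> variation \<mu> (\<Union>i. A i)" for n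
    using A(1) by (intro order.trans[OF sum_variation_le[OF A] variation_mono] UN) auto
  have nonneg: "0 \<le> variation \<mu> (A i)" for i
    using A(1) by (intro variation_nonneg) auto
  show summable: "summable (\<lambda>i. variation \<mu> (A i))"
    by (rule bounded_imp_summable[of _ "variation \<mu> (\<Union>i. A i)", OF nonneg])
      (use partial[of "Suc _"] in \<open>simp add: lessThan_Suc_atMost\<close>)
  then show "(\<Sum>i. variation \<mu> (A i)) \<le> variation \<mu> (\<Union>i. A i)"
    using partial by (rule suminf_le_const)
qed

lemma
  fixes A :: "nat \<Rightarrow> 'a set"
  assumes A: "range A \<subseteq> sets (restrict_space borel U)" "disjoint_family A"
    and B: "B \<in> sets borel" "B \<subseteq> (\<Union>i. A i)"
  shows summable_abs_Int: "summable (\<lambda>i. \<bar>\<mu> (B \<inter> A i)\<bar>)"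
    and abs_le_suminf_abs_Int: "\<bar>\<mu> B\<bar> \<le> (\<Sum>i. \<bar>\<mu> (B \<inter> A i)\<bar>)"
proof -
  have Int: "B \<inter> A i \<in> sets (restrict_space borel U)" for i
    using A(1) B by (auto simp: measurable_iff image_subset_iff)
  have "\<bar>\<mu> (B \<inter> A i)\<bar> \<le> variation \<mu> (A i)" for i
    using A(1) by (intro order.trans[OF abs_le_variation[OF Int] variation_mono[OF Int]]) auto
  then show summable: "summable (\<lambda>i. \<bar>\<mu> (B \<inter> A i)\<bar>)"
    by (intro summable_comparison_test'[OF summable_variation[OF A]]) simp
  have "(\<lambda>i. \<mu> (B \<inter> A i)) sums \<mu> (\<Union>i. B \<inter> A i)"
    using Int A(2) by (intro sums_disjoint_UN) (auto simp: disjoint_family_on_def)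
  moreover have "(\<Union>i. B \<inter> A i) = B" using B(2) by auto
  ultimately have "\<mu> B = (\<Sum>i. \<mu> (B \<inter> A i))" by (simp add: sums_iff)
  then show "\<bar>\<mu> B\<bar> \<le> (\<Sum>i. \<bar>\<mu> (B \<inter> A i)\<bar>)"
    using summable_rabs[OF summable] by simp
qed

lemma variation_UN_le_suminf:
  fixes A :: "nat \<Rightarrow> 'a set"
  assumes A: "range A \<subseteq> sets (restrict_space borel U)" "disjoint_family A"
  shows "variation \<mu> (\<Union>i. A i) \<le> (\<Sum>i. variation \<mu> (A i))"
proof (rule variation_least)
  show "(\<Union>i. A i) \<in> sets borel"
    using A(1) by (auto simp: measurable_iff image_subset_iff)
  fix D
  assume D: "finite D" "partition_on (\<Union>i. A i) D" "D \<subseteq> sets borel"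
  have B: "B \<in> sets borel" "B \<subseteq> (\<Union>i. A i)" if "B \<in> D" for B
    using D that by (auto simp: partition_on_def)
  note summable = summable_abs_Int[OF A B]
  have "(\<Sum>B\<in>D. \<bar>\<mu> B\<bar>) \<le> (\<Sum>B\<in>D. \<Sum>i. \<bar>\<mu> (B \<inter> A i)\<bar>)"
    by (intro sum_mono abs_le_suminf_abs_Int[OF A B])
  also have "\<dots> = (\<Sum>i. \<Sum>B\<in>D. \<bar>\<mu> (B \<inter> A i)\<bar>)"
    by (intro suminf_sum[symmetric] summable)
  also have "\<dots> \<le> (\<Sum>i. variation \<mu> (A i))"
  proof (rule suminf_le[OF _ summable_sum[OF summable] summable_variation[OF A]])
    fix i
    have "disjoint_family_on (\<lambda>B. B \<inter> A i) D"
      using D(2) unfolding disjoint_family_on_def partition_on_def disjoint_def by blast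
    then show "(\<Sum>B\<in>D. \<bar>\<mu> (B \<inter> A i)\<bar>) \<le> variation \<mu> (A i)"
      using A(1) B(1) D(1) by (intro sum_abs_le_variation_family)
        (auto simp: measurable_iff image_subset_iff)
  qed
  finally show "(\<Sum>B\<in>D. \<bar>\<mu> B\<bar>) \<le> (\<Sum>i. variation \<mu> (A i))" .
qed

lemma sums_variation:
  fixes A :: "nat \<Rightarrow> 'a set"
  assumes A: "range A \<subseteq> sets (restrict_space borel U)" "disjoint_family A"
  shows "(\<lambda>i. variation \<mu> (A i)) sums variation \<mu> (\<Union>i. A i)"
  using summable_variation[OF A] suminf_variation_le[OF A] variation_UN_le_suminf[OF A]
  by (simp add: sums_iff)

lemma variation_empty: "variation \<mu> {} = 0"
proof (rule antisym)
  show "variation \<mu> {} \<le> 0"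
    by (rule variation_least) (auto simp: partition_on_empty)
qed (simp add: variation_nonneg)

end

lemma signed_measure_on_signed_radon:
  assumes "\<mu> \<in> signed_radon U" "U \<in> sets borel"
  shows "signed_measure_on U \<mu>"
  using assms unfolding signed_radon_def by unfold_locales auto

lemma signed_measure_on_uminus:
  assumes "signed_measure_on U \<mu>"
  shows "signed_measure_on U (\<lambda>A. - \<mu> A)"
proof -
  interpret signed_measure_on U \<mu> by fact
  have "variation_sums (\<lambda>A. - \<mu> A) U = variation_sums \<mu> U"
    by (simp add: variation_sums_def)
  then show ?thesis
    using domain_borel sums_disjoint_UN bdd_above_variation_sums_domain
    by unfold_locales (auto intro: sums_minus)
qed

lemma
  assumes "signed_measure_on U \<mu>" "signed_measure_on U \<nu>"
  shows signed_measure_on_diff: "signed_measure_on U (\<lambda>A. \<mu> A - \<nu> A)"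
    and variation_le_variation_diff: "variation \<mu> U \<le> variation \<nu> U + variation (\<lambda>A. \<mu> A - \<nu> A) U"
proof -
  interpret \<mu>: signed_measure_on U \<mu> by fact
  interpret \<nu>: signed_measure_on U \<nu> by fact
  have U: "U \<in> sets (restrict_space borel U)"
    using \<mu>.domain_borel by (simp add: \<mu>.measurable_iff)
  note sum_le = \<mu>.partition_sum_abs_le_variation[OF U] \<nu>.partition_sum_abs_le_variation[OF U]
  show diff: "signed_measure_on U (\<lambda>A. \<mu> A - \<nu> A)"
  proof
    have "(\<Sum>B\<in>D. \<bar>\<mu> B - \<nu> B\<bar>) \<le> variation \<mu> U + variation \<nu> U"
      if "finite D" "partition_on U D" "D \<subseteq> sets borel" for D
    proof -
      have "(\<Sum>B\<in>D. \<bar>\<mu> B - \<nu> B\<bar>) \<le> (\<Sum>B\<in>D. \<bar>\<mu> B\<bar> + \<bar>\<nu> B\<bar>)"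
        by (intro sum_mono) simp
      with sum_le(1)[OF that] sum_le(2)[OF that] show ?thesis by (simp add: sum.distrib)
    qed
    then show "bdd_above (variation_sums (\<lambda>A. \<mu> A - \<nu> A) U)"
      by (intro bdd_aboveI[of _ "variation \<mu> U + variation \<nu> U"]) (auto simp: variation_sums_def)
  qed (use \<mu>.domain_borel in \<open>auto intro: sums_diff \<mu>.sums_disjoint_UN \<nu>.sums_disjoint_UN\<close>)
  interpret \<kappa>: signed_measure_on U "\<lambda>A. \<mu> A - \<nu> A" by (rule diff)
  show "variation \<mu> U \<le> variation \<nu> U + variation (\<lambda>A. \<mu> A - \<nu> A) U"
  proof (rule variation_least[OF \<mu>.domain_borel])
    fix D
    assume D: "finite D" "partition_on U D" "D \<subseteq> sets borel"
    have "(\<Sum>B\<in>D. \<bar>\<mu> B\<bar>) \<le> (\<Sum>B\<in>D. \<bar>\<nu> B\<bar> + \<bar>\<mu> B - \<nu> B\<bar>)"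
      by (intro sum_mono) simp
    moreover have "(\<Sum>B\<in>D. \<bar>\<mu> B - \<nu> B\<bar>) \<le> variation (\<lambda>A. \<mu> A - \<nu> A) U"
      by (rule \<kappa>.partition_sum_abs_le_variation[OF U D])
    ultimately show "(\<Sum>B\<in>D. \<bar>\<mu> B\<bar>) \<le> variation \<nu> U + variation (\<lambda>A. \<mu> A - \<nu> A) U"
      using sum_le(2)[OF D] by (simp add: sum.distrib)
  qed
qed

section \<open>Integration against a signed measure\<close>

lemma neg_variation_eq: "neg_variation U \<mu> = pos_variation U (\<lambda>A. - \<mu> A)"
  by (simp add: neg_variation_def pos_variation_def variation_uminus)

context signed_measure_on
begin

lemma
  shows sets_pos_variation: "sets (pos_variation U \<mu>) = sets (restrict_space borel U)"
    and emeasure_pos_variation: "A \<in> sets (restrict_space borel U) \<Longrightarrow>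
      emeasure (pos_variation U \<mu>) A = ennreal ((variation \<mu> A + \<mu> A) / 2)"
proof -
  let ?R = "sets (restrict_space borel U)"
  have sigma: "sigma_algebra U ?R"
    using sets.sigma_algebra_axioms[of "restrict_space borel U"] by (simp add: space_restrict_space)
  show "sets (pos_variation U \<mu>) = ?R"
    unfolding pos_variation_def using sigma_algebra.sigma_sets_eq[OF sigma]
    by (subst sets_measure_of) (auto simp: measurable_iff)
  have nonneg: "0 \<le> (variation \<mu> A + \<mu> A) / 2" if "A \<in> ?R" for A
    using abs_le_variation[OF that] by simp
  have "countably_additive ?R (\<lambda>A. ennreal ((variation \<mu> A + \<mu> A) / 2))"
  proof (rule countably_additiveI)
    fix A :: "nat \<Rightarrow> 'a set"
    assume A: "range A \<subseteq> ?R" "disjoint_family A"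
    have "(\<lambda>i. (variation \<mu> (A i) + \<mu> (A i)) / 2) sums ((variation \<mu> (\<Union>i. A i) + \<mu> (\<Union>i. A i)) / 2)"
      by (intro sums_divide sums_add sums_variation sums_disjoint_UN A)
    then show "(\<Sum>i. ennreal ((variation \<mu> (A i) + \<mu> (A i)) / 2)) =
        ennreal ((variation \<mu> (\<Union>i. A i) + \<mu> (\<Union>i. A i)) / 2)"
      using A(1) by (intro suminf_ennreal_eq nonneg) auto
  qed
  then show "emeasure (pos_variation U \<mu>) A = ennreal ((variation \<mu> A + \<mu> A) / 2)" if "A \<in> ?R"
    unfolding pos_variation_def using that
    by (intro emeasure_measure_of_sigma[OF sigma])
      (auto simp: positive_def variation_empty measure_empty)
qed

lemma space_pos_variation: "space (pos_variation U \<mu>) = U"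
  using sets_eq_imp_space_eq[OF sets_pos_variation] by (simp add: space_restrict_space)

lemma measure_pos_variation:
  assumes "A \<in> sets (restrict_space borel U)"
  shows "measure (pos_variation U \<mu>) A = (variation \<mu> A + \<mu> A) / 2"
  using emeasure_pos_variation[OF assms] abs_le_variation[OF assms] by (simp add: measure_def)

lemma finite_measure_pos_variation: "finite_measure (pos_variation U \<mu>)"
  using emeasure_pos_variation[of U] domain_borel
  by (intro finite_measureI) (simp add: space_pos_variation measurable_iff)

lemma
  assumes \<phi>: "\<phi> \<in> borel_measurable (restrict_space borel U)" "\<And>y. y \<in> U \<Longrightarrow> \<bar>\<phi> y\<bar> \<le> B"
  shows integrable_pos_variation: "integrable (pos_variation U \<mu>) \<phi>"
    and abs_integral_pos_variation_le:
      "\<bar>\<integral>y. \<phi> y \<partial>pos_variation U \<mu>\<bar> \<le> B * ((variation \<mu> U + \<mu> U) / 2)"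
proof -
  interpret pos: finite_measure "pos_variation U \<mu>" by (rule finite_measure_pos_variation)
  have "\<phi> \<in> borel_measurable (pos_variation U \<mu>)"
    using \<phi>(1) by (simp add: measurable_cong_sets[OF sets_pos_variation refl])
  then show integrable: "integrable (pos_variation U \<mu>) \<phi>"
    using \<phi>(2) by (intro pos.integrable_const_bound[of _ B]) (auto simp: space_pos_variation)
  have "\<bar>\<integral>y. \<phi> y \<partial>pos_variation U \<mu>\<bar> \<le> (\<integral>y. \<bar>\<phi> y\<bar> \<partial>pos_variation U \<mu>)"
    by (rule integral_abs_bound)
  also have "\<dots> \<le> (\<integral>y. B \<partial>pos_variation U \<mu>)"
    using integrable \<phi>(2) by (intro integral_mono) (auto simp: space_pos_variation)
  finally show "\<bar>\<integral>y. \<phi> y \<partial>pos_variation U \<mu>\<bar> \<le> B * ((variation \<mu> U + \<mu> U) / 2)"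
    using domain_borel by (simp add: space_pos_variation measure_pos_variation measurable_iff mult.commute)
qed

lemma integral_pos_variation_simple_function:
  fixes s :: "'a \<Rightarrow> real"
  assumes "simple_function (restrict_space borel U) s"
  shows "(\<integral>y. s y \<partial>pos_variation U \<mu>) =
    (\<Sum>c\<in>s ` U. (variation \<mu> {y \<in> U. s y = c} + \<mu> {y \<in> U. s y = c}) / 2 * c)"
proof -
  interpret pos: finite_measure "pos_variation U \<mu>" by (rule finite_measure_pos_variation)
  have simple: "simple_function (pos_variation U \<mu>) s"
    using assms by (intro simple_function_cong_algebra[THEN iffD1, OF sets_pos_variation])
      (auto simp: space_pos_variation space_restrict_space)
  have simple_integrable: "Bochner_Integration.simple_bochner_integrable (pos_variation U \<mu>) s"
    using simple by (simp add: simple_bochner_integrable.simps)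
  have "(\<integral>y. s y \<partial>pos_variation U \<mu>) =
      (\<Sum>c\<in>s ` U. measure (pos_variation U \<mu>) {y \<in> U. s y = c} * c)"
    using simple_bochner_integral_partition[OF simple_integrable simple, of "\<lambda>c. c"]
    by (simp add: simple_bochner_integrable_eq_integral[OF simple_integrable] space_pos_variation)
  also have "\<dots> = (\<Sum>c\<in>s ` U. (variation \<mu> {y \<in> U. s y = c} + \<mu> {y \<in> U. s y = c}) / 2 * c)"
  proof (intro sum.cong refl)
    fix c
    have "s -` {c} \<inter> space (restrict_space borel U) \<in> sets (restrict_space borel U)"
      by (rule simple_functionD(2)[OF assms])
    moreover have "s -` {c} \<inter> space (restrict_space borel U) = {y \<in> U. s y = c}"
      by (auto simp: space_restrict_space)
    ultimately show "measure (pos_variation U \<mu>) {y \<in> U. s y = c} * c =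
        (variation \<mu> {y \<in> U. s y = c} + \<mu> {y \<in> U. s y = c}) / 2 * c"
      by (simp add: measure_pos_variation)
  qed
  finally show ?thesis .
qed

interpretation uminus: signed_measure_on U "\<lambda>A. - \<mu> A"
  by (rule signed_measure_on_uminus) unfold_locales

lemma abs_signed_integral_le:
  assumes \<phi>: "\<phi> \<in> borel_measurable (restrict_space borel U)" "\<And>y. y \<in> U \<Longrightarrow> \<bar>\<phi> y\<bar> \<le> B"
  shows "\<bar>signed_integral U \<mu> \<phi>\<bar> \<le> B * variation \<mu> U"
proof -
  have "B * ((variation \<mu> U + \<mu> U) / 2) + B * ((variation \<mu> U - \<mu> U) / 2) = B * variation \<mu> U"
    by (simp add: field_simps)
  then show ?thesis
    using abs_integral_pos_variation_le[OF \<phi>] uminus.abs_integral_pos_variation_le[OF \<phi>]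
    unfolding signed_integral_def neg_variation_eq by (simp add: variation_uminus)
qed

lemma signed_integral_diff:
  assumes \<phi>: "\<phi> \<in> borel_measurable (restrict_space borel U)" "\<And>y. y \<in> U \<Longrightarrow> \<bar>\<phi> y\<bar> \<le> B"
    and \<psi>: "\<psi> \<in> borel_measurable (restrict_space borel U)" "\<And>y. y \<in> U \<Longrightarrow> \<bar>\<psi> y\<bar> \<le> C"
  shows "signed_integral U \<mu> (\<lambda>y. \<phi> y - \<psi> y) = signed_integral U \<mu> \<phi> - signed_integral U \<mu> \<psi>"
  using integrable_pos_variation[OF \<phi>] integrable_pos_variation[OF \<psi>]
    uminus.integrable_pos_variation[OF \<phi>] uminus.integrable_pos_variation[OF \<psi>]
  unfolding signed_integral_def neg_variation_eq by simp

lemma signed_integral_simple_function: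
  fixes s :: "'a \<Rightarrow> real"
  assumes "simple_function (restrict_space borel U) s"
  shows "signed_integral U \<mu> s = (\<Sum>c\<in>s ` U. c * \<mu> {y \<in> U. s y = c})"
  unfolding signed_integral_def neg_variation_eq integral_pos_variation_simple_function[OF assms]
    uminus.integral_pos_variation_simple_function[OF assms] sum_subtractf[symmetric]
  by (intro sum.cong) (auto simp: variation_uminus field_simps)

lemma signed_integral_LIMSEQ:
  assumes s: "\<And>i::nat. s i \<in> borel_measurable (restrict_space borel U)"
    and \<phi>: "\<phi> \<in> borel_measurable (restrict_space borel U)"
    and lim: "\<And>y. y \<in> U \<Longrightarrow> (\<lambda>i. s i y) \<longlonglongrightarrow> \<phi> y"
    and bound: "\<And>i y. y \<in> U \<Longrightarrow> \<bar>s i y\<bar> \<le> B"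
  shows "(\<lambda>i. signed_integral U \<mu> (s i)) \<longlonglongrightarrow> signed_integral U \<mu> \<phi>"
proof -
  have "(\<lambda>i. \<integral>y. s i y \<partial>pos_variation U \<nu>) \<longlonglongrightarrow> (\<integral>y. \<phi> y \<partial>pos_variation U \<nu>)"
    if "signed_measure_on U \<nu>" for \<nu>
  proof -
    interpret \<nu>: signed_measure_on U \<nu> by fact
    interpret pos: finite_measure "pos_variation U \<nu>" by (rule \<nu>.finite_measure_pos_variation)
    show ?thesis
      by (rule integral_dominated_convergence[where w="\<lambda>_. B"])
        (use s \<phi> lim bound in \<open>auto simp: \<nu>.space_pos_variation
          measurable_cong_sets[OF \<nu>.sets_pos_variation refl]\<close>)
  qed
  from this[OF signed_measure_on_axioms] this[OF uminus.signed_measure_on_axioms] show ?thesis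
    unfolding signed_integral_def neg_variation_eq by (rule tendsto_diff)
qed

end

lemma signed_integral_measure_diff:
  assumes "signed_measure_on U \<mu>" "signed_measure_on U \<nu>"
    and \<phi>: "\<phi> \<in> borel_measurable (restrict_space borel U)" "\<And>y. y \<in> U \<Longrightarrow> \<bar>\<phi> y\<bar> \<le> B"
  shows "signed_integral U (\<lambda>A. \<mu> A - \<nu> A) \<phi> = signed_integral U \<mu> \<phi> - signed_integral U \<nu> \<phi>"
proof -
  interpret \<mu>: signed_measure_on U \<mu> by fact
  interpret \<nu>: signed_measure_on U \<nu> by fact
  interpret diff: signed_measure_on U "\<lambda>A. \<mu> A - \<nu> A"
    by (rule signed_measure_on_diff) fact+
  from borel_measurable_implies_sequence_metric[OF \<phi>(1), of 0]
  obtain s where s: "\<And>i. simple_function (restrict_space borel U) (s i)"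
    and lim: "\<And>y. y \<in> U \<Longrightarrow> (\<lambda>i. s i y) \<longlonglongrightarrow> \<phi> y" and s_le: "\<And>i y. y \<in> U \<Longrightarrow> \<bar>s i y\<bar> \<le> 2 * \<bar>\<phi> y\<bar>"
    by (simp add: space_restrict_space) metis
  have bound: "\<bar>s i y\<bar> \<le> 2 * B" if "y \<in> U" for i y
    using s_le[OF that, of i] \<phi>(2)[OF that] by simp
  note limits = borel_measurable_simple_function[OF s] \<phi>(1) lim bound
  have "signed_integral U (\<lambda>A. \<mu> A - \<nu> A) (s i) =
      signed_integral U \<mu> (s i) - signed_integral U \<nu> (s i)" for i
    using s by (simp add: \<mu>.signed_integral_simple_function \<nu>.signed_integral_simple_function
        diff.signed_integral_simple_function right_diff_distrib sum_subtractf)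
  then have "(\<lambda>i. signed_integral U \<mu> (s i) - signed_integral U \<nu> (s i))
      \<longlonglongrightarrow> signed_integral U (\<lambda>A. \<mu> A - \<nu> A) \<phi>"
    using diff.signed_integral_LIMSEQ[OF limits] by simp
  moreover have "(\<lambda>i. signed_integral U \<mu> (s i) - signed_integral U \<nu> (s i))
      \<longlonglongrightarrow> signed_integral U \<mu> \<phi> - signed_integral U \<nu> \<phi>"
    by (intro tendsto_diff \<mu>.signed_integral_LIMSEQ[OF limits] \<nu>.signed_integral_LIMSEQ[OF limits])
  ultimately show ?thesis by (rule LIMSEQ_unique)
qed

lemma abs_signed_integral_measure_diff_le:
  assumes "\<mu> \<in> signed_radon U" "\<nu> \<in> signed_radon U" and U: "U \<in> sets borel"
    and \<phi>: "\<phi> \<in> borel_measurable (restrict_space borel U)" "\<And>y. y \<in> U \<Longrightarrow> \<bar>\<phi> y\<bar> \<le> B"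
  shows "\<bar>signed_integral U \<mu> \<phi> - signed_integral U \<nu> \<phi>\<bar> \<le> B * tv_dist U \<mu> \<nu>"
proof -
  have \<mu>: "signed_measure_on U \<mu>" and \<nu>: "signed_measure_on U \<nu>"
    using assms by (auto intro: signed_measure_on_signed_radon)
  show ?thesis
    using signed_measure_on.abs_signed_integral_le[OF signed_measure_on_diff[OF \<mu> \<nu>] \<phi>] assms(1,2)
    by (simp add: signed_integral_measure_diff[OF \<mu> \<nu> \<phi>] tv_dist_def)
qed

section \<open>Equicontinuous random functions\<close>

lemma simple_function_floor:
  fixes g :: "'w \<Rightarrow> real"
  assumes g: "g \<in> borel_measurable M" and bound: "\<And>\<omega>. \<omega> \<in> space M \<Longrightarrow> \<bar>g \<omega>\<bar> \<le> B"
  shows "simple_function M (\<lambda>\<omega>. \<lfloor>g \<omega>\<rfloor>)"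
  unfolding simple_function_def
proof (intro conjI ballI)
  have "\<lfloor>g \<omega>\<rfloor> \<in> {\<lfloor>- B\<rfloor>..\<lfloor>B\<rfloor>}" if "\<omega> \<in> space M" for \<omega>
    using abs_le_D1[OF bound[OF that]] abs_le_D2[OF bound[OF that]]
    unfolding atLeastAtMost_iff by (intro conjI floor_mono) simp_all
  then have "(\<lambda>\<omega>. \<lfloor>g \<omega>\<rfloor>) ` space M \<subseteq> {\<lfloor>- B\<rfloor>..\<lfloor>B\<rfloor>}"
    by (rule image_subsetI)
  then show "finite ((\<lambda>\<omega>. \<lfloor>g \<omega>\<rfloor>) ` space M)"
    by (rule finite_subset) simp
  have "(\<lambda>\<omega>. \<lfloor>g \<omega>\<rfloor>) \<in> measurable M (count_space UNIV)"
    using g by measurable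
  then show "(\<lambda>\<omega>. \<lfloor>g \<omega>\<rfloor>) -` {q} \<inter> space M \<in> sets M" for q
    by (rule measurable_sets) simp
qed

lemma simple_function_restrict:
  assumes "finite S" and k: "\<And>x. x \<in> S \<Longrightarrow> simple_function M (\<lambda>\<omega>. k \<omega> x)"
  shows "simple_function M (\<lambda>\<omega>. restrict (k \<omega>) S)"
  unfolding simple_function_def
proof (intro conjI ballI)
  have "(\<lambda>\<omega>. restrict (k \<omega>) S) ` space M \<subseteq> (\<Pi>\<^sub>E x\<in>S. (\<lambda>\<omega>. k \<omega> x) ` space M)"
    by auto
  then show "finite ((\<lambda>\<omega>. restrict (k \<omega>) S) ` space M)"
    using finite_PiE[OF \<open>finite S\<close> simple_functionD(1)[OF k]] by (rule finite_subset)
  fix q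
  assume "q \<in> (\<lambda>\<omega>. restrict (k \<omega>) S) ` space M"
  then obtain \<omega>' where q: "q = restrict (k \<omega>') S" by auto
  have "restrict (k \<omega>) S = q \<longleftrightarrow> (\<forall>x\<in>S. k \<omega> x = q x)" for \<omega>
    unfolding q by (metis restrict_apply' restrict_ext)
  then have "(\<lambda>\<omega>. restrict (k \<omega>) S) -` {q} \<inter> space M = {\<omega> \<in> space M. \<forall>x\<in>S. k \<omega> x = q x}"
    by auto
  also have "\<dots> \<in> sets M"
  proof (rule sets.sets_Collect_finite_All[OF _ \<open>finite S\<close>])
    fix x
    assume "x \<in> S"
    have "{\<omega> \<in> space M. k \<omega> x = q x} = (\<lambda>\<omega>. k \<omega> x) -` {q x} \<inter> space M" by auto
    then show "{\<omega> \<in> space M. k \<omega> x = q x} \<in> sets M"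
      using simple_functionD(2)[OF k[OF \<open>x \<in> S\<close>]] by simp
  qed
  finally show "(\<lambda>\<omega>. restrict (k \<omega>) S) -` {q} \<inter> space M \<in> sets M" .
qed

lemma abs_diff_le_of_floor_eq:
  fixes x y \<eta> :: real
  assumes "0 < \<eta>" "\<lfloor>x / \<eta>\<rfloor> = \<lfloor>y / \<eta>\<rfloor>"
  shows "\<bar>x - y\<bar> \<le> \<eta>"
proof -
  have "\<bar>x / \<eta> - y / \<eta>\<bar> \<le> 1"
    using assms(2) by linarith
  then show ?thesis
    using \<open>0 < \<eta>\<close> by (simp add: field_simps flip: diff_divide_distrib)
qed

text \<open>Arzela--Ascoli: the values on a finite net of \<open>U\<close>, rounded to a grid, determine the function
  uniformly up to \<open>e\<close>.\<close>

lemma equicontinuous_finite_cells: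
  fixes V :: "'w \<Rightarrow> 'a::metric_space \<Rightarrow> real"
  assumes U: "Met_TC.mtotally_bounded U"
    and measurable: "\<And>x. x \<in> U \<Longrightarrow> (\<lambda>\<omega>. V \<omega> x) \<in> borel_measurable M"
    and bounded: "\<And>\<omega> x. \<omega> \<in> space M \<Longrightarrow> x \<in> U \<Longrightarrow> \<bar>V \<omega> x\<bar> \<le> B"
    and equicontinuous: "\<And>e. 0 < e \<Longrightarrow> \<exists>d>0. \<forall>\<omega>\<in>space M. \<forall>x\<in>U. \<forall>x'\<in>U.
      dist x x' < d \<longrightarrow> \<bar>V \<omega> x - V \<omega> x'\<bar> \<le> e"
    and "0 < e"
  shows "\<exists>c :: 'w \<Rightarrow> 'a \<Rightarrow> int. simple_function M c \<and>
    (\<forall>\<omega>\<in>space M. \<forall>\<omega>'\<in>space M. c \<omega> = c \<omega>' \<longrightarrow> (\<forall>x\<in>U. \<bar>V \<omega> x - V \<omega>' x\<bar> \<le> e))"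
proof -
  define \<eta> where "\<eta> = e / 3"
  have "0 < \<eta>" using \<open>0 < e\<close> by (simp add: \<eta>_def)
  obtain d where "0 < d" and near: "\<And>\<omega> x x'. \<omega> \<in> space M \<Longrightarrow> x \<in> U \<Longrightarrow> x' \<in> U \<Longrightarrow>
      dist x x' < d \<Longrightarrow> \<bar>V \<omega> x - V \<omega> x'\<bar> \<le> \<eta>"
    using equicontinuous[OF \<open>0 < \<eta>\<close>] by blast
  then obtain S where S: "finite S" "S \<subseteq> U" "U \<subseteq> (\<Union>x\<in>S. ball x d)"
    using U unfolding Met_TC.mtotally_bounded_def by (auto simp: ball_def)
  define c where "c \<omega> = restrict (\<lambda>x. \<lfloor>V \<omega> x / \<eta>\<rfloor>) S" for \<omega>
  have "simple_function M (\<lambda>\<omega>. \<lfloor>V \<omega> x / \<eta>\<rfloor>)" if "x \<in> S" for x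
  proof (rule simple_function_floor)
    show "(\<lambda>\<omega>. V \<omega> x / \<eta>) \<in> borel_measurable M"
      using measurable[of x] S(2) that by (intro borel_measurable_divide) auto
    show "\<bar>V \<omega> x / \<eta>\<bar> \<le> B / \<eta>" if "\<omega> \<in> space M" for \<omega>
      using bounded[OF that, of x] S(2) \<open>x \<in> S\<close> \<open>0 < \<eta>\<close>
      by (auto simp: abs_divide intro!: divide_right_mono)
  qed
  then have "simple_function M c"
    unfolding c_def by (intro simple_function_restrict S(1))
  moreover have "\<bar>V \<omega> y - V \<omega>' y\<bar> \<le> e"
    if \<omega>: "\<omega> \<in> space M" "\<omega>' \<in> space M" "c \<omega> = c \<omega>'" and y: "y \<in> U" for \<omega> \<omega>' y
  proof -
    obtain x where x: "x \<in> S" "x \<in> U" "dist x y < d"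
      using S y by fastforce
    have "\<bar>V \<omega> x - V \<omega>' x\<bar> \<le> \<eta>"
      using fun_cong[OF \<omega>(3), of x] x(1) by (intro abs_diff_le_of_floor_eq \<open>0 < \<eta>\<close>) (simp add: c_def)
    moreover have "\<bar>V \<omega> x - V \<omega> y\<bar> \<le> \<eta>" "\<bar>V \<omega>' x - V \<omega>' y\<bar> \<le> \<eta>"
      using near \<omega> x y by auto
    ultimately show ?thesis
      unfolding \<eta>_def by linarith
  qed
  ultimately show ?thesis
    by (intro exI[of _ c]) simp
qed

lemma Linf_uniformly_approximable_equicontinuous:
  fixes V :: "'w \<Rightarrow> 'a::euclidean_space \<Rightarrow> real"
  assumes "bounded U" and V: "V \<in> space M \<rightarrow> Linf U"
    and measurable: "\<And>x. x \<in> U \<Longrightarrow> (\<lambda>\<omega>. V \<omega> x) \<in> borel_measurable M"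
    and bounded: "\<And>\<omega> x. \<omega> \<in> space M \<Longrightarrow> x \<in> U \<Longrightarrow> \<bar>V \<omega> x\<bar> \<le> B"
    and equicontinuous: "\<And>e. 0 < e \<Longrightarrow> \<exists>d>0. \<forall>\<omega>\<in>space M. \<forall>x\<in>U. \<forall>x'\<in>U.
      dist x x' < d \<longrightarrow> \<bar>V \<omega> x - V \<omega> x'\<bar> \<le> e"
  shows "Linf_uniformly_approximable M U V"
proof (rule Linf_uniformly_approximable_of_cells[OF V])
  fix e :: real
  assume "0 < e"
  have U: "Met_TC.mtotally_bounded U"
    using \<open>bounded U\<close> by (intro Met_TC.compact_closure_of_imp_mtotally_bounded) auto
  have "Linf_norm U (\<lambda>x. V \<omega> x - V \<omega>' x) \<le> e"
    if \<omega>: "\<omega> \<in> space M" "\<omega>' \<in> space M" and le: "\<forall>x\<in>U. \<bar>V \<omega> x - V \<omega>' x\<bar> \<le> e" for \<omega> \<omega>'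
  proof (rule Linf_norm_le)
    show "(\<lambda>x. V \<omega> x - V \<omega>' x) \<in> borel_measurable (lebesgue_on U)"
      using V \<omega> by (intro Linf_measurable Linf_diff) auto
    show "AE x in lebesgue_on U. \<bar>V \<omega> x - V \<omega>' x\<bar> \<le> e"
      using le by (intro AE_I2) simp
  qed (use \<open>0 < e\<close> in simp)
  then show "\<exists>c :: 'w \<Rightarrow> 'a \<Rightarrow> int. simple_function M c \<and> (\<forall>\<omega>\<in>space M. \<forall>\<omega>'\<in>space M.
      c \<omega> = c \<omega>' \<longrightarrow> Linf_norm U (\<lambda>x. V \<omega> x - V \<omega>' x) \<le> e)"
    using equicontinuous_finite_cells[OF U measurable bounded equicontinuous \<open>0 < e\<close>] by meson
qed

section \<open>The random potential\<close>

lemma potential_kernel_measurable: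
  fixes f :: "'a::euclidean_space \<Rightarrow>\<^sub>C real"
  shows "(\<lambda>y. apply_bcontfun f (x - y)) \<in> borel_measurable (restrict_space borel U)"
proof -
  have "continuous_on UNIV (\<lambda>y. apply_bcontfun f (x - y))"
    by (rule continuous_on_compose2[OF continuous_on_apply_bcontfun[of UNIV f]])
      (auto intro!: continuous_intros)
  then show ?thesis
    by (intro measurable_restrict_space1 borel_measurable_continuous_onI)
qed

lemma abs_apply_bcontfun_le: "\<bar>apply_bcontfun f x\<bar> \<le> norm (f :: 'a::topological_space \<Rightarrow>\<^sub>C real)"
  using norm_bounded[of f x] by simp

lemma
  fixes f :: "'a::euclidean_space \<Rightarrow>\<^sub>C real"
  assumes U: "U \<in> sets borel" and \<mu>: "\<mu> \<in> signed_radon U"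
  shows abs_potential_le: "\<bar>potential U f \<mu> x\<bar> \<le> norm f * tv_norm U \<mu>"
    and abs_potential_diff_le: "(\<And>y. y \<in> U \<Longrightarrow> \<bar>apply_bcontfun f (x - y) - apply_bcontfun f (x' - y)\<bar> \<le> e) \<Longrightarrow>
      \<bar>potential U f \<mu> x - potential U f \<mu> x'\<bar> \<le> e * tv_norm U \<mu>"
    and abs_potential_measure_diff_le: "\<nu> \<in> signed_radon U \<Longrightarrow>
      \<bar>potential U f \<mu> x - potential U f \<nu> x\<bar> \<le> norm f * tv_dist U \<mu> \<nu>"
proof -
  interpret signed_measure_on U \<mu> by (rule signed_measure_on_signed_radon[OF \<mu> U])
  note kernel = potential_kernel_measurable abs_apply_bcontfun_le
  show "\<bar>potential U f \<mu> x\<bar> \<le> norm f * tv_norm U \<mu>"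
    unfolding potential_def by (rule abs_signed_integral_le[OF kernel])
  show "\<bar>potential U f \<mu> x - potential U f \<mu> x'\<bar> \<le> e * tv_norm U \<mu>"
    if "\<And>y. y \<in> U \<Longrightarrow> \<bar>apply_bcontfun f (x - y) - apply_bcontfun f (x' - y)\<bar> \<le> e"
    unfolding potential_def signed_integral_diff[OF kernel kernel, symmetric]
    using that by (intro abs_signed_integral_le borel_measurable_diff potential_kernel_measurable)
  show "\<bar>potential U f \<mu> x - potential U f \<nu> x\<bar> \<le> norm f * tv_dist U \<mu> \<nu>" if "\<nu> \<in> signed_radon U"
    unfolding potential_def by (rule abs_signed_integral_measure_diff_le[OF \<mu> that U kernel])
qed

lemma potential_equicontinuous:
  fixes f :: "'a::euclidean_space \<Rightarrow>\<^sub>C real"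
  assumes U: "U \<in> sets borel" "bounded U" and "0 < e"
  shows "\<exists>d>0. \<forall>\<mu>\<in>signed_radon U. tv_norm U \<mu> \<le> t \<longrightarrow> (\<forall>x\<in>U. \<forall>x'\<in>U. dist x x' < d \<longrightarrow>
    \<bar>potential U f \<mu> x - potential U f \<mu> x'\<bar> \<le> e)"
proof -
  define e' where "e' = e / (\<bar>t\<bar> + 1)"
  have "0 < e'" using \<open>0 < e\<close> by (simp add: e'_def)
  obtain R where R: "\<And>x. x \<in> U \<Longrightarrow> norm x \<le> R" using U(2) by (auto simp: bounded_iff)
  have diff_in_cball: "x - y \<in> cball 0 (2 * R)" if "x \<in> U" "y \<in> U" for x y
    using norm_triangle_ineq4[of x y] R[OF that(1)] R[OF that(2)] by simp
  have "uniformly_continuous_on (cball 0 (2 * R)) (apply_bcontfun f)"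
    by (intro compact_uniformly_continuous continuous_on_apply_bcontfun) auto
  then obtain d where "0 < d" and d: "\<And>z z'. z \<in> cball 0 (2 * R) \<Longrightarrow> z' \<in> cball 0 (2 * R) \<Longrightarrow>
      dist z z' < d \<Longrightarrow> dist (apply_bcontfun f z) (apply_bcontfun f z') < e'"
    using \<open>0 < e'\<close> unfolding uniformly_continuous_on_def by metis
  have "\<bar>potential U f \<mu> x - potential U f \<mu> x'\<bar> \<le> e"
    if \<mu>: "\<mu> \<in> signed_radon U" "tv_norm U \<mu> \<le> t" and x: "x \<in> U" "x' \<in> U" "dist x x' < d" for \<mu> x x'
  proof -
    have "\<bar>apply_bcontfun f (x - y) - apply_bcontfun f (x' - y)\<bar> \<le> e'" if "y \<in> U" for y
      using d[of "x - y" "x' - y"] diff_in_cball that x by (simp add: dist_norm)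
    then have "\<bar>potential U f \<mu> x - potential U f \<mu> x'\<bar> \<le> e' * tv_norm U \<mu>"
      by (rule abs_potential_diff_le[OF U(1) \<mu>(1)])
    also have "\<dots> \<le> e' * (\<bar>t\<bar> + 1)"
      using \<mu>(2) \<open>0 < e'\<close> by (intro mult_left_mono) auto
    also have "\<dots> = e"
      by (simp add: e'_def add_nonneg_pos[THEN less_imp_neq, symmetric])
    finally show ?thesis .
  qed
  with \<open>0 < d\<close> show ?thesis by blast
qed

lemma potential_in_Linf:
  fixes f :: "'a::euclidean_space \<Rightarrow>\<^sub>C real"
  assumes U: "U \<in> sets borel" "bounded U" and \<mu>: "\<mu> \<in> signed_radon U"
  shows "potential U f \<mu> \<in> Linf U"
proof (rule LinfI)
  have "continuous_on U (potential U f \<mu>)"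
    unfolding continuous_on_iff
  proof (intro ballI allI impI)
    fix x and e :: real
    assume x: "x \<in> U" and "0 < e"
    then have "0 < e / 2" by simp
    from potential_equicontinuous[OF U this, of "tv_norm U \<mu>" f]
    obtain d where "0 < d"
      and d: "\<And>x x'. x \<in> U \<Longrightarrow> x' \<in> U \<Longrightarrow> dist x x' < d \<Longrightarrow> dist (potential U f \<mu> x) (potential U f \<mu> x') \<le> e / 2"
      using \<mu> unfolding dist_real_def by blast
    have "dist (potential U f \<mu> x') (potential U f \<mu> x) < e" if "x' \<in> U" "dist x' x < d" for x'
      using d[OF that(1) x that(2)] \<open>0 < e\<close> by simp
    then show "\<exists>d>0. \<forall>x'\<in>U. dist x' x < d \<longrightarrow> dist (potential U f \<mu> x') (potential U f \<mu> x) < e"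
      using \<open>0 < d\<close> by blast
  qed
  then show "potential U f \<mu> \<in> borel_measurable (lebesgue_on U)"
    using U(1) by (intro continuous_imp_measurable_on_sets_lebesgue) auto
  show "AE x in lebesgue_on U. \<bar>potential U f \<mu> x\<bar> \<le> norm f * tv_norm U \<mu>"
    by (intro AE_I2 abs_potential_le U \<mu>)
qed

lemma Linf_norm_potential_le:
  fixes f :: "'a::euclidean_space \<Rightarrow>\<^sub>C real"
  assumes U: "U \<in> sets borel" "bounded U" and \<mu>: "\<mu> \<in> signed_radon U"
  shows "Linf_norm U (potential U f \<mu>) \<le> norm f * tv_norm U \<mu>"
proof (rule Linf_norm_le)
  show "0 \<le> norm f * tv_norm U \<mu>"
    using order.trans[OF abs_ge_zero abs_potential_le[OF U(1) \<mu>]] .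
qed (use potential_in_Linf[OF assms] abs_potential_le[OF U(1) \<mu>]
  in \<open>auto intro: Linf_measurable AE_I2\<close>)

lemma borel_measurable_continuous_map:
  assumes "continuous_map T euclidean F"
  shows "F \<in> borel_measurable (sigma (topspace T) {S. openin T S})"
proof (rule borel_measurableI)
  have sub: "{S. openin T S} \<subseteq> Pow (topspace T)"
    using openin_subset by auto
  fix S :: "'b set"
  assume "open S"
  then have "openin T {x \<in> topspace T. F x \<in> S}"
    by (intro openin_continuous_map_preimage[OF assms]) simp
  moreover have "F -` S \<inter> topspace T = {x \<in> topspace T. F x \<in> S}" by auto
  ultimately show "F -` S \<inter> space (sigma (topspace T) {S. openin T S})
      \<in> sets (sigma (topspace T) {S. openin T S})"
    using sub by (simp add: space_measure_of sets_measure_of sigma_sets.Basic)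
qed

lemma borel_measurable_Lipschitz_signed_radon:
  assumes U: "U \<in> sets borel"
    and Lipschitz: "\<And>\<mu> \<nu>. \<mu> \<in> signed_radon U \<Longrightarrow> \<nu> \<in> signed_radon U \<Longrightarrow>
      \<bar>F \<mu> - F \<nu>\<bar> \<le> L * tv_dist U \<mu> \<nu>"
  shows "F \<in> borel_measurable (borel_signed_radon U)"
proof -
  interpret Metric_space "signed_radon U" "tv_dist U" by (rule Metric_space_signed_radon[OF U])
  have "Lipschitz_continuous_map (metric (signed_radon U, tv_dist U)) euclidean_metric F"
    using Lipschitz by (auto simp: Lipschitz_continuous_map_def dist_real_def)
  then have "continuous_map mtopology euclidean F"
    using Lipschitz_continuous_imp_continuous_map by fastforce
  from borel_measurable_continuous_map[OF this] show ?thesis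
    by (simp add: borel_signed_radon_def)
qed

lemma space_borel_signed_radon: "space (borel_signed_radon U) = signed_radon U"
  by (simp add: borel_signed_radon_def space_measure_of_conv)

lemma borel_measurable_potential:
  fixes f :: "'a::euclidean_space \<Rightarrow>\<^sub>C real"
  assumes "U \<in> sets borel"
  shows "(\<lambda>\<mu>. potential U f \<mu> x) \<in> borel_measurable (borel_signed_radon U)"
  using abs_potential_measure_diff_le[OF assms]
  by (intro borel_measurable_Lipschitz_signed_radon[OF assms, of _ "norm f"])

lemma borel_measurable_tv_norm:
  assumes U: "U \<in> sets borel"
  shows "tv_norm U \<in> borel_measurable (borel_signed_radon U)"
proof (rule borel_measurable_Lipschitz_signed_radon[OF U])
  fix \<mu> \<nu>
  assume radon: "\<mu> \<in> signed_radon U" "\<nu> \<in> signed_radon U"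
  then have \<mu>: "signed_measure_on U \<mu>" and \<nu>: "signed_measure_on U \<nu>"
    using U by (auto intro: signed_measure_on_signed_radon)
  show "\<bar>tv_norm U \<mu> - tv_norm U \<nu>\<bar> \<le> 1 * tv_dist U \<mu> \<nu>"
    using variation_le_variation_diff[OF \<mu> \<nu>] variation_le_variation_diff[OF \<nu> \<mu>]
      variation_uminus[of "\<lambda>A. \<mu> A - \<nu> A"] radon by (simp add: tv_dist_def)
qed

lemma Linf_uniformly_approximable_potential:
  fixes f :: "'a::euclidean_space \<Rightarrow>\<^sub>C real"
  assumes U: "U \<in> sets borel" "bounded U" and X: "X \<in> measurable M (borel_signed_radon U)"
    and t: "\<And>\<omega>. \<omega> \<in> space M \<Longrightarrow> tv_norm U (X \<omega>) \<le> t"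
  shows "Linf_uniformly_approximable M U (\<lambda>\<omega>. potential U f (X \<omega>))"
proof (rule Linf_uniformly_approximable_equicontinuous[OF U(2)])
  have X_radon: "X \<omega> \<in> signed_radon U" if "\<omega> \<in> space M" for \<omega>
    using measurable_space[OF X that] by (simp add: space_borel_signed_radon)
  then show "(\<lambda>\<omega>. potential U f (X \<omega>)) \<in> space M \<rightarrow> Linf U"
    by (auto intro: potential_in_Linf U)
  show "(\<lambda>\<omega>. potential U f (X \<omega>) x) \<in> borel_measurable M" for x
    by (rule measurable_compose[OF X borel_measurable_potential[OF U(1)]])
  show "\<bar>potential U f (X \<omega>) x\<bar> \<le> norm f * t" if "\<omega> \<in> space M" for \<omega> x
    using abs_potential_le[OF U(1) X_radon[OF that]] mult_left_mono[OF t[OF that], of "norm f"]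
    by (meson norm_ge_zero order.trans)
  show "\<exists>d>0. \<forall>\<omega>\<in>space M. \<forall>x\<in>U. \<forall>x'\<in>U. dist x x' < d \<longrightarrow>
      \<bar>potential U f (X \<omega>) x - potential U f (X \<omega>) x'\<bar> \<le> e" if "0 < e" for e
    using potential_equicontinuous[OF U that, of t f] X_radon t by meson
qed

section \<open>Second moments of balls\<close>

lemma set_integrable_cball_continuous:
  fixes F :: "'a::euclidean_space \<Rightarrow> real"
  assumes "continuous_on (cball a r) F"
  shows "set_integrable lborel (cball a r) F"
  unfolding set_integrable_def by (rule borel_integrable_compact[OF compact_cball assms])

lemma set_integral_sum:
  fixes F :: "'i \<Rightarrow> 'a \<Rightarrow> real"
  assumes "\<And>i. i \<in> I \<Longrightarrow> set_integrable M A (F i)"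
  shows "(LINT x:A|M. (\<Sum>i\<in>I. F i x)) = (\<Sum>i\<in>I. LINT x:A|M. F i x)"
  using assms unfolding set_lebesgue_integral_def set_integrable_def scaleR_sum_right
  by (rule Bochner_Integration.integral_sum)

lemma set_integral_cball_isometry:
  fixes F :: "'a::euclidean_space \<Rightarrow> real" and T :: "'a \<Rightarrow> 'a"
  assumes T: "distr lborel borel T = lborel" "T \<in> borel_measurable borel" "\<And>h. norm (T h) = norm h"
    and F: "F \<in> borel_measurable borel"
  shows "(LBINT h:cball 0 r. F (T h)) = (LBINT h:cball 0 r. F h)"
proof -
  have "(LBINT h:cball 0 r. F h) = (\<integral>h. indicator (cball 0 r) h *\<^sub>R F h \<partial>distr lborel borel T)"
    by (simp add: set_lebesgue_integral_def T(1))
  also have "\<dots> = (\<integral>h. indicator (cball 0 r) (T h) *\<^sub>R F (T h) \<partial>lborel)"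
    using T(2) F by (intro integral_distr borel_measurable_scaleR borel_measurable_indicator) auto
  also have "\<dots> = (LBINT h:cball 0 r. F (T h))"
    by (simp add: set_lebesgue_integral_def T(3) indicator_def)
  finally show ?thesis by simp
qed

lemma set_integral_cball_odd:
  fixes F :: "'a::euclidean_space \<Rightarrow> real"
  assumes F: "F \<in> borel_measurable borel" and odd: "\<And>h. F (- h) = - F h"
  shows "(LBINT h:cball 0 r. F h) = 0"
proof -
  have "distr lborel borel (uminus :: 'a \<Rightarrow> 'a) = lborel"
    using lborel_affine[of "-1" "0::'a"] by (simp add: density_1)
  then have "(LBINT h:cball 0 r. F (- h)) = (LBINT h:cball 0 r. F h)"
    using F by (intro set_integral_cball_isometry) auto
  then show ?thesis
    by (simp add: odd set_lebesgue_integral_def)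
qed

lemma norm_eq_of_basis_squares:
  fixes x y :: "'a::euclidean_space"
  assumes "(\<Sum>b\<in>Basis. (x \<bullet> b)\<^sup>2) = (\<Sum>b\<in>Basis. (y \<bullet> b)\<^sup>2)"
  shows "norm x = norm y"
  using assms unfolding norm_eq_sqrt_inner euclidean_inner[of x x] euclidean_inner[of y y]
  by (simp add: power2_eq_square)

lemma set_integral_cball_mixed_moment:
  fixes i j :: "'a::euclidean_space"
  assumes "i \<in> Basis" "j \<in> Basis" "i \<noteq> j"
  shows "(LBINT h:cball 0 r. (h \<bullet> i) * (h \<bullet> j)) = 0"
proof -
  define c where "c b = (if b = i then -1 else 1 :: real)" for b :: 'a
  define T where "T x = (\<Sum>b\<in>Basis. (c b * (x \<bullet> b)) *\<^sub>R b)" for x :: 'a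
  have T_inner: "T x \<bullet> b = c b * (x \<bullet> b)" if "b \<in> Basis" for x b
    using that by (simp add: T_def)
  have "(\<Prod>b\<in>Basis. \<bar>c b\<bar>) = 1"
    by (intro prod.neutral) (auto simp: c_def)
  then have "distr lborel borel T = lborel"
    using lborel_affine_euclidean[of c 0] by (simp add: c_def T_def[abs_def] density_1)
  moreover have "norm (T x) = norm x" for x
    by (intro norm_eq_of_basis_squares sum.cong) (auto simp: T_inner c_def)
  moreover have "T \<in> borel_measurable borel"
    unfolding T_def by measurable
  ultimately have "(LBINT h:cball 0 r. (T h \<bullet> i) * (T h \<bullet> j)) = (LBINT h:cball 0 r. (h \<bullet> i) * (h \<bullet> j))"
    by (intro set_integral_cball_isometry[where F="\<lambda>h. (h \<bullet> i) * (h \<bullet> j)"]) auto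
  then show ?thesis
    using assms by (simp add: T_inner c_def set_lebesgue_integral_def)
qed

lemma lborel_distr_basis_permutation:
  fixes \<pi> :: "'a::euclidean_space \<Rightarrow> 'a"
  assumes \<pi>: "bij_betw \<pi> Basis Basis"
  defines "T x \<equiv> \<Sum>b\<in>Basis. (x \<bullet> \<pi> b) *\<^sub>R b"
  shows "distr lborel borel T = lborel"
proof (rule lborel_eqI[symmetric])
  have T_inner: "T x \<bullet> b = x \<bullet> \<pi> b" if "b \<in> Basis" for x b
    using that by (simp add: T_def)
  have [measurable]: "T \<in> borel_measurable borel"
    unfolding T_def by measurable
  define T' where "T' x = (\<Sum>b\<in>Basis. (x \<bullet> inv_into Basis \<pi> b) *\<^sub>R b)" for x
  have T'_inner: "T' x \<bullet> \<pi> b = x \<bullet> b" if "b \<in> Basis" for x b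
    using that bij_betwE[OF \<pi>] bij_betw_inv_into_left[OF \<pi>]
    by (simp add: T'_def)
  fix l u :: 'a
  assume le: "\<And>b. b \<in> Basis \<Longrightarrow> l \<bullet> b \<le> u \<bullet> b"
  have all_Basis: "(\<forall>b\<in>Basis. Q b) \<longleftrightarrow> (\<forall>b\<in>Basis. Q (\<pi> b))" for Q
    using bij_betw_imp_surj_on[OF \<pi>] by (metis imageE imageI)
  have "T -` box l u \<inter> space lborel = box (T' l) (T' u)"
    by (simp add: set_eq_iff mem_box T_inner all_Basis[of "\<lambda>b. _ \<bullet> b < _ \<bullet> b \<and> _ \<bullet> b < _ \<bullet> b"] T'_inner)
  then have "emeasure (distr lborel borel T) (box l u) = emeasure lborel (box (T' l) (T' u))"
    by (simp add: emeasure_distr)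
  also have "\<dots> = (\<Prod>b\<in>Basis. (T' u - T' l) \<bullet> b)"
  proof (rule emeasure_lborel_box)
    have "\<forall>b\<in>Basis. T' l \<bullet> b \<le> T' u \<bullet> b"
      using le by (subst all_Basis) (simp add: T'_inner)
    then show "T' l \<bullet> b \<le> T' u \<bullet> b" if "b \<in> Basis" for b
      using that by blast
  qed
  also have "(\<Prod>b\<in>Basis. (T' u - T' l) \<bullet> b) = (\<Prod>b\<in>Basis. (T' u - T' l) \<bullet> \<pi> b)"
    by (rule prod.reindex_bij_betw[OF \<pi>, symmetric])
  also have "\<dots> = (\<Prod>b\<in>Basis. (u - l) \<bullet> b)"
    by (intro prod.cong) (auto simp: inner_diff_left T'_inner)
  finally show "emeasure (distr lborel borel T) (box l u) = (\<Prod>b\<in>Basis. (u - l) \<bullet> b)" .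
qed simp

lemma set_integral_cball_square_moment_eq:
  fixes i j :: "'a::euclidean_space"
  assumes "i \<in> Basis" "j \<in> Basis"
  shows "(LBINT h:cball 0 r. (h \<bullet> i)\<^sup>2) = (LBINT h:cball 0 r. (h \<bullet> j)\<^sup>2)"
proof -
  let ?\<pi> = "Transposition.transpose i j"
  define T where "T x = (\<Sum>b\<in>Basis. (x \<bullet> ?\<pi> b) *\<^sub>R b)" for x :: 'a
  have bij: "bij_betw ?\<pi> Basis Basis"
    using assms by (intro bij_betw_byWitness[where f'="?\<pi>"]) (auto simp: Transposition.transpose_def)
  have T_inner: "T x \<bullet> b = x \<bullet> ?\<pi> b" if "b \<in> Basis" for x b
    using that by (simp add: T_def)
  have "norm (T x) = norm x" for x
    using sum.reindex_bij_betw[OF bij, of "\<lambda>b. (x \<bullet> b)\<^sup>2"]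
    by (intro norm_eq_of_basis_squares) (simp add: T_inner)
  moreover have "T \<in> borel_measurable borel"
    unfolding T_def by measurable
  ultimately have "(LBINT h:cball 0 r. (T h \<bullet> j)\<^sup>2) = (LBINT h:cball 0 r. (h \<bullet> j)\<^sup>2)"
    unfolding T_def
    by (intro set_integral_cball_isometry[where F="\<lambda>h. (h \<bullet> j)\<^sup>2"] lborel_distr_basis_permutation bij) auto
  then show ?thesis
    using assms by (simp add: T_inner)
qed

lemma set_integral_cball_inner_square:
  fixes a :: "'a::euclidean_space"
  shows "(LBINT h:cball 0 r. (a \<bullet> h)\<^sup>2) = (norm a)\<^sup>2 / DIM('a) * (LBINT h:cball (0::'a) r. (norm h)\<^sup>2)"
proof -
  have integrable: "set_integrable lborel (cball 0 r) F" if "continuous_on UNIV F" for F :: "'a \<Rightarrow> real"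
    by (rule set_integrable_cball_continuous[OF continuous_on_subset[OF that subset_UNIV]])
  obtain e :: 'a where e: "e \<in> Basis" using nonempty_Basis by blast
  define m where "m = (LBINT h:cball 0 r. (h \<bullet> e)\<^sup>2)"
  have moment: "(LBINT h:cball 0 r. (h \<bullet> b)\<^sup>2) = m" if "b \<in> Basis" for b :: 'a
    unfolding m_def by (rule set_integral_cball_square_moment_eq[OF that e])
  have "(LBINT h:cball (0::'a) r. (norm h)\<^sup>2) = (LBINT h:cball (0::'a) r. (\<Sum>b\<in>Basis. (h \<bullet> b)\<^sup>2))"
    unfolding power2_norm_eq_inner by (subst euclidean_inner) (simp only: power2_eq_square)
  also have "\<dots> = (\<Sum>b\<in>(Basis :: 'a set). LBINT h:cball 0 r. (h \<bullet> b)\<^sup>2)"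
    by (intro set_integral_sum integrable continuous_intros)
  also have "\<dots> = DIM('a) * m"
    by (simp add: moment)
  finally have norm_moment: "(LBINT h:cball (0::'a) r. (norm h)\<^sup>2) = DIM('a) * m" .
  have "(a \<bullet> h)\<^sup>2 = (\<Sum>b\<in>Basis. \<Sum>b'\<in>Basis. (a \<bullet> b) * (a \<bullet> b') * ((h \<bullet> b) * (h \<bullet> b')))" for h
    unfolding power2_eq_square by (subst (1 2) euclidean_inner) (simp add: sum_product mult_ac)
  then have "(LBINT h:cball 0 r. (a \<bullet> h)\<^sup>2) =
      (\<Sum>b\<in>Basis. \<Sum>b'\<in>Basis. (a \<bullet> b) * (a \<bullet> b') * (LBINT h:cball 0 r. (h \<bullet> b) * (h \<bullet> b')))"
    by (simp add: set_integral_sum integrable continuous_intros)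
  also have "\<dots> = (\<Sum>b\<in>Basis. \<Sum>b'\<in>Basis. if b' = b then (a \<bullet> b) * (a \<bullet> b) * m else 0)"
    by (intro sum.cong refl)
      (auto simp: moment[unfolded power2_eq_square] set_integral_cball_mixed_moment)
  also have "\<dots> = (norm a)\<^sup>2 * m"
    by (simp add: power2_norm_eq_inner euclidean_inner[of a a] sum_distrib_right)
  finally show ?thesis
    unfolding norm_moment by simp
qed

lemma set_integral_cball_norm_square_pos:
  assumes "0 < r"
  shows "0 < (LBINT h:cball (0::'a::euclidean_space) r. (norm h)\<^sup>2)"
proof -
  let ?F = "\<lambda>h::'a. indicator (cball 0 r) h *\<^sub>R (norm h)\<^sup>2"
  have nonneg: "AE h in lborel. 0 \<le> ?F h"
    by (intro AE_I2) auto
  have integrable: "integrable lborel ?F"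
    using set_integrable_cball_continuous[of "0::'a" r "\<lambda>h. (norm h)\<^sup>2"]
    by (simp add: set_integrable_def continuous_intros)
  have "integral\<^sup>L lborel ?F \<noteq> 0"
  proof
    assume "integral\<^sup>L lborel ?F = 0"
    then have "AE h in lborel. ?F h = 0"
      using integral_nonneg_eq_0_iff_AE[OF integrable nonneg] by simp
    moreover have "AE h in lborel. h \<noteq> (0::'a)" by (rule AE_lborel_singleton)
    ultimately have "AE h in lborel. h \<notin> cball (0::'a) r"
      by eventually_elim (auto simp: indicator_def split: if_splits)
    then have "emeasure lborel (cball (0::'a) r) = 0"
      by (subst (asm) AE_iff_measurable[of "cball 0 r"]) auto
    then show False
      using assms unit_ball_vol_pos[of "real DIM('a)"] by (simp add: emeasure_cball)
  qed
  then show ?thesis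
    using integral_nonneg_AE[OF nonneg] unfolding set_lebesgue_integral_def by linarith
qed

section \<open>Ball means and subharmonic functions\<close>

definition ball_mean :: "('a::euclidean_space \<Rightarrow> real) \<Rightarrow> 'a \<Rightarrow> real \<Rightarrow> real" where
  "ball_mean w a r = (\<integral>y. w y \<partial>lebesgue_on (cball a r)) / measure lebesgue (cball a r)"

lemma ball_mean_eq:
  fixes w :: "'a::euclidean_space \<Rightarrow> real"
  assumes "0 < r" and cont: "continuous_on (cball a r) w"
  shows "ball_mean w a r = (LBINT h:cball 0 r. w (a + h)) / measure lborel (cball (0::'a) r)"
proof -
  have measurable: "(\<lambda>y. indicator (cball a r) y *\<^sub>R w y) \<in> borel_measurable borel"
    by (rule borel_measurable_continuous_on_indicator[OF _ cont]) simp
  have "(\<integral>y. w y \<partial>lebesgue_on (cball a r)) = (\<integral>y. indicator (cball a r) y *\<^sub>R w y \<partial>lebesgue)"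
    by (subst integral_restrict_space) auto
  also have "\<dots> = (\<integral>y. indicator (cball a r) y *\<^sub>R w y \<partial>lborel)"
    using measurable by (intro integral_completion) simp
  also have "\<dots> = (\<integral>y. indicator (cball a r) y *\<^sub>R w y \<partial>distr lborel borel ((+) a))"
    by (simp add: lborel_distr_plus)
  also have "\<dots> = (\<integral>h. indicator (cball a r) (a + h) *\<^sub>R w (a + h) \<partial>lborel)"
    using measurable by (intro integral_distr) auto
  also have "\<dots> = (LBINT h:cball 0 r. w (a + h))"
    unfolding set_lebesgue_integral_def
    by (intro Bochner_Integration.integral_cong) (auto simp: indicator_def dist_norm)
  finally show ?thesis
    using content_cball[of r a] content_cball[of r "0::'a"] \<open>0 < r\<close> by (simp add: ball_mean_def)
qed

lemma set_integrable_cball_translate: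
  fixes w :: "'a::euclidean_space \<Rightarrow> real"
  assumes "continuous_on (cball a r) w"
  shows "set_integrable lborel (cball 0 r) (\<lambda>h. w (a + h))"
  by (intro set_integrable_cball_continuous continuous_on_compose2[OF assms])
    (auto intro!: continuous_intros simp: dist_norm)

lemma ball_mean_le_add_const:
  fixes v w :: "'a::euclidean_space \<Rightarrow> real"
  assumes "0 < r" and cont: "continuous_on (cball a r) v" "continuous_on (cball a r) w"
    and le: "\<And>y. y \<in> cball a r \<Longrightarrow> v y \<le> w y + c"
  shows "ball_mean v a r \<le> ball_mean w a r + c"
proof -
  let ?V = "measure lborel (cball (0::'a) r)"
  have "0 < ?V" using \<open>0 < r\<close> by (simp add: content_cball)
  have "(LBINT h:cball (0::'a) r. c) = ?V * c"
    by (simp add: set_lebesgue_integral_def)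
  moreover have const: "set_integrable lborel (cball (0::'a) r) (\<lambda>h. c)"
    by (intro set_integrable_cball_continuous continuous_intros)
  moreover note integrable = set_integrable_cball_translate[OF cont(1)] set_integrable_cball_translate[OF cont(2)]
  moreover have "(LBINT h:cball 0 r. v (a + h)) \<le> (LBINT h:cball 0 r. w (a + h) + c)"
    using le by (intro set_integral_mono set_integral_add integrable const) (auto simp: dist_norm)
  ultimately have "(LBINT h:cball 0 r. v (a + h)) \<le> (LBINT h:cball 0 r. w (a + h)) + ?V * c"
    by simp
  then show ?thesis
    using \<open>0 < ?V\<close> unfolding ball_mean_eq[OF \<open>0 < r\<close> cont(1)] ball_mean_eq[OF \<open>0 < r\<close> cont(2)]
    by (simp only: pos_divide_le_eq distrib_right) (simp add: mult.commute)
qed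

definition strictly_superharmonic_at :: "('a::euclidean_space \<Rightarrow> real) \<Rightarrow> 'a \<Rightarrow> bool" where
  "strictly_superharmonic_at w a \<longleftrightarrow>
    (\<forall>\<^sub>F r in at_right 0. continuous_on (cball a r) w \<and> ball_mean w a r < w a)"

lemma subharmonic_diff_no_local_max:
  fixes v w :: "'a::euclidean_space \<Rightarrow> real"
  assumes v: "subharmonic_on U v" and U: "open U" "a \<in> U" and w: "strictly_superharmonic_at w a"
  shows "\<not> (\<forall>\<^sub>F z in nhds a. v z - w z \<le> v a - w a)"
proof
  assume "\<forall>\<^sub>F z in nhds a. v z - w z \<le> v a - w a"
  with eventually_nhds_in_open[OF U] have "\<forall>\<^sub>F z in nhds a. z \<in> U \<and> v z - w z \<le> v a - w a"
    by (rule eventually_conj)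
  then obtain d where "0 < d" and d: "\<And>z. dist z a < d \<Longrightarrow> z \<in> U \<and> v z - w z \<le> v a - w a"
    by (auto simp: eventually_nhds_metric)
  have "\<forall>\<^sub>F r in at_right 0. 0 < r \<and> r < d"
    using \<open>0 < d\<close> by (intro eventually_conj eventually_at_right_less) (auto simp: eventually_at_right_field)
  with w have "\<forall>\<^sub>F r in at_right 0. continuous_on (cball a r) w \<and> ball_mean w a r < w a \<and> 0 < r \<and> r < d"
    unfolding strictly_superharmonic_at_def by eventually_elim simp
  then obtain r where r: "continuous_on (cball a r) w" "ball_mean w a r < w a" "0 < r" "r < d"
    using eventually_happens'[OF trivial_limit_at_right_real] by blast
  have in_cball: "z \<in> U \<and> v z - w z \<le> v a - w a" if "z \<in> cball a r" for z
    using that r(4) by (intro d) (simp add: dist_commute)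
  then have "cball a r \<subseteq> U" by blast
  then have "continuous_on (cball a r) v" "v a \<le> ball_mean v a r"
    using v r(3) by (auto simp: subharmonic_on_def ball_mean_def intro: continuous_on_subset)
  moreover from this r in_cball have "ball_mean v a r \<le> ball_mean w a r + (v a - w a)"
    by (intro ball_mean_le_add_const) (auto simp: algebra_simps)
  ultimately show False
    using r(2) by simp
qed

lemma subharmonic_comparison:
  fixes v w :: "'a::euclidean_space \<Rightarrow> real"
  assumes U: "open U" "bounded U" and v: "continuous_on (closure U) v" "subharmonic_on U v"
    and w: "continuous_on (closure U - {x}) w" "\<And>a. a \<in> U - {x} \<Longrightarrow> strictly_superharmonic_at w a"
    and frontier: "\<And>z. z \<in> frontier U \<Longrightarrow> v z \<le> w z"
    and pole: "\<forall>\<^sub>F z in at x. z \<in> closure U \<longrightarrow> v z \<le> w z"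
    and y: "y \<in> U" "y \<noteq> x"
  shows "v y \<le> w y"
proof (rule ccontr)
  assume "\<not> v y \<le> w y"
  obtain \<rho> where "0 < \<rho>" and \<rho>: "\<And>z. z \<noteq> x \<Longrightarrow> dist z x < \<rho> \<Longrightarrow> z \<in> closure U \<Longrightarrow> v z \<le> w z"
    using pole by (auto simp: eventually_at)
  define S where "S = closure U - ball x \<rho>"
  have subset: "S \<subseteq> closure U - {x}" using \<open>0 < \<rho>\<close> by (auto simp: S_def)
  have outside: "z \<in> S" if "z \<in> closure U" "z \<noteq> x" "w z < v z" for z
    using \<rho>[of z] that by (force simp: S_def dist_commute)
  have "y \<in> S"
    using \<open>\<not> v y \<le> w y\<close> y closure_subset[of U] by (intro outside) auto
  moreover have "compact S"
    unfolding S_def using U(2) by (intro compact_diff) auto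
  moreover have "continuous_on S (\<lambda>z. v z - w z)"
    using subset by (intro continuous_on_diff continuous_on_subset[OF v(1)] continuous_on_subset[OF w(1)]) auto
  ultimately obtain a where a: "a \<in> S" and max: "\<And>z. z \<in> S \<Longrightarrow> v z - w z \<le> v a - w a"
    using continuous_attains_sup[of S "\<lambda>z. v z - w z"] by blast
  have "w a < v a"
    using max[OF \<open>y \<in> S\<close>] \<open>\<not> v y \<le> w y\<close> by simp
  then have "a \<notin> frontier U"
    using frontier[of a] by auto
  then have "a \<in> U - {x}"
    using a subset U(1) by (auto simp: frontier_def interior_open)
  moreover have "\<forall>\<^sub>F z in nhds a. v z - w z \<le> v a - w a"
  proof -
    have "\<forall>\<^sub>F z in nhds a. z \<in> U - {x}"
      using \<open>a \<in> U - {x}\<close> U(1) by (intro eventually_nhds_in_open open_delete)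
    then show ?thesis
    proof eventually_elim
      case (elim z)
      then show ?case
        using outside[of z] max[of z] \<open>w a < v a\<close> closure_subset[of U] by fastforce
    qed
  qed
  ultimately show False
    using subharmonic_diff_no_local_max[OF v(2) U(1) _ w(2)] by blast
qed

section \<open>Ball means of radial functions\<close>

lemma eventually_le_of_derivative_sign:
  fixes g g' :: "real \<Rightarrow> real"
  assumes "\<forall>\<^sub>F t in nhds T. (g has_real_derivative g' t) (at t)"
    and "\<forall>\<^sub>F t in nhds T. (t - T) * g' t \<le> 0"
  shows "\<forall>\<^sub>F t in nhds T. g t \<le> g T"
proof -
  from eventually_conj[OF assms] obtain d where "0 < d" and d: "\<And>t. \<bar>t - T\<bar> < d \<Longrightarrow>
      (g has_real_derivative g' t) (at t) \<and> (t - T) * g' t \<le> 0"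
    by (auto simp: eventually_nhds_metric dist_real_def)
  have "g t \<le> g T" if t: "\<bar>t - T\<bar> < d" for t
  proof -
    consider "t = T" | "T < t" | "t < T" by linarith
    then show ?thesis
    proof cases
      case 2
      then obtain z where "T < z" "z < t" "g t - g T = (t - T) * g' z"
        using MVT2[of T t g g'] d t by fastforce
      then have "g' z \<le> 0"
        using d[of z] t by (auto simp: mult_le_0_iff)
      then have "(t - T) * g' z \<le> 0"
        using 2 by (intro mult_nonneg_nonpos) auto
      with \<open>g t - g T = (t - T) * g' z\<close> show ?thesis by simp
    next
      case 3
      then obtain z where "t < z" "z < T" "g T - g t = (T - t) * g' z"
        using MVT2[of t T g g'] d t by fastforce
      then have "0 \<le> g' z"
        using d[of z] t by (auto simp: mult_le_0_iff)
      then have "0 \<le> (T - t) * g' z"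
        using 3 by (intro mult_nonneg_nonneg) auto
      with \<open>g T - g t = (T - t) * g' z\<close> show ?thesis by simp
    qed simp
  qed
  then show ?thesis
    using \<open>0 < d\<close> by (auto simp: eventually_nhds_metric dist_real_def)
qed

lemma Taylor2_upper:
  fixes f f' :: "real \<Rightarrow> real"
  assumes f: "\<forall>\<^sub>F t in nhds T. (f has_real_derivative f' t) (at t)"
    and f': "(f' has_real_derivative D) (at T)" and "0 < \<eta>"
  shows "\<forall>\<^sub>F t in nhds T. f t \<le> f T + f' T * (t - T) + (D / 2 + \<eta>) * (t - T)\<^sup>2"
proof -
  define g where "g t = f t - (f' T * (t - T) + (D / 2 + \<eta>) * (t - T)\<^sup>2)" for t
  define g' where "g' t = f' t - f' T - (D + 2 * \<eta>) * (t - T)" for t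
  have "\<forall>\<^sub>F t in nhds T. (g has_real_derivative g' t) (at t)"
    using f
  proof eventually_elim
    case (elim t)
    then show ?case
      unfolding g_def[abs_def] g'_def by (auto intro!: derivative_eq_intros simp: field_simps)
  qed
  moreover have "\<forall>\<^sub>F t in nhds T. (t - T) * g' t \<le> 0"
  proof -
    have "\<forall>\<^sub>F t in at T. dist ((f' t - f' T) / (t - T)) D < 2 * \<eta>"
      using f' \<open>0 < \<eta>\<close> by (intro tendstoD) (auto simp: has_field_derivative_iff)
    then have "\<forall>\<^sub>F t in nhds T. t \<noteq> T \<longrightarrow> dist ((f' t - f' T) / (t - T)) D < 2 * \<eta>"
      by (simp add: eventually_at_filter)
    then show ?thesis
    proof eventually_elim
      case (elim t)
      show ?case
      proof (cases "t = T")
        case False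
        define q where "q = (f' t - f' T) / (t - T)"
        have f't_eq: "f' t = f' T + (t - T) * q"
          using False by (simp add: q_def)
        have "(t - T) * g' t = (t - T)\<^sup>2 * (q - D - 2 * \<eta>)"
          unfolding g'_def f't_eq by (simp add: power2_eq_square algebra_simps)
        also have "\<dots> \<le> 0"
          using elim False by (intro mult_nonneg_nonpos) (auto simp: q_def dist_real_def)
        finally show ?thesis .
      qed simp
    qed
  qed
  ultimately have "\<forall>\<^sub>F t in nhds T. g t \<le> g T"
    by (rule eventually_le_of_derivative_sign)
  then show ?thesis
    by eventually_elim (simp add: g_def)
qed

lemma norm_add_square: "(norm (a + h))\<^sup>2 = (norm a)\<^sup>2 + (2 * (a \<bullet> h) + (norm h)\<^sup>2)"
  for a h :: "'a::real_inner"
  using dot_norm[of a h] by simp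

lemma eventually_norm_add_square:
  fixes a :: "'a::real_inner"
  assumes "\<forall>\<^sub>F t in nhds ((norm a)\<^sup>2). P t"
  shows "\<forall>\<^sub>F r in at_right 0. \<forall>h. norm h \<le> r \<longrightarrow> P ((norm (a + h))\<^sup>2)"
proof -
  have "isCont (\<lambda>h. (norm (a + h))\<^sup>2) 0"
    by (intro continuous_intros)
  then have "((\<lambda>h. (norm (a + h))\<^sup>2) \<longlongrightarrow> (norm (a + 0))\<^sup>2) (nhds 0)"
    unfolding isCont_def by (rule tendsto_at_iff_tendsto_nhds[THEN iffD1])
  then have "\<forall>\<^sub>F h in nhds 0. P ((norm (a + h))\<^sup>2)"
    using assms by (simp add: filterlim_iff)
  then obtain d where "0 < d" and d: "\<And>h. norm h < d \<Longrightarrow> P ((norm (a + h))\<^sup>2)"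
    by (auto simp: eventually_nhds_metric)
  have "\<forall>\<^sub>F r in at_right 0. r < d"
    using \<open>0 < d\<close> by (auto simp: eventually_at_right_field)
  then show ?thesis
    by eventually_elim (use d in auto)
qed

lemma eventually_continuous_on_cball_radial:
  fixes a x :: "'a::euclidean_space" and f :: "real \<Rightarrow> real"
  assumes "\<forall>\<^sub>F t in nhds ((norm (a - x))\<^sup>2). isCont f t"
  shows "\<forall>\<^sub>F r in at_right 0. continuous_on (cball a r) (\<lambda>y. f ((norm (y - x))\<^sup>2))"
  using eventually_norm_add_square[OF assms]
proof eventually_elim
  case (elim r)
  show ?case
  proof (intro continuous_at_imp_continuous_on ballI)
    fix y
    assume "y \<in> cball a r"
    then have "isCont f ((norm (y - x))\<^sup>2)"
      using elim[rule_format, of "y - a"] by (simp add: dist_norm norm_minus_commute)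
    moreover have "isCont (\<lambda>y. (norm (y - x))\<^sup>2) y"
      by (intro continuous_intros)
    ultimately show "isCont (\<lambda>y. f ((norm (y - x))\<^sup>2)) y"
      by (rule isCont_o2[rotated])
  qed
qed

lemma radial_le_quadratic:
  fixes a :: "'a::real_inner"
  defines "T \<equiv> (norm a)\<^sup>2"
  assumes f: "\<forall>\<^sub>F t in nhds T. f t \<le> f T + D * (t - T) + c * (t - T)\<^sup>2" and "0 < \<eta>"
  shows "\<forall>\<^sub>F r in at_right 0. \<forall>h. norm h \<le> r \<longrightarrow> f ((norm (a + h))\<^sup>2) \<le>
    f T + 2 * D * (a \<bullet> h) + (D + \<eta>) * (norm h)\<^sup>2 + 4 * c * (a \<bullet> h)\<^sup>2 + 4 * c * ((a \<bullet> h) * (norm h)\<^sup>2)"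
proof -
  have "((\<lambda>r. \<bar>c\<bar> * r\<^sup>2) \<longlongrightarrow> \<bar>c\<bar> * 0\<^sup>2) (at_right 0)"
    by (intro tendsto_intros)
  then have "\<forall>\<^sub>F r in at_right 0. \<bar>c\<bar> * r\<^sup>2 < \<eta>"
    using \<open>0 < \<eta>\<close> by (intro order_tendstoD(2)) auto
  then show ?thesis
    using eventually_norm_add_square[OF f[unfolded T_def]] eventually_at_right_less
  proof eventually_elim
    case (elim r)
    show ?case
    proof (intro allI impI)
      fix h :: 'a
      assume h: "norm h \<le> r"
      let ?t = "2 * (a \<bullet> h) + (norm h)\<^sup>2"
      have "f ((norm (a + h))\<^sup>2) \<le> f T + D * ?t + c * ?t\<^sup>2"
        using elim(2) h unfolding norm_add_square T_def by fastforce
      also have "\<dots> = f T + 2 * D * (a \<bullet> h) + D * (norm h)\<^sup>2 + 4 * c * (a \<bullet> h)\<^sup>2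
          + 4 * c * ((a \<bullet> h) * (norm h)\<^sup>2) + c * (norm h)\<^sup>2 * (norm h)\<^sup>2"
        by (simp add: power2_eq_square algebra_simps)
      also have "c * (norm h)\<^sup>2 * (norm h)\<^sup>2 \<le> \<eta> * (norm h)\<^sup>2"
      proof (rule mult_right_mono)
        have "c * (norm h)\<^sup>2 \<le> \<bar>c\<bar> * r\<^sup>2"
          using h by (intro mult_mono power_mono) auto
        then show "c * (norm h)\<^sup>2 \<le> \<eta>" using elim(1) by simp
      qed simp
      finally show "f ((norm (a + h))\<^sup>2) \<le> f T + 2 * D * (a \<bullet> h) + (D + \<eta>) * (norm h)\<^sup>2
          + 4 * c * (a \<bullet> h)\<^sup>2 + 4 * c * ((a \<bullet> h) * (norm h)\<^sup>2)"
        by (simp add: algebra_simps)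
    qed
  qed
qed

lemma set_integral_cball_quadratic:
  fixes a :: "'a::euclidean_space"
  shows "(LBINT h:cball 0 r. c\<^sub>0 + c\<^sub>1 * (a \<bullet> h) + c\<^sub>2 * (norm h)\<^sup>2 + c\<^sub>3 * (a \<bullet> h)\<^sup>2 + c\<^sub>4 * ((a \<bullet> h) * (norm h)\<^sup>2)) =
    c\<^sub>0 * measure lborel (cball (0::'a) r)
      + (c\<^sub>2 + c\<^sub>3 * ((norm a)\<^sup>2 / DIM('a))) * (LBINT h:cball (0::'a) r. (norm h)\<^sup>2)"
proof -
  have integrable: "set_integrable lborel (cball (0::'a) r) (\<lambda>h. c)"
    "set_integrable lborel (cball 0 r) (\<lambda>h. a \<bullet> h)"
    "set_integrable lborel (cball (0::'a) r) (\<lambda>h. (norm h)\<^sup>2)"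
    "set_integrable lborel (cball 0 r) (\<lambda>h. (a \<bullet> h)\<^sup>2)"
    "set_integrable lborel (cball 0 r) (\<lambda>h. (a \<bullet> h) * (norm h)\<^sup>2)" for c :: real
    by (intro set_integrable_cball_continuous continuous_intros)+
  have "(LBINT h:cball 0 r. a \<bullet> h) = 0" "(LBINT h:cball 0 r. (a \<bullet> h) * (norm h)\<^sup>2) = 0"
    by (intro set_integral_cball_odd; simp)+
  moreover have "(LBINT h:cball (0::'a) r. c\<^sub>0) = c\<^sub>0 * measure lborel (cball (0::'a) r)"
    by (simp add: set_lebesgue_integral_def)
  ultimately show ?thesis
    by (simp add: set_integral_add integrable set_integral_cball_inner_square algebra_simps)
qed

lemma ball_mean_less_of_quadratic_upper:
  fixes a p :: "'a::euclidean_space"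
  assumes "0 < r" and cont: "continuous_on (cball a r) w"
    and upper: "\<And>h. norm h \<le> r \<Longrightarrow> w (a + h) \<le>
      w a + c\<^sub>1 * (p \<bullet> h) + c\<^sub>2 * (norm h)\<^sup>2 + c\<^sub>3 * (p \<bullet> h)\<^sup>2 + c\<^sub>4 * ((p \<bullet> h) * (norm h)\<^sup>2)"
    and neg: "c\<^sub>2 + c\<^sub>3 * ((norm p)\<^sup>2 / DIM('a)) < 0"
  shows "ball_mean w a r < w a"
proof -
  let ?q = "\<lambda>h. w a + c\<^sub>1 * (p \<bullet> h) + c\<^sub>2 * (norm h)\<^sup>2 + c\<^sub>3 * (p \<bullet> h)\<^sup>2 + c\<^sub>4 * ((p \<bullet> h) * (norm h)\<^sup>2)"
  have "(LBINT h:cball 0 r. w (a + h)) \<le> (LBINT h:cball 0 r. ?q h)"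
  proof (rule set_integral_mono[OF set_integrable_cball_translate[OF cont]])
    show "set_integrable lborel (cball 0 r) ?q"
      by (intro set_integrable_cball_continuous continuous_intros)
  qed (use upper in simp)
  also have "\<dots> < w a * measure lborel (cball (0::'a) r)"
    unfolding set_integral_cball_quadratic
    using mult_neg_pos[OF neg set_integral_cball_norm_square_pos[OF \<open>0 < r\<close>, where 'a='a]] by simp
  finally show ?thesis
    using \<open>0 < r\<close> by (simp add: ball_mean_eq[OF \<open>0 < r\<close> cont] content_cball field_simps)
qed

text \<open>\<open>2 n f'(T) + 4 T f''(T)\<close> is the Laplacian of \<open>f(\<bar>y\<bar>\<^sup>2)\<close> at \<open>\<bar>y\<bar>\<^sup>2 = T\<close>.\<close>

lemma strictly_superharmonic_at_radial:
  fixes a x :: "'a::euclidean_space"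
  defines "T \<equiv> (norm (a - x))\<^sup>2"
  assumes f: "\<forall>\<^sub>F t in nhds T. (f has_real_derivative f' t) (at t)"
    and f': "(f' has_real_derivative D) (at T)"
    and neg: "f' T + 2 * T / DIM('a) * D < 0"
  shows "strictly_superharmonic_at (\<lambda>y. f ((norm (y - x))\<^sup>2)) a"
proof -
  define \<eta> where "\<eta> = - (f' T + 2 * T / DIM('a) * D)"
  have "0 < \<eta>" using neg by (simp add: \<eta>_def)
  have "0 \<le> T" by (simp add: T_def)
  define c where "c = D / 2 + \<eta> * DIM('a) / (16 * (T + 1))"
  have "4 * c * (T / DIM('a)) = 2 * T / DIM('a) * D + \<eta> / 4 * (T / (T + 1))"
    using \<open>0 \<le> T\<close> by (simp add: c_def divide_simps) (simp add: algebra_simps)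
  moreover have "\<eta> / 4 * (T / (T + 1)) \<le> \<eta> / 4 * 1"
    using \<open>0 < \<eta>\<close> \<open>0 \<le> T\<close> by (intro mult_left_mono) auto
  moreover have "f' T + 2 * T / DIM('a) * D = - \<eta>"
    by (simp add: \<eta>_def)
  ultimately have neg': "f' T + \<eta> / 4 + 4 * c * ((norm (a - x))\<^sup>2 / DIM('a)) < 0"
    using \<open>0 < \<eta>\<close> unfolding T_def by linarith
  have "0 < \<eta> * DIM('a) / (16 * (T + 1))"
    using \<open>0 < \<eta>\<close> \<open>0 \<le> T\<close> by simp
  then have "\<forall>\<^sub>F t in nhds T. f t \<le> f T + f' T * (t - T) + c * (t - T)\<^sup>2"
    unfolding c_def by (rule Taylor2_upper[OF f f'])
  then have upper: "\<forall>\<^sub>F r in at_right 0. \<forall>h. norm h \<le> r \<longrightarrow> f ((norm (a - x + h))\<^sup>2) \<le>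
      f T + 2 * f' T * ((a - x) \<bullet> h) + (f' T + \<eta> / 4) * (norm h)\<^sup>2
        + 4 * c * ((a - x) \<bullet> h)\<^sup>2 + 4 * c * (((a - x) \<bullet> h) * (norm h)\<^sup>2)"
    unfolding T_def using \<open>0 < \<eta>\<close> by (intro radial_le_quadratic) auto
  have "\<forall>\<^sub>F t in nhds ((norm (a - x))\<^sup>2). isCont f t"
    using f unfolding T_def by eventually_elim (rule DERIV_isCont)
  from eventually_continuous_on_cball_radial[OF this] upper show ?thesis
    unfolding strictly_superharmonic_at_def using eventually_at_right_less
  proof eventually_elim
    case (elim r)
    have "f ((norm (a + h - x))\<^sup>2) \<le> f ((norm (a - x))\<^sup>2) + 2 * f' T * ((a - x) \<bullet> h)
        + (f' T + \<eta> / 4) * (norm h)\<^sup>2 + 4 * c * ((a - x) \<bullet> h)\<^sup>2 + 4 * c * (((a - x) \<bullet> h) * (norm h)\<^sup>2)"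
      if "norm h \<le> r" for h
      using elim(2) that by (simp add: T_def diff_add_eq)
    then have "ball_mean (\<lambda>y. f ((norm (y - x))\<^sup>2)) a r < f ((norm (a - x))\<^sup>2)"
      by (rule ball_mean_less_of_quadratic_upper[OF elim(3,1) _ neg'])
    with elim(1) show ?case by simp
  qed
qed

section \<open>The fundamental solution\<close>

lemma fund_sol_nonneg: "3 \<le> DIM('a) \<Longrightarrow> 0 \<le> fund_sol (z :: 'a::euclidean_space)"
  by (simp add: fund_sol_def)

lemma fund_sol_measurable [measurable]:
  "(\<lambda>y. fund_sol (y - x)) \<in> borel_measurable (borel :: 'a::euclidean_space measure)"
  unfolding fund_sol_def by measurable

lemma continuous_on_fund_sol: "continuous_on (S - {x}) (\<lambda>z. fund_sol (z - x))"
  unfolding fund_sol_def by (intro continuous_intros) auto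

lemma filterlim_fund_sol_at_top:
  assumes "3 \<le> DIM('a::euclidean_space)"
  shows "filterlim (\<lambda>z. fund_sol (z - x)) at_top (at (x::'a))"
proof -
  have "((\<lambda>z. norm (z - x) ^ (DIM('a) - 2)) \<longlongrightarrow> norm (x - x) ^ (DIM('a) - 2)) (at x)"
    by (intro tendsto_intros)
  moreover have "norm (x - x) ^ (DIM('a) - 2) = 0"
    using assms by simp
  ultimately have "filterlim (\<lambda>z. inverse (norm (z - x) ^ (DIM('a) - 2))) at_top (at x)"
    by (intro filterlim_inverse_at_top) (simp_all only: eventually_at_filter, simp)
  moreover have "0 < 1 / (real DIM('a) * unit_ball_vol (real DIM('a)) * (real DIM('a) - 2))"
    using assms by (intro divide_pos_pos mult_pos_pos) auto
  ultimately show ?thesis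
    unfolding fund_sol_def by (intro filterlim_tendsto_pos_mult_at_top[OF tendsto_const])
      (simp_all add: inverse_eq_divide)
qed

text \<open>Also at \<open>z = 0\<close>, where both sides vanish because of \<open>1 / 0 = 0\<close> and \<open>0 powr _ = 0\<close>.\<close>

lemma fund_sol_eq_powr:
  assumes "3 \<le> DIM('a::euclidean_space)"
  obtains C where "0 < C" "\<And>z::'a. fund_sol z = C * ((norm z)\<^sup>2) powr (1 - DIM('a) / 2)"
proof
  let ?C = "1 / (real DIM('a) * unit_ball_vol (real DIM('a)) * (real DIM('a) - 2))"
  show "0 < ?C"
    using assms by (intro divide_pos_pos mult_pos_pos) auto
  fix z :: 'a
  show "fund_sol z = ?C * ((norm z)\<^sup>2) powr (1 - DIM('a) / 2)"
  proof (cases "z = 0")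
    case False
    have "((norm z)\<^sup>2) powr (1 - DIM('a) / 2) = norm z powr (- real (DIM('a) - 2))"
      using False assms by (simp add: powr_powr right_diff_distrib of_nat_diff flip: powr_numeral)
    also have "\<dots> = 1 / norm z ^ (DIM('a) - 2)"
      using False by (simp add: powr_minus_divide powr_realpow)
    finally show ?thesis by (simp add: fund_sol_def)
  qed (use assms in \<open>simp add: fund_sol_def\<close>)
qed

lemma strictly_superharmonic_at_fund_sol:
  fixes a x :: "'a::euclidean_space"
  assumes "3 \<le> DIM('a)" "a \<noteq> x" "0 < \<eta>"
  shows "strictly_superharmonic_at (\<lambda>y. fund_sol (y - x) + \<eta> * (B - (norm (y - x))\<^sup>2)) a"
proof -
  define T where "T = (norm (a - x))\<^sup>2"
  have "0 < T" using \<open>a \<noteq> x\<close> by (simp add: T_def)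
  define k where "k = 1 - DIM('a) / 2"
  obtain C where C: "\<And>z::'a. fund_sol z = C * ((norm z)\<^sup>2) powr k"
    using fund_sol_eq_powr[OF assms(1)] unfolding k_def by blast
  define f where "f t = C * t powr k + \<eta> * (B - t)" for t
  define f' where "f' t = C * (k * t powr (k - 1)) - \<eta>" for t
  have "(f has_real_derivative f' t) (at t)" if "0 < t" for t
    unfolding f_def[abs_def] f'_def using that
    by (auto intro!: derivative_eq_intros has_real_derivative_powr)
  moreover have "\<forall>\<^sub>F t in nhds T. t \<in> {0<..}"
    using \<open>0 < T\<close> by (intro eventually_nhds_in_open) auto
  ultimately have f_deriv: "\<forall>\<^sub>F t in nhds T. (f has_real_derivative f' t) (at t)"
    by (simp add: eventually_mono)
  have f'_deriv: "(f' has_real_derivative C * (k * ((k - 1) * T powr (k - 1 - 1)))) (at T)"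
    unfolding f'_def[abs_def] using \<open>0 < T\<close>
    by (auto intro!: derivative_eq_intros has_real_derivative_powr)
  have "T * T powr (k - 1 - 1) = T powr (k - 1)"
    using \<open>0 < T\<close> powr_add[of T 1 "k - 1 - 1"] by simp
  moreover have "2 / DIM('a) * (k - 1) = - 1"
    by (simp add: k_def)
  ultimately have "f' T + 2 * T / DIM('a) * (C * (k * ((k - 1) * T powr (k - 1 - 1)))) = - \<eta>"
    by (simp add: f'_def k_def)
  then have "strictly_superharmonic_at (\<lambda>y. f ((norm (y - x))\<^sup>2)) a"
    using f_deriv f'_deriv \<open>0 < \<eta>\<close> unfolding T_def by (intro strictly_superharmonic_at_radial) auto
  then show ?thesis
    by (simp add: f_def C)
qed

lemma inverse_power_eq_nn_integral:
  fixes \<rho> d :: real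
  assumes "0 < \<rho>" "\<rho> \<le> d"
  shows "ennreal (1 / \<rho> ^ k) = ennreal (1 / d ^ k)
    + (\<integral>\<^sup>+r. ennreal (real k / r ^ Suc k) * indicator {\<rho>..d} r \<partial>lborel)"
proof -
  have "((\<lambda>r. - (1 / r ^ k)) has_real_derivative real k / r ^ Suc k) (at r)" if "0 < r" for r
  proof -
    have "((\<lambda>r. - (1 / r ^ k)) has_real_derivative - (- (real k * r ^ (k - 1)) / (r ^ k * r ^ k))) (at r)"
      using that by (auto intro!: derivative_eq_intros)
    also have "- (- (real k * r ^ (k - 1)) / (r ^ k * r ^ k)) = real k / r ^ Suc k"
      using that by (cases k) simp_all
    finally show ?thesis .
  qed
  then have "(\<integral>\<^sup>+r. ennreal (real k / r ^ Suc k) * indicator {\<rho>..d} r \<partial>lborel)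
      = ennreal (- (1 / d ^ k) - - (1 / \<rho> ^ k))"
    using assms by (intro nn_integral_FTC_Icc) auto
  moreover have "1 / d ^ k \<le> 1 / \<rho> ^ k"
    using assms by (intro divide_left_mono power_mono) auto
  ultimately show ?thesis
    using assms by (simp flip: ennreal_plus)
qed

lemma
  fixes f :: "real \<Rightarrow> ennreal"
  assumes f: "f \<in> borel_measurable borel"
  shows measurable_nn_integral_norm_layers:
      "(\<lambda>y::'a::euclidean_space. \<integral>\<^sup>+r. f r * indicator {norm y..d} r \<partial>lborel) \<in> borel_measurable lborel"
    and nn_integral_norm_layers: "(\<integral>\<^sup>+y. (\<integral>\<^sup>+r. f r * indicator {norm (y::'a)..d} r \<partial>lborel) \<partial>lborel)
      = (\<integral>\<^sup>+r. f r * emeasure lborel (cball (0::'a) r) * indicator {..d} r \<partial>lborel)"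
proof -
  define Q where "Q = {q :: 'a \<times> real. norm (fst q) \<le> snd q \<and> snd q \<le> d}"
  have "{q \<in> space (lborel \<Otimes>\<^sub>M lborel). norm (fst q :: 'a) \<le> snd q \<and> snd q \<le> d} \<in> sets (lborel \<Otimes>\<^sub>M lborel)"
    by measurable
  then have Q: "Q \<in> sets (lborel \<Otimes>\<^sub>M lborel)"
    by (simp add: Q_def space_pair_measure)
  have "(\<lambda>q. f (snd q) * indicator Q q) \<in> borel_measurable (lborel \<Otimes>\<^sub>M lborel)"
    using f by (intro borel_measurable_times_ennreal borel_measurable_indicator[OF Q]
        measurable_compose[OF measurable_snd]) simp
  then have measurable: "(\<lambda>(y, r). f r * indicator Q (y, r)) \<in> borel_measurable (lborel \<Otimes>\<^sub>M lborel)"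
    by (simp add: case_prod_beta')
  have layer_eq: "(\<integral>\<^sup>+r. f r * indicator {norm y..d} r \<partial>lborel)
      = (\<integral>\<^sup>+r. f r * indicator Q (y, r) \<partial>lborel)" for y
    by (intro nn_integral_cong) (simp add: Q_def indicator_def)
  show "(\<lambda>y::'a. \<integral>\<^sup>+r. f r * indicator {norm y..d} r \<partial>lborel) \<in> borel_measurable lborel"
    unfolding layer_eq using lborel.borel_measurable_nn_integral_fst[OF measurable] by simp
  have "(\<integral>\<^sup>+y. (\<integral>\<^sup>+r. f r * indicator {norm (y::'a)..d} r \<partial>lborel) \<partial>lborel)
      = (\<integral>\<^sup>+y. (\<integral>\<^sup>+r. f r * indicator Q (y, r) \<partial>lborel) \<partial>lborel)"
    unfolding layer_eq ..
  also have "\<dots> = (\<integral>\<^sup>+r. (\<integral>\<^sup>+y. f r * indicator Q (y, r) \<partial>lborel) \<partial>lborel)"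
    by (rule lborel_pair.Fubini'[OF measurable, symmetric])
  also have "\<dots> = (\<integral>\<^sup>+r. f r * emeasure lborel (cball (0::'a) r) * indicator {..d} r \<partial>lborel)"
  proof (rule nn_integral_cong)
    fix r
    have "(\<integral>\<^sup>+y. f r * indicator Q (y, r) \<partial>lborel)
        = (\<integral>\<^sup>+y. f r * indicator {..d} r * indicator (cball (0::'a) r) y \<partial>lborel)"
      by (intro nn_integral_cong) (auto simp: Q_def indicator_def)
    also have "\<dots> = f r * indicator {..d} r * emeasure lborel (cball (0::'a) r)"
      by (rule nn_integral_cmult_indicator) simp
    finally show "(\<integral>\<^sup>+y. f r * indicator Q (y, r) \<partial>lborel)
        = f r * emeasure lborel (cball (0::'a) r) * indicator {..d} r"
      by (simp add: mult_ac)
  qed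
  finally show "(\<integral>\<^sup>+y. (\<integral>\<^sup>+r. f r * indicator {norm (y::'a)..d} r \<partial>lborel) \<partial>lborel)
      = (\<integral>\<^sup>+r. f r * emeasure lborel (cball (0::'a) r) * indicator {..d} r \<partial>lborel)" .
qed

lemma nn_integral_inverse_power_volume:
  fixes d :: real
  assumes k: "DIM('a::euclidean_space) = k + 2" and "0 \<le> d"
  shows "(\<integral>\<^sup>+r. ennreal (real k / r ^ Suc k) * emeasure lborel (cball (0::'a) r) * indicator {..d} r \<partial>lborel)
    = ennreal (real k * unit_ball_vol (real DIM('a)) * d\<^sup>2 / 2)"
proof -
  define \<alpha> where "\<alpha> = unit_ball_vol (real DIM('a))"
  have "0 < \<alpha>" by (simp add: \<alpha>_def)
  have "ennreal (real k / r ^ Suc k) * emeasure lborel (cball (0::'a) r) * indicator {..d} r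
      = ennreal (real k * \<alpha> * r) * indicator {0..d} r" for r
  proof -
    consider "r < 0" | "r = 0" | "0 < r" by linarith
    then show ?thesis
    proof cases
      case 3
      have "ennreal (real k / r ^ Suc k) * ennreal (\<alpha> * r ^ (k + 2))
          = ennreal (real k / r ^ Suc k * (\<alpha> * r ^ (k + 2)))"
        using 3 by (intro ennreal_mult'[symmetric]) simp
      also have "real k / r ^ Suc k * (\<alpha> * r ^ (k + 2)) = real k * \<alpha> * r"
        using 3 by simp
      finally show ?thesis
        using 3 by (simp add: emeasure_cball \<alpha>_def k indicator_def)
    qed simp_all
  qed
  then have "(\<integral>\<^sup>+r. ennreal (real k / r ^ Suc k) * emeasure lborel (cball (0::'a) r) * indicator {..d} r \<partial>lborel)
      = (\<integral>\<^sup>+r. ennreal (real k * \<alpha> * r) * indicator {0..d} r \<partial>lborel)"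
    by simp
  also have "\<dots> = ennreal (real k * \<alpha> * d\<^sup>2 / 2 - real k * \<alpha> * 0\<^sup>2 / 2)"
    using \<open>0 < \<alpha>\<close> \<open>0 \<le> d\<close> by (intro nn_integral_FTC_Icc) (auto intro!: derivative_eq_intros)
  finally show ?thesis by (simp add: \<alpha>_def)
qed

lemma nn_integral_inverse_norm_power_le:
  fixes d :: real
  assumes n: "3 \<le> DIM('a::euclidean_space)" and "0 < d"
  shows "(\<integral>\<^sup>+y. ennreal (1 / norm y ^ (DIM('a) - 2)) * indicator (cball (0::'a) d) y \<partial>lborel)
    \<le> ennreal (real DIM('a) * unit_ball_vol (real DIM('a)) * d\<^sup>2 / 2)"
proof -
  define k where "k = DIM('a) - 2"
  have k: "DIM('a) = k + 2" "0 < k" using n by (auto simp: k_def)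
  define \<alpha> where "\<alpha> = unit_ball_vol (real DIM('a))"
  have "0 < \<alpha>" by (simp add: \<alpha>_def)
  let ?L = "\<lambda>y::'a. \<integral>\<^sup>+r. ennreal (real k / r ^ Suc k) * indicator {norm y..d} r \<partial>lborel"
  have "ennreal (1 / norm y ^ k) * indicator (cball 0 d) y
      \<le> ennreal (1 / d ^ k) * indicator (cball 0 d) y + ?L y" for y :: 'a
    using inverse_power_eq_nn_integral[of "norm y" d k] k(2)
    by (cases "y = 0") (auto simp: indicator_def zero_power)
  then have "(\<integral>\<^sup>+y. ennreal (1 / norm y ^ k) * indicator (cball (0::'a) d) y \<partial>lborel)
      \<le> (\<integral>\<^sup>+y. ennreal (1 / d ^ k) * indicator (cball (0::'a) d) y + ?L y \<partial>lborel)"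
    by (intro nn_integral_mono)
  also have "\<dots> = (\<integral>\<^sup>+y. ennreal (1 / d ^ k) * indicator (cball (0::'a) d) y \<partial>lborel)
      + (\<integral>\<^sup>+y. ?L y \<partial>lborel)"
    by (intro nn_integral_add borel_measurable_times_ennreal borel_measurable_indicator
        measurable_nn_integral_norm_layers) (simp, simp, measurable)
  also have "(\<integral>\<^sup>+y. ennreal (1 / d ^ k) * indicator (cball (0::'a) d) y \<partial>lborel) = ennreal (\<alpha> * d\<^sup>2)"
    using \<open>0 < d\<close> \<open>0 < \<alpha>\<close> by (simp add: nn_integral_cmult_indicator emeasure_cball \<alpha>_def k(1)
        power_add power2_eq_square flip: ennreal_mult)
  also have "(\<integral>\<^sup>+y. ?L y \<partial>lborel) = (\<integral>\<^sup>+r. ennreal (real k / r ^ Suc k)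
      * emeasure lborel (cball (0::'a) r) * indicator {..d} r \<partial>lborel)"
    by (rule nn_integral_norm_layers) measurable
  also have "\<dots> = ennreal (real k * \<alpha> * d\<^sup>2 / 2)"
    unfolding \<alpha>_def using \<open>0 < d\<close> by (intro nn_integral_inverse_power_volume k(1)) simp
  also have "ennreal (\<alpha> * d\<^sup>2) + \<dots> = ennreal (real DIM('a) * \<alpha> * d\<^sup>2 / 2)"
    using \<open>0 < \<alpha>\<close> by (simp add: k(1) field_simps flip: ennreal_plus)
  finally show ?thesis by (simp add: k_def \<alpha>_def)
qed

section \<open>The Dirichlet Green function\<close>

lemma borel_measurable_SUP_continuous_on:
  fixes \<V> :: "('a::topological_space \<Rightarrow> real) set"
  assumes S: "open S" and "\<V> \<noteq> {}" and cont: "\<And>v. v \<in> \<V> \<Longrightarrow> continuous_on S v"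
    and bdd: "\<And>y. y \<in> S \<Longrightarrow> bdd_above ((\<lambda>v. v y) ` \<V>)"
  shows "(\<lambda>y. SUP v\<in>\<V>. v y) \<in> borel_measurable (restrict_space borel S)"
  unfolding borel_measurable_iff_greater
proof
  fix t :: real
  have "open (S \<inter> v -` {t<..})" if "v \<in> \<V>" for v
    using cont[OF that] S by (rule continuous_open_preimage) simp
  then have "open (\<Union>v\<in>\<V>. S \<inter> v -` {t<..})" by blast
  moreover have "{y \<in> S. t < (SUP v\<in>\<V>. v y)} = (\<Union>v\<in>\<V>. S \<inter> v -` {t<..})"
    using less_cSUP_iff[OF \<open>\<V> \<noteq> {}\<close> bdd] by auto
  ultimately show "{y \<in> space (restrict_space borel S). t < (SUP v\<in>\<V>. v y)} \<in> sets (restrict_space borel S)"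
    using S by (simp add: space_restrict_space sets_restrict_space_iff)
qed

lemma diameter_pos:
  fixes U :: "'a::euclidean_space set"
  assumes "open U" "bounded U" "U \<noteq> {}"
  shows "0 < diameter U"
proof -
  obtain x r where x: "x \<in> U" "0 < r" "cball x r \<subseteq> U"
    using assms unfolding open_contains_cball by blast
  obtain b :: 'a where b: "b \<in> Basis" using nonempty_Basis by blast
  have "x + r *\<^sub>R b \<in> U"
    using x b by (intro subsetD[OF x(3)]) (simp add: dist_norm)
  then have "dist (x + r *\<^sub>R b) x \<le> diameter U"
    using x(1) by (intro diameter_bounded_bound assms)
  then show ?thesis using x(2) b by (simp add: dist_norm)
qed

definition perron_subfunctions :: "'a::euclidean_space set \<Rightarrow> ('a \<Rightarrow> real) \<Rightarrow> ('a \<Rightarrow> real) set" where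
  "perron_subfunctions U \<psi> =
    {v. continuous_on (closure U) v \<and> subharmonic_on U v \<and> (\<forall>z\<in>frontier U. v z \<le> \<psi> z)}"

lemma perron_solution_eq: "perron_solution U \<psi> y = (SUP v\<in>perron_subfunctions U \<psi>. v y)"
  by (simp add: perron_solution_def perron_subfunctions_def)

locale dirichlet_domain =
  fixes U :: "'a::euclidean_space set"
  assumes dim_ge_3: "3 \<le> DIM('a)" and open_domain: "open U" and bounded_domain: "bounded U"
begin

lemma l0_nonneg: "0 \<le> l0 U"
  using dim_ge_3 by (simp add: l0_def)

lemma subharmonic_le_fund_sol:
  assumes v: "continuous_on (closure U) v" "subharmonic_on U v"
    and frontier: "\<And>z. z \<in> frontier U \<Longrightarrow> v z \<le> fund_sol (z - x)"
    and y: "y \<in> U" "y \<noteq> x"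
  shows "v y \<le> fund_sol (y - x)"
proof (rule field_le_epsilon)
  fix e :: real
  assume "0 < e"
  have compact: "compact (closure U)" using bounded_domain by simp
  obtain M where M: "\<And>z. z \<in> closure U \<Longrightarrow> v z \<le> M"
    using compact_imp_bounded[OF compact_continuous_image[OF v(1) compact]]
    unfolding bounded_real by (auto simp: abs_le_iff)
  have "bounded ((\<lambda>z. z - x) ` closure U)"
    by (intro compact_imp_bounded compact_continuous_image compact continuous_intros)
  then obtain R where "0 < R" and R: "\<And>z. z \<in> closure U \<Longrightarrow> norm (z - x) \<le> R"
    unfolding bounded_pos by force
  define \<eta> where "\<eta> = e / R\<^sup>2"
  have "0 < \<eta>" using \<open>0 < e\<close> \<open>0 < R\<close> by (simp add: \<eta>_def)
  define w where "w z = fund_sol (z - x) + \<eta> * (R\<^sup>2 - (norm (z - x))\<^sup>2)" for z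
  have fund_sol_le: "fund_sol (z - x) \<le> w z" if "z \<in> closure U" for z
    using power_mono[OF R[OF that], of 2] \<open>0 < \<eta>\<close> by (simp add: w_def)
  have "v y \<le> w y"
  proof (rule subharmonic_comparison[OF open_domain bounded_domain v])
    show "continuous_on (closure U - {x}) w"
      unfolding w_def by (intro continuous_intros continuous_on_fund_sol)
    show "strictly_superharmonic_at w a" if "a \<in> U - {x}" for a
      unfolding w_def[abs_def] using that
      by (intro strictly_superharmonic_at_fund_sol dim_ge_3 \<open>0 < \<eta>\<close>) auto
    show "v z \<le> w z" if "z \<in> frontier U" for z
      using frontier[OF that] fund_sol_le[of z] that by (auto simp: frontier_def)
    have "\<forall>\<^sub>F z in at x. M \<le> fund_sol (z - x)"
      using filterlim_fund_sol_at_top[OF dim_ge_3, of x] by (simp add: filterlim_at_top)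
    then show "\<forall>\<^sub>F z in at x. z \<in> closure U \<longrightarrow> v z \<le> w z"
    proof eventually_elim
      case (elim z)
      then show ?case
        using order.trans[OF M order.trans[OF elim fund_sol_le]] by simp
    qed
  qed (use y in auto)
  also have "w y \<le> fund_sol (y - x) + \<eta> * R\<^sup>2"
    using \<open>0 < \<eta>\<close> by (simp add: w_def)
  also have "\<eta> * R\<^sup>2 = e"
    using \<open>0 < R\<close> by (simp add: \<eta>_def)
  finally show "v y \<le> fund_sol (y - x) + e" .
qed

abbreviation "green_subfunctions x \<equiv> perron_subfunctions U (\<lambda>z. fund_sol (z - x))"

lemma zero_perron_subfunction: "(\<lambda>_. 0) \<in> green_subfunctions x"
  using dim_ge_3 by (auto simp: perron_subfunctions_def subharmonic_on_def fund_sol_nonneg)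

lemma perron_subfunction_le_fund_sol:
  "v \<in> green_subfunctions x \<Longrightarrow> y \<in> U \<Longrightarrow> y \<noteq> x \<Longrightarrow> v y \<le> fund_sol (y - x)"
  by (rule subharmonic_le_fund_sol) (auto simp: perron_subfunctions_def)

lemma bdd_above_perron_subfunctions:
  "y \<in> U \<Longrightarrow> y \<noteq> x \<Longrightarrow> bdd_above ((\<lambda>v. v y) ` green_subfunctions x)"
  using perron_subfunction_le_fund_sol by (intro bdd_aboveI2[where M="fund_sol (y - x)"]) auto

lemma
  assumes y: "y \<in> U" "y \<noteq> x"
  shows green_nonneg: "0 \<le> green U x y" and green_le_fund_sol: "green U x y \<le> fund_sol (y - x)"
proof -
  have "perron_solution U (\<lambda>z. fund_sol (z - x)) y \<le> fund_sol (y - x)"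
    unfolding perron_solution_eq using zero_perron_subfunction[of x] perron_subfunction_le_fund_sol y
    by (intro cSUP_least) auto
  then show "0 \<le> green U x y" by (simp add: green_def)
  have "0 \<le> perron_solution U (\<lambda>z. fund_sol (z - x)) y"
    unfolding perron_solution_eq
    using cSUP_upper[OF zero_perron_subfunction bdd_above_perron_subfunctions[OF y]] by simp
  then show "green U x y \<le> fund_sol (y - x)" by (simp add: green_def)
qed

lemma green_measurable: "green U x \<in> borel_measurable (lebesgue_on U)"
proof -
  let ?h = "perron_solution U (\<lambda>z. fund_sol (z - x))"
  have "?h \<in> borel_measurable (restrict_space borel (U - {x}))"
    unfolding perron_solution_eq[abs_def]
  proof (rule borel_measurable_SUP_continuous_on)
    show "continuous_on (U - {x}) v" if "v \<in> green_subfunctions x" for v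
      using that closure_subset[of U] by (auto simp: perron_subfunctions_def intro: continuous_on_subset)
  qed (use open_domain zero_perron_subfunction[of x] bdd_above_perron_subfunctions in auto)
  then have "(\<lambda>y. indicator (U - {x}) y *\<^sub>R ?h y) \<in> borel_measurable borel"
    using open_domain by (subst (asm) borel_measurable_restrict_space_iff) auto
  then have "(\<lambda>y. indicator (U - {x}) y *\<^sub>R ?h y) \<in> borel_measurable (lebesgue_on U)"
    by (intro measurable_restrict_space1 measurable_completion) simp
  then have "?h \<in> borel_measurable (lebesgue_on U)"
  proof (rule measurable_discrete_difference[where X="{x} \<inter> U"])
    show "{z} \<in> sets (lebesgue_on U)" if "z \<in> {x} \<inter> U" for z
      using that open_domain by (auto simp: sets_restrict_space_iff)
  qed auto
  moreover have "(\<lambda>y. fund_sol (y - x)) \<in> borel_measurable (lebesgue_on U)"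
    by (intro measurable_restrict_space1 measurable_completion) measurable
  ultimately show ?thesis
    unfolding green_def[abs_def] by (intro borel_measurable_diff)
qed

lemma nn_integral_fund_sol_le:
  assumes x: "x \<in> U"
  shows "(\<integral>\<^sup>+y. ennreal (fund_sol (y - x)) \<partial>lebesgue_on U) \<le> ennreal (l0 U)"
proof -
  define d where "d = diameter U"
  have "0 < d" using diameter_pos[OF open_domain bounded_domain] x by (auto simp: d_def)
  define \<alpha> where "\<alpha> = unit_ball_vol (real DIM('a))"
  have "0 < \<alpha>" by (simp add: \<alpha>_def)
  define c where "c = 1 / (real DIM('a) * \<alpha> * (real DIM('a) - 2))"
  have "0 < c" using dim_ge_3 \<open>0 < \<alpha>\<close> unfolding c_def by (intro divide_pos_pos mult_pos_pos) auto
  let ?g = "\<lambda>y::'a. ennreal c * (ennreal (1 / norm y ^ (DIM('a) - 2)) * indicator (cball 0 d) y)"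
  have g_measurable: "?g \<in> borel_measurable borel"
    by (intro borel_measurable_times_ennreal borel_measurable_indicator) auto
  have "(\<integral>\<^sup>+y. ennreal (fund_sol (y - x)) \<partial>lebesgue_on U)
      = (\<integral>\<^sup>+y. ennreal (fund_sol (y - x)) * indicator U y \<partial>lebesgue)"
    using open_domain by (subst nn_integral_restrict_space) auto
  also have "\<dots> \<le> (\<integral>\<^sup>+y. ?g (y - x) \<partial>lebesgue)"
  proof (rule nn_integral_mono)
    fix y
    have "norm (y - x) \<le> d" if "y \<in> U"
      using diameter_bounded_bound[OF bounded_domain that x] by (simp add: d_def dist_norm)
    then show "ennreal (fund_sol (y - x)) * indicator U y \<le> ?g (y - x)"
      using \<open>0 < c\<close> by (auto simp: indicator_def fund_sol_def c_def \<alpha>_def simp flip: ennreal_mult')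
  qed
  also have "\<dots> = (\<integral>\<^sup>+y. ?g (y - x) \<partial>distr lborel borel ((+) x))"
    by (simp add: nn_integral_completion lborel_distr_plus)
  also have "\<dots> = (\<integral>\<^sup>+y. ?g (x + y - x) \<partial>lborel)"
    using g_measurable by (intro nn_integral_distr) auto
  also have "\<dots> = ennreal c * (\<integral>\<^sup>+y. ennreal (1 / norm y ^ (DIM('a) - 2)) * indicator (cball (0::'a) d) y \<partial>lborel)"
    by (subst nn_integral_cmult[symmetric])
      (auto intro!: borel_measurable_times_ennreal borel_measurable_indicator)
  also have "\<dots> \<le> ennreal c * ennreal (real DIM('a) * \<alpha> * d\<^sup>2 / 2)"
    unfolding \<alpha>_def by (intro mult_left_mono nn_integral_inverse_norm_power_le dim_ge_3 \<open>0 < d\<close>) auto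
  also have "\<dots> = ennreal (c * (real DIM('a) * \<alpha> * d\<^sup>2 / 2))"
    using \<open>0 < c\<close> by (intro ennreal_mult'[symmetric]) simp
  also have "c * (real DIM('a) * \<alpha> * d\<^sup>2 / 2) = l0 U"
    using \<open>0 < \<alpha>\<close> dim_ge_3 by (simp add: c_def l0_def d_def field_simps)
  finally show ?thesis .
qed

lemma
  assumes x: "x \<in> U"
  shows integrable_fund_sol: "integrable (lebesgue_on U) (\<lambda>y. fund_sol (y - x))"
    and integral_fund_sol_le: "(\<integral>y. fund_sol (y - x) \<partial>lebesgue_on U) \<le> l0 U"
proof -
  have measurable: "(\<lambda>y. fund_sol (y - x)) \<in> borel_measurable (lebesgue_on U)"
    by (intro measurable_restrict_space1 measurable_completion) measurable
  note nonneg = fund_sol_nonneg[OF dim_ge_3]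
  show "integrable (lebesgue_on U) (\<lambda>y. fund_sol (y - x))"
    using nn_integral_fund_sol_le[OF x] nonneg
    by (intro integrableI_nonneg measurable) (auto intro: le_less_trans[OF _ ennreal_less_top])
  have "(\<integral>y. fund_sol (y - x) \<partial>lebesgue_on U) = enn2real (\<integral>\<^sup>+y. ennreal (fund_sol (y - x)) \<partial>lebesgue_on U)"
    using nonneg measurable by (intro integral_eq_nn_integral) auto
  also have "\<dots> \<le> l0 U"
    using nn_integral_fund_sol_le[OF x] by (intro enn2real_leI l0_nonneg)
  finally show "(\<integral>y. fund_sol (y - x) \<partial>lebesgue_on U) \<le> l0 U" .
qed

lemma AE_abs_green_le_fund_sol:
  assumes "x \<in> U"
  shows "AE y in lebesgue_on U. \<bar>green U x y\<bar> \<le> fund_sol (y - x)"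
proof -
  have "AE y in lebesgue. y \<noteq> x"
    using AE_lborel_singleton[of x] by (rule AE_completion)
  then have "AE y in lebesgue_on U. y \<noteq> x"
    using open_domain by (subst AE_restrict_space_iff) auto
  then show ?thesis
    using AE_space
  proof eventually_elim
    case (elim y)
    then show ?case using green_nonneg[of y x] green_le_fund_sol[of y x] by simp
  qed
qed

lemma
  assumes x: "x \<in> U" and \<phi>: "\<phi> \<in> Linf U"
  shows integrable_green_mult: "integrable (lebesgue_on U) (\<lambda>y. green U x y * \<phi> y)"
    and abs_green_op_le: "\<bar>green_op U \<phi> x\<bar> \<le> l0 U * Linf_norm U \<phi>"
proof -
  have dominated: "AE y in lebesgue_on U. \<bar>green U x y * \<phi> y\<bar> \<le> Linf_norm U \<phi> * fund_sol (y - x)"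
    using AE_abs_green_le_fund_sol[OF x] AE_abs_le_Linf_norm[OF \<phi>]
  proof eventually_elim
    case (elim y)
    then have "\<bar>green U x y\<bar> * \<bar>\<phi> y\<bar> \<le> fund_sol (y - x) * Linf_norm U \<phi>"
      by (intro mult_mono fund_sol_nonneg dim_ge_3) auto
    then show ?case by (simp add: abs_mult mult.commute)
  qed
  have bound_integrable: "integrable (lebesgue_on U) (\<lambda>y. Linf_norm U \<phi> * fund_sol (y - x))"
    using integrable_fund_sol[OF x] by simp
  then show integrable: "integrable (lebesgue_on U) (\<lambda>y. green U x y * \<phi> y)"
  proof (rule Bochner_Integration.integrable_bound)
    show "(\<lambda>y. green U x y * \<phi> y) \<in> borel_measurable (lebesgue_on U)"
      using green_measurable Linf_measurable[OF \<phi>] by (intro borel_measurable_times)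
    show "AE y in lebesgue_on U. norm (green U x y * \<phi> y) \<le> norm (Linf_norm U \<phi> * fund_sol (y - x))"
      using dominated by eventually_elim auto
  qed
  have "\<bar>green_op U \<phi> x\<bar> \<le> (\<integral>y. \<bar>green U x y * \<phi> y\<bar> \<partial>lebesgue_on U)"
    unfolding green_op_def by (rule integral_abs_bound)
  also have "\<dots> \<le> (\<integral>y. Linf_norm U \<phi> * fund_sol (y - x) \<partial>lebesgue_on U)"
    using integrable bound_integrable dominated by (intro integral_mono_AE) auto
  also have "\<dots> \<le> l0 U * Linf_norm U \<phi>"
    using mult_right_mono[OF integral_fund_sol_le[OF x] Linf_norm_nonneg[of U \<phi>]]
    by (simp add: mult.commute)
  finally show "\<bar>green_op U \<phi> x\<bar> \<le> l0 U * Linf_norm U \<phi>" .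
qed

lemma green_op_diff:
  assumes "x \<in> U" "\<phi> \<in> Linf U" "\<psi> \<in> Linf U"
  shows "green_op U (\<lambda>y. \<phi> y - \<psi> y) x = green_op U \<phi> x - green_op U \<psi> x"
  using integrable_green_mult[OF assms(1,2)] integrable_green_mult[OF assms(1,3)]
  by (simp add: green_op_def right_diff_distrib)

end

section \<open>Superposition operators on \<open>L\<^sup>\<infinity>(U)\<close>\<close>

lemma Linf_mult:
  assumes "\<phi> \<in> Linf U" "\<psi> \<in> Linf U"
  shows "(\<lambda>x. \<phi> x * \<psi> x) \<in> Linf U"
proof (rule LinfI)
  show "AE x in lebesgue_on U. \<bar>\<phi> x * \<psi> x\<bar> \<le> Linf_norm U \<phi> * Linf_norm U \<psi>"
    using AE_abs_le_Linf_norm[OF assms(1)] AE_abs_le_Linf_norm[OF assms(2)]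
    by eventually_elim (auto simp: abs_mult intro!: mult_mono)
qed (intro borel_measurable_times Linf_measurable assms)

lemma Linf_compose:
  fixes \<phi> :: "real \<Rightarrow> real"
  assumes \<phi>: "continuous_on UNIV \<phi>" and u: "u \<in> Linf U"
  shows "(\<lambda>x. \<phi> (u x)) \<in> Linf U"
proof -
  have "bounded (\<phi> ` cball 0 (Linf_norm U u))"
    by (intro compact_imp_bounded compact_continuous_image continuous_on_subset[OF \<phi>]) auto
  then obtain B where "\<forall>y\<in>\<phi> ` cball 0 (Linf_norm U u). norm y \<le> B"
    unfolding bounded_iff by blast
  then have B: "\<bar>\<phi> s\<bar> \<le> B" if "\<bar>s\<bar> \<le> Linf_norm U u" for s
    using that by simp
  show ?thesis
  proof (rule LinfI)
    show "(\<lambda>x. \<phi> (u x)) \<in> borel_measurable (lebesgue_on U)"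
      using Linf_measurable[OF u] borel_measurable_continuous_onI[OF \<phi>] by (rule measurable_compose)
    show "AE x in lebesgue_on U. \<bar>\<phi> (u x)\<bar> \<le> B"
      using AE_abs_le_Linf_norm[OF u] by eventually_elim (rule B)
  qed
qed

lemma Linf_norm_compose_diff_le:
  fixes \<phi> :: "real \<Rightarrow> real"
  assumes \<phi>: "continuous_on UNIV \<phi>"
    and Lipschitz: "\<And>s t. \<bar>s\<bar> \<le> R \<Longrightarrow> \<bar>t\<bar> \<le> R \<Longrightarrow> \<bar>\<phi> s - \<phi> t\<bar> \<le> L * \<bar>s - t\<bar>" and "0 \<le> L"
    and u: "u \<in> Linf U" "Linf_norm U u \<le> R" and w: "w \<in> Linf U" "Linf_norm U w \<le> R"
  shows "Linf_norm U (\<lambda>x. \<phi> (u x) - \<phi> (w x)) \<le> L * Linf_norm U (\<lambda>x. u x - w x)"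
proof (rule Linf_norm_le)
  show "(\<lambda>x. \<phi> (u x) - \<phi> (w x)) \<in> borel_measurable (lebesgue_on U)"
    by (rule Linf_measurable[OF Linf_diff[OF Linf_compose[OF \<phi> u(1)] Linf_compose[OF \<phi> w(1)]]])
  show "AE x in lebesgue_on U. \<bar>\<phi> (u x) - \<phi> (w x)\<bar> \<le> L * Linf_norm U (\<lambda>x. u x - w x)"
    using AE_abs_le_Linf_norm[OF u(1)] AE_abs_le_Linf_norm[OF w(1)]
      AE_abs_le_Linf_norm[OF Linf_diff[OF u(1) w(1)]]
  proof eventually_elim
    case (elim x)
    have "\<bar>\<phi> (u x) - \<phi> (w x)\<bar> \<le> L * \<bar>u x - w x\<bar>"
      using elim u(2) w(2) by (intro Lipschitz) auto
    also have "\<dots> \<le> L * Linf_norm U (\<lambda>x. u x - w x)"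
      using elim(3) \<open>0 \<le> L\<close> by (rule mult_left_mono)
    finally show ?case .
  qed
qed (use \<open>0 \<le> L\<close> in simp)

lemma abs_power_diff_le:
  fixes s t R :: real
  assumes "\<bar>s\<bar> \<le> R" "\<bar>t\<bar> \<le> R"
  shows "\<bar>\<bar>s\<bar> ^ m - \<bar>t\<bar> ^ m\<bar> \<le> real m * R ^ (m - 1) * \<bar>s - t\<bar>"
proof -
  have "norm (\<bar>s\<bar> ^ m - \<bar>t\<bar> ^ m) \<le> real m * R ^ (m - 1) * norm (\<bar>s\<bar> - \<bar>t\<bar>)"
  proof (rule field_differentiable_bound[where S="{0..R}"])
    fix z :: real
    assume z: "z \<in> {0..R}"
    show "((\<lambda>z. z ^ m) has_real_derivative real m * z ^ (m - 1)) (at z within {0..R})"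
      using DERIV_pow[of m z] by simp
    show "norm (real m * z ^ (m - 1)) \<le> real m * R ^ (m - 1)"
      using z by (auto intro!: mult_left_mono power_mono)
  qed (use assms in auto)
  also have "\<dots> \<le> real m * R ^ (m - 1) * \<bar>s - t\<bar>"
    using assms by (intro mult_left_mono) auto
  finally show ?thesis by simp
qed

lemma has_real_derivative_signed_powr:
  fixes q s :: real
  assumes "0 < q"
  shows "((\<lambda>s. s * \<bar>s\<bar> powr q) has_real_derivative (q + 1) * \<bar>s\<bar> powr q) (at s)"
proof (cases "s = 0")
  case True
  have "((\<lambda>y::real. \<bar>y\<bar> powr q) \<longlongrightarrow> 0) (at 0)"
    using assms by (intro tendsto_zero_powrI[where b=q] tendsto_rabs_zero tendsto_ident_at tendsto_const) auto
  then have "((\<lambda>y::real. (y * \<bar>y\<bar> powr q - 0) / (y - 0)) \<longlongrightarrow> 0) (at 0)"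
    by (rule Lim_transform_eventually) (simp add: eventually_at_filter)
  with True show ?thesis by (simp add: has_field_derivative_iff)
next
  case False
  define \<sigma> where "\<sigma> = sgn s"
  have \<sigma>: "\<bar>y\<bar> = \<sigma> * y" if "0 < \<sigma> * y" for y
    using that by (auto simp: \<sigma>_def sgn_real_def split: if_splits)
  have "0 < \<sigma> * s" using False by (simp add: \<sigma>_def sgn_real_def)
  have "(\<sigma> * s) * (\<sigma> * s) powr (q - 1) = (\<sigma> * s) powr q"
    using \<open>0 < \<sigma> * s\<close> powr_add[of "\<sigma> * s" 1 "q - 1"] by simp
  then have "((\<lambda>y. y * (\<sigma> * y) powr q) has_real_derivative (q + 1) * (\<sigma> * s) powr q) (at s)"
    using \<open>0 < \<sigma> * s\<close> by (auto intro!: derivative_eq_intros simp: algebra_simps)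
  then have "((\<lambda>y. y * \<bar>y\<bar> powr q) has_real_derivative (q + 1) * (\<sigma> * s) powr q) (at s)"
  proof (rule has_field_derivative_transform_within_open)
    show "open {y. 0 < \<sigma> * y}"
      by (intro open_Collect_less continuous_intros)
  qed (use \<open>0 < \<sigma> * s\<close> \<sigma> in auto)
  then show ?thesis using \<sigma>[OF \<open>0 < \<sigma> * s\<close>] by simp
qed

lemma continuous_on_signed_powr:
  fixes q :: real
  assumes "0 < q"
  shows "continuous_on S (\<lambda>s. s * \<bar>s\<bar> powr q)"
  using DERIV_isCont[OF has_real_derivative_signed_powr[OF assms]]
  by (intro continuous_at_imp_continuous_on) blast

lemma abs_signed_powr_diff_le:
  fixes s t R q :: real
  assumes "\<bar>s\<bar> \<le> R" "\<bar>t\<bar> \<le> R" "0 < q"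
  shows "\<bar>s * \<bar>s\<bar> powr q - t * \<bar>t\<bar> powr q\<bar> \<le> (q + 1) * R powr q * \<bar>s - t\<bar>"
proof -
  have "norm (s * \<bar>s\<bar> powr q - t * \<bar>t\<bar> powr q) \<le> (q + 1) * R powr q * norm (s - t)"
  proof (rule field_differentiable_bound[where S="cball 0 R"])
    fix z :: real
    assume z: "z \<in> cball 0 R"
    show "((\<lambda>s. s * \<bar>s\<bar> powr q) has_real_derivative (q + 1) * \<bar>z\<bar> powr q) (at z within cball 0 R)"
      by (rule has_field_derivative_at_within[OF has_real_derivative_signed_powr[OF \<open>0 < q\<close>]])
    show "norm ((q + 1) * \<bar>z\<bar> powr q) \<le> (q + 1) * R powr q"
      using z \<open>0 < q\<close> by (auto simp: abs_mult intro!: mult_left_mono powr_mono2)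
  qed (use assms in auto)
  then show ?thesis by simp
qed

section \<open>Continuous dependence of the solution on the potential\<close>

definition nonlinear_source ::
    "real \<Rightarrow> ('a \<Rightarrow> real) \<Rightarrow> ('a \<Rightarrow> real) \<Rightarrow> ('a \<Rightarrow> real) \<Rightarrow> ('a \<Rightarrow> real) \<Rightarrow> 'a \<Rightarrow> real" where
  "nonlinear_source p b g V u = (\<lambda>y. g y - (V y * u y - b y * (u y * \<bar>u y\<bar> powr (p - 1))))"

lemma Linf_signed_powr: "1 < p \<Longrightarrow> u \<in> Linf U \<Longrightarrow> (\<lambda>y. u y * \<bar>u y\<bar> powr (p - 1)) \<in> Linf U"
  by (rule Linf_compose[OF continuous_on_signed_powr]) simp_all

lemma Linf_norm_signed_powr_diff_le:
  assumes "1 < p" and u: "u \<in> Linf U" "Linf_norm U u \<le> R" and w: "w \<in> Linf U" "Linf_norm U w \<le> R"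
  shows "Linf_norm U (\<lambda>y. u y * \<bar>u y\<bar> powr (p - 1) - w y * \<bar>w y\<bar> powr (p - 1))
    \<le> p * R powr (p - 1) * Linf_norm U (\<lambda>y. u y - w y)"
proof (rule Linf_norm_compose_diff_le[OF continuous_on_signed_powr _ _ u w])
  show "\<bar>s * \<bar>s\<bar> powr (p - 1) - t * \<bar>t\<bar> powr (p - 1)\<bar> \<le> p * R powr (p - 1) * \<bar>s - t\<bar>"
    if "\<bar>s\<bar> \<le> R" "\<bar>t\<bar> \<le> R" for s t
    using abs_signed_powr_diff_le[OF that, of "p - 1"] \<open>1 < p\<close> by simp
qed (use \<open>1 < p\<close> in auto)

lemma nonlinear_source_in_Linf:
  assumes "1 < p" "b \<in> Linf U" "g \<in> Linf U" "V \<in> Linf U" "u \<in> Linf U"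
  shows "nonlinear_source p b g V u \<in> Linf U"
  unfolding nonlinear_source_def using assms by (intro Linf_diff Linf_mult Linf_signed_powr)

lemma Linf_norm_nonlinear_source_diff_le:
  assumes p: "1 < p" and coeffs: "b \<in> Linf U" "g \<in> Linf U" "V \<in> Linf U" "W \<in> Linf U"
    and u: "u \<in> Linf U" "Linf_norm U u \<le> R" and w: "w \<in> Linf U" "Linf_norm U w \<le> R"
  shows "Linf_norm U (\<lambda>y. nonlinear_source p b g V u y - nonlinear_source p b g W w y)
    \<le> Linf_norm U (\<lambda>y. V y - W y) * R
      + (Linf_norm U V + p * Linf_norm U b * R powr (p - 1)) * Linf_norm U (\<lambda>y. u y - w y)"
    (is "?lhs \<le> ?\<delta> * R + (?v + p * ?\<beta> * R powr (p - 1)) * ?D")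
proof (rule Linf_norm_le)
  let ?\<Phi> = "\<lambda>s::real. s * \<bar>s\<bar> powr (p - 1)"
  show "(\<lambda>y. nonlinear_source p b g V u y - nonlinear_source p b g W w y) \<in> borel_measurable (lebesgue_on U)"
    by (intro Linf_measurable Linf_diff nonlinear_source_in_Linf p coeffs u w)
  show "AE y in lebesgue_on U. \<bar>nonlinear_source p b g V u y - nonlinear_source p b g W w y\<bar>
      \<le> ?\<delta> * R + (?v + p * ?\<beta> * R powr (p - 1)) * ?D"
    using AE_abs_le_Linf_norm[OF Linf_diff[OF Linf_signed_powr[OF p u(1)] Linf_signed_powr[OF p w(1)]]]
      AE_abs_le_Linf_norm[OF w(1)] AE_abs_le_Linf_norm[OF Linf_diff[OF u(1) w(1)]]
      AE_abs_le_Linf_norm[OF coeffs(1)] AE_abs_le_Linf_norm[OF coeffs(3)]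
      AE_abs_le_Linf_norm[OF Linf_diff[OF coeffs(3,4)]]
  proof eventually_elim
    case (elim y)
    have "\<bar>b y\<bar> * \<bar>?\<Phi> (u y) - ?\<Phi> (w y)\<bar> \<le> ?\<beta> * (p * R powr (p - 1) * ?D)"
      using elim(1,4) Linf_norm_signed_powr_diff_le[OF p u w] by (intro mult_mono) auto
    moreover have "\<bar>V y\<bar> * \<bar>u y - w y\<bar> \<le> ?v * ?D"
      using elim(3,5) by (intro mult_mono) auto
    moreover have "\<bar>V y - W y\<bar> * \<bar>w y\<bar> \<le> ?\<delta> * R"
      using elim(2,6) w(2) by (intro mult_mono) auto
    moreover have "nonlinear_source p b g V u y - nonlinear_source p b g W w y
        = b y * (?\<Phi> (u y) - ?\<Phi> (w y)) - V y * (u y - w y) - (V y - W y) * w y"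
      by (simp add: nonlinear_source_def algebra_simps)
    then have "\<bar>nonlinear_source p b g V u y - nonlinear_source p b g W w y\<bar>
        \<le> \<bar>b y\<bar> * \<bar>?\<Phi> (u y) - ?\<Phi> (w y)\<bar> + \<bar>V y\<bar> * \<bar>u y - w y\<bar> + \<bar>V y - W y\<bar> * \<bar>w y\<bar>"
      unfolding abs_mult[symmetric] by linarith
    ultimately have "\<bar>nonlinear_source p b g V u y - nonlinear_source p b g W w y\<bar>
        \<le> ?\<beta> * (p * R powr (p - 1) * ?D) + ?v * ?D + ?\<delta> * R"
      by linarith
    then show ?case by (simp add: algebra_simps)
  qed
  have "0 \<le> R"
    by (rule order.trans[OF Linf_norm_nonneg u(2)])
  then show "0 \<le> ?\<delta> * R + (?v + p * ?\<beta> * R powr (p - 1)) * ?D"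
    using p by (intro add_nonneg_nonneg mult_nonneg_nonneg) auto
qed

context dirichlet_domain
begin

lemma integral_solution_eq_green_op:
  assumes "1 < p" "b \<in> Linf U" "g \<in> Linf U" "V \<in> Linf U" and u: "integral_solution U p b g V u"
  shows "AE x in lebesgue_on U. u x = green_op U (nonlinear_source p b g V u) x"
proof -
  have "u \<in> Linf U"
    and eq: "AE x in lebesgue_on U. u x = green_op U g x - green_op U (\<lambda>y. V y * u y) x
      + green_op U (\<lambda>y. b y * u y * \<bar>u y\<bar> powr (p - 1)) x"
    using u by (auto simp: integral_solution_def)
  have "(\<lambda>y. V y * u y) \<in> Linf U" "(\<lambda>y. b y * (u y * \<bar>u y\<bar> powr (p - 1))) \<in> Linf U"
    using assms \<open>u \<in> Linf U\<close> by (intro Linf_mult Linf_signed_powr; simp)+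
  note terms = assms(3) Linf_diff[OF this] this
  from eq AE_space show ?thesis
  proof eventually_elim
    case (elim x)
    then have "x \<in> U" by simp
    then show ?case
      using elim terms by (simp add: nonlinear_source_def green_op_diff mult.assoc)
  qed
qed

lemma Linf_norm_integral_solution_diff_le:
  assumes p: "1 < p" and coeffs: "b \<in> Linf U" "g \<in> Linf U" "V \<in> Linf U" "W \<in> Linf U"
    and u: "integral_solution U p b g V u" "Linf_norm U u \<le> R"
    and w: "integral_solution U p b g W w" "Linf_norm U w \<le> R"
  shows "Linf_norm U (\<lambda>x. u x - w x) \<le> l0 U * (Linf_norm U (\<lambda>y. V y - W y) * R
      + (Linf_norm U V + p * Linf_norm U b * R powr (p - 1)) * Linf_norm U (\<lambda>x. u x - w x))"
proof -
  let ?\<Psi> = "\<lambda>y. nonlinear_source p b g V u y - nonlinear_source p b g W w y"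
  have u_Linf: "u \<in> Linf U" and w_Linf: "w \<in> Linf U"
    using u w by (auto simp: integral_solution_def)
  note sources = nonlinear_source_in_Linf[OF p coeffs(1-3) u_Linf]
    nonlinear_source_in_Linf[OF p coeffs(1,2,4) w_Linf]
  have "Linf_norm U (\<lambda>x. u x - w x) \<le> l0 U * Linf_norm U ?\<Psi>"
  proof (rule Linf_norm_le)
    show "(\<lambda>x. u x - w x) \<in> borel_measurable (lebesgue_on U)"
      by (intro Linf_measurable Linf_diff u_Linf w_Linf)
    show "AE x in lebesgue_on U. \<bar>u x - w x\<bar> \<le> l0 U * Linf_norm U ?\<Psi>"
      using integral_solution_eq_green_op[OF p coeffs(1-3) u(1)]
        integral_solution_eq_green_op[OF p coeffs(1,2,4) w(1)] AE_space
    proof eventually_elim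
      case (elim x)
      then have "x \<in> U" by simp
      then show ?case
        using abs_green_op_le[OF _ Linf_diff[OF sources]] green_op_diff[OF _ sources] elim by simp
    qed
  qed (simp add: l0_nonneg)
  also have "\<dots> \<le> l0 U * (Linf_norm U (\<lambda>y. V y - W y) * R
      + (Linf_norm U V + p * Linf_norm U b * R powr (p - 1)) * Linf_norm U (\<lambda>x. u x - w x))"
    by (intro mult_left_mono l0_nonneg Linf_norm_nonlinear_source_diff_le p coeffs u_Linf w_Linf u w)
  finally show ?thesis .
qed

lemma integral_solution_Lipschitz:
  assumes p: "1 < p" and coeffs: "b \<in> Linf U" "g \<in> Linf U" "V \<in> Linf U" "W \<in> Linf U"
    and u: "integral_solution U p b g V u" "Linf_norm U u \<le> R"
    and w: "integral_solution U p b g W w" "Linf_norm U w \<le> R"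
    and contraction: "l0 U * (Linf_norm U V + p * Linf_norm U b * R powr (p - 1)) \<le> q" and "q < 1"
  shows "Linf_norm U (\<lambda>x. u x - w x) \<le> l0 U * R / (1 - q) * Linf_norm U (\<lambda>y. V y - W y)"
proof -
  let ?D = "Linf_norm U (\<lambda>x. u x - w x)" and ?\<delta> = "Linf_norm U (\<lambda>y. V y - W y)"
  have "?D \<le> l0 U * (?\<delta> * R + (Linf_norm U V + p * Linf_norm U b * R powr (p - 1)) * ?D)"
    by (rule Linf_norm_integral_solution_diff_le[OF p coeffs u w])
  also have "\<dots> = l0 U * R * ?\<delta> + l0 U * (Linf_norm U V + p * Linf_norm U b * R powr (p - 1)) * ?D"
    by (simp add: algebra_simps)
  also have "\<dots> \<le> l0 U * R * ?\<delta> + q * ?D"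
    by (intro add_left_mono mult_right_mono contraction) simp
  finally have "(1 - q) * ?D \<le> l0 U * R * ?\<delta>"
    by (simp add: algebra_simps)
  then show ?thesis
    using \<open>q < 1\<close> by (simp add: pos_le_divide_eq mult.commute)
qed

end

section \<open>The random solution\<close>

locale random_dirichlet_problem = dirichlet_domain U + prob_space P
  for U :: "'a::euclidean_space set" and P :: "'w measure" +
  fixes X :: "'w \<Rightarrow> 'a set \<Rightarrow> real" and f :: "'a \<Rightarrow>\<^sub>C real" and b g :: "'a \<Rightarrow> real"
    and u :: "'w \<Rightarrow> 'a \<Rightarrow> real" and p c\<^sub>0 K \<epsilon>\<^sub>0 :: real and A :: "'w set"
  assumes domain_nonempty: "U \<noteq> {}" and exponent: "1 < p"
    and X_measurable: "X \<in> measurable P (borel_signed_radon U)"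
    and f_nonzero: "f \<noteq> 0"
    and b_Linf: "b \<in> Linf U" and b_nonzero: "Linf_norm U b \<noteq> 0" and g_Linf: "g \<in> Linf U"
    and K_eq: "K = l0 U * p * Linf_norm U b"
    and c\<^sub>0_less_1: "c\<^sub>0 < 1"
    and \<epsilon>\<^sub>0_eq: "\<epsilon>\<^sub>0 = ((1 - c\<^sub>0) powr p / (2 powr p * K)) powr (1 / (p - 1))"
    and A_eq: "A = admissible_set P X U p f K g \<epsilon>\<^sub>0"
    and solution: "\<And>\<omega>. \<omega> \<in> A \<Longrightarrow> integral_solution U p b g (potential U f (X \<omega>)) (u \<omega>)"
    and solution_norm_le: "\<And>\<omega>. \<omega> \<in> A \<Longrightarrow> Linf_norm U (u \<omega>) \<le> 2 * \<epsilon>\<^sub>0 / (1 - tau U f (X \<omega>))"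
begin

abbreviation "potential_at \<omega> \<equiv> potential U f (X \<omega>)"

definition solution_bound :: real where
  "solution_bound = 2 * \<epsilon>\<^sub>0 / (1 - c\<^sub>0)"

lemma domain_borel: "U \<in> sets borel"
  using open_domain by simp

lemma l0_pos: "0 < l0 U"
  using diameter_pos[OF open_domain bounded_domain domain_nonempty] dim_ge_3 by (simp add: l0_def)

lemma K_pos: "0 < K"
  using l0_pos exponent b_nonzero by (simp add: K_eq less_le[of 0 "Linf_norm U b"])

lemma \<epsilon>\<^sub>0_pos: "0 < \<epsilon>\<^sub>0"
  using K_pos c\<^sub>0_less_1 by (simp add: \<epsilon>\<^sub>0_eq)

lemma \<epsilon>\<^sub>0_powr: "\<epsilon>\<^sub>0 powr (p - 1) = (1 - c\<^sub>0) powr p / (2 powr p * K)"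
  using exponent K_pos by (simp add: \<epsilon>\<^sub>0_eq powr_powr)

lemma K_solution_bound_powr: "K * solution_bound powr (p - 1) = (1 - c\<^sub>0) / 2"
proof -
  have "(1 - c\<^sub>0) powr p = (1 - c\<^sub>0) powr (p - 1) * (1 - c\<^sub>0)"
    using powr_add[of "1 - c\<^sub>0" "p - 1" 1] c\<^sub>0_less_1 by simp
  moreover have "(2::real) powr p = 2 powr (p - 1) * 2"
    using powr_add[of 2 "p - 1" 1] by simp
  ultimately show ?thesis
    using K_pos c\<^sub>0_less_1 \<epsilon>\<^sub>0_pos
    by (simp add: solution_bound_def powr_divide powr_mult \<epsilon>\<^sub>0_powr)
qed

lemma admissible_imp_tau_less:
  assumes "\<omega> \<in> A"
  shows "tau U f (X \<omega>) < c\<^sub>0"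
proof (rule ccontr)
  let ?\<tau> = "tau U f (X \<omega>)"
  assume "\<not> ?\<tau> < c\<^sub>0"
  have "?\<tau> < 1" and "2 powr p * K * \<epsilon>\<^sub>0 powr (p - 1) / (1 - ?\<tau>) powr (p - 1) + ?\<tau> < 1"
    using assms by (auto simp: A_eq admissible_set_def)
  then have "(1 - c\<^sub>0) powr p / (1 - ?\<tau>) powr (p - 1) < 1 - ?\<tau>"
    using K_pos by (simp add: \<epsilon>\<^sub>0_powr)
  then have "(1 - c\<^sub>0) powr p < (1 - ?\<tau>) * (1 - ?\<tau>) powr (p - 1)"
    using \<open>?\<tau> < 1\<close> by (simp add: pos_divide_less_eq)
  also have "\<dots> = (1 - ?\<tau>) powr p"
    using \<open>?\<tau> < 1\<close> powr_add[of "1 - ?\<tau>" 1 "p - 1"] by simp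
  also have "\<dots> \<le> (1 - c\<^sub>0) powr p"
    using \<open>?\<tau> < 1\<close> \<open>\<not> ?\<tau> < c\<^sub>0\<close> exponent by (intro powr_mono2) auto
  finally show False by simp
qed

lemma admissible_in_sets: "A \<in> sets P"
proof -
  have [measurable]: "(\<lambda>\<omega>. tau U f (X \<omega>)) \<in> borel_measurable P"
    unfolding tau_def using measurable_compose[OF X_measurable borel_measurable_tv_norm[OF domain_borel]]
    by measurable
  show ?thesis
    unfolding A_eq admissible_set_def by measurable
qed

lemma space_admissible: "space (restrict_space P A) = A"
  using sets.sets_into_space[OF admissible_in_sets] by (auto simp: space_restrict_space)

lemma finite_measure_admissible: "finite_measure (restrict_space P A)"
  using admissible_in_sets by (intro finite_measure_restrict_space finite_measure_axioms) auto

lemma X_in_signed_radon: "\<omega> \<in> A \<Longrightarrow> X \<omega> \<in> signed_radon U"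
  using measurable_space[OF X_measurable] sets.sets_into_space[OF admissible_in_sets]
  by (auto simp: space_borel_signed_radon)

lemma potential_at_in_Linf: "\<omega> \<in> A \<Longrightarrow> potential_at \<omega> \<in> Linf U"
  by (intro potential_in_Linf domain_borel bounded_domain X_in_signed_radon)

lemma solution_in_Linf: "\<omega> \<in> A \<Longrightarrow> u \<omega> \<in> Linf U"
  using solution by (simp add: integral_solution_def)

lemma solution_le_solution_bound:
  assumes "\<omega> \<in> A"
  shows "Linf_norm U (u \<omega>) \<le> solution_bound"
proof -
  have "2 * \<epsilon>\<^sub>0 / (1 - tau U f (X \<omega>)) \<le> solution_bound"
    unfolding solution_bound_def using admissible_imp_tau_less[OF assms] c\<^sub>0_less_1 \<epsilon>\<^sub>0_pos
    by (intro divide_left_mono) auto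
  with solution_norm_le[OF assms] show ?thesis by simp
qed

lemma solution_Lipschitz:
  assumes \<omega>: "\<omega> \<in> A" "\<omega>' \<in> A"
  shows "Linf_norm U (\<lambda>x. u \<omega> x - u \<omega>' x) \<le> l0 U * solution_bound / (1 - (1 + c\<^sub>0) / 2)
    * Linf_norm U (\<lambda>x. potential_at \<omega> x - potential_at \<omega>' x)"
proof (rule integral_solution_Lipschitz[OF exponent b_Linf g_Linf])
  have "l0 U * Linf_norm U (potential_at \<omega>) \<le> tau U f (X \<omega>)"
    using mult_left_mono[OF Linf_norm_potential_le[OF domain_borel bounded_domain X_in_signed_radon[OF \<omega>(1)]]
        l0_nonneg] by (simp add: tau_def mult.assoc)
  then have "l0 U * Linf_norm U (potential_at \<omega>) + K * solution_bound powr (p - 1) \<le> c\<^sub>0 + (1 - c\<^sub>0) / 2"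
    using admissible_imp_tau_less[OF \<omega>(1)] by (simp add: K_solution_bound_powr)
  then show "l0 U * (Linf_norm U (potential_at \<omega>) + p * Linf_norm U b * solution_bound powr (p - 1))
      \<le> (1 + c\<^sub>0) / 2"
    by (simp add: K_eq distrib_left mult.assoc) (simp add: field_simps)
qed (use \<omega> potential_at_in_Linf solution solution_le_solution_bound c\<^sub>0_less_1 in auto)

lemma Linf_uniformly_approximable_potential_at:
  "Linf_uniformly_approximable (restrict_space P A) U potential_at"
proof (rule Linf_uniformly_approximable_potential[OF domain_borel bounded_domain])
  show "X \<in> measurable (restrict_space P A) (borel_signed_radon U)"
    by (rule measurable_restrict_space1[OF X_measurable])
  fix \<omega>
  assume "\<omega> \<in> space (restrict_space P A)"
  then have "l0 U * norm f * tv_norm U (X \<omega>) < c\<^sub>0"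
    using admissible_imp_tau_less by (simp add: space_admissible tau_def)
  then show "tv_norm U (X \<omega>) \<le> c\<^sub>0 / (l0 U * norm f)"
    using l0_pos f_nonzero by (simp add: pos_le_divide_eq mult.commute)
qed

lemma Linf_uniformly_approximable_solution: "Linf_uniformly_approximable (restrict_space P A) U u"
  by (rule Linf_uniformly_approximable_Lipschitz[OF Linf_uniformly_approximable_potential_at])
    (auto simp: space_admissible intro: solution_in_Linf solution_Lipschitz)

lemma Linf_uniformly_approximable_abs_solution_power:
  "Linf_uniformly_approximable (restrict_space P A) U (\<lambda>\<omega> x. \<bar>u \<omega> x\<bar> ^ m)"
proof (rule Linf_uniformly_approximable_Lipschitz[OF Linf_uniformly_approximable_solution])
  have cont: "continuous_on UNIV (\<lambda>s::real. \<bar>s\<bar> ^ m)"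
    by (intro continuous_intros)
  show "(\<lambda>\<omega> x. \<bar>u \<omega> x\<bar> ^ m) \<in> space (restrict_space P A) \<rightarrow> Linf U"
    using Linf_compose[OF cont] solution_in_Linf by (auto simp: space_admissible)
  fix \<omega> \<omega>'
  assume "\<omega> \<in> space (restrict_space P A)" "\<omega>' \<in> space (restrict_space P A)"
  then show "Linf_norm U (\<lambda>x. \<bar>u \<omega> x\<bar> ^ m - \<bar>u \<omega>' x\<bar> ^ m)
      \<le> real m * solution_bound ^ (m - 1) * Linf_norm U (\<lambda>x. u \<omega> x - u \<omega>' x)"
    using solution_in_Linf solution_le_solution_bound \<epsilon>\<^sub>0_pos c\<^sub>0_less_1
    by (intro Linf_norm_compose_diff_le[OF cont abs_power_diff_le])
      (auto simp: space_admissible solution_bound_def)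
qed

end

theorem theorem3p5:
  fixes U :: "(real ^ 'n) set"
    and P :: "'w measure"
    and X :: "'w \<Rightarrow> (real ^ 'n) set \<Rightarrow> real"
    and f :: "(real ^ 'n) \<Rightarrow>\<^sub>C real"
    and b g :: "real ^ 'n \<Rightarrow> real"
    and u :: "'w \<Rightarrow> real ^ 'n \<Rightarrow> real"
    and p c\<^sub>0 K \<epsilon>\<^sub>0 :: real
    and m :: nat
    and A :: "'w set"
  assumes "CARD('n) \<ge> 3" and "p > 1"
    and "open U" and "connected U" and "U \<noteq> {}" and "bounded U"
    and "prob_space P" and "complete_measure P"
    and "X \<in> measurable P (borel_signed_radon U)"
    and "f \<noteq> 0"
    and "b \<in> Linf U" and "Linf_norm U b \<noteq> 0"
    and K: "K = l0 U * p * Linf_norm U b"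
    and "g \<in> Linf U"
    and "Linf_norm U g < 1 / l0 U * (1 / (2 powr p * K)) powr (1 / (p - 1))"
    and "0 < c\<^sub>0" and "c\<^sub>0 < 1"
    and eps: "\<epsilon>\<^sub>0 = ((1 - c\<^sub>0) powr p / (2 powr p * K)) powr (1 / (p - 1))"
    and A: "A = admissible_set P X U p f K g \<epsilon>\<^sub>0"
    and u: "\<And>\<omega>. \<omega> \<in> A \<Longrightarrow> integral_solution U p b g (potential U f (X \<omega>)) (u \<omega>) \<and>
                   Linf_norm U (u \<omega>) \<le> 2 * \<epsilon>\<^sub>0 / (1 - tau U f (X \<omega>))"
    and "m \<ge> 1"
    and "(\<Sum>i. let j = Suc i in
            ennreal (fact (m + j - 1) / (fact (m - 1) * fact j) * (l0 U * norm f) ^ j) *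
            (\<integral>\<^sup>+\<omega>\<in>A. ennreal (tv_norm U (X \<omega>) ^ j) \<partial>P)) < \<infinity>"
  shows "(\<exists>h \<in> Linf U. has_Linf_bochner_integral (restrict_space P A) U (\<lambda>\<omega> x. \<bar>u \<omega> x\<bar> ^ m) h) \<and>
         set_integrable P A (\<lambda>\<omega>. Linf_norm U (\<lambda>x. \<bar>u \<omega> x\<bar> ^ m)) \<and>
         (\<exists>h \<in> Linf U. has_Linf_bochner_integral (restrict_space P A) U u h)"
proof -
  interpret prob_space P by fact
  interpret random_dirichlet_problem U P X f b g u p c\<^sub>0 K \<epsilon>\<^sub>0 A
    using assms by unfold_locales auto
  note bochner = has_Linf_bochner_integral_uniformly_approximable[OF finite_measure_admissible]
  have "integrable (restrict_space P A) (\<lambda>\<omega>. Linf_norm U (\<lambda>x. \<bar>u \<omega> x\<bar> ^ m))"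
    by (rule integrable_Linf_norm_uniformly_approximable[OF finite_measure_admissible
          Linf_uniformly_approximable_abs_solution_power])
  then have "set_integrable P A (\<lambda>\<omega>. Linf_norm U (\<lambda>x. \<bar>u \<omega> x\<bar> ^ m))"
    using admissible_in_sets by (simp add: set_integrable_def integrable_restrict_space)
  with bochner[OF Linf_uniformly_approximable_abs_solution_power]
    bochner[OF Linf_uniformly_approximable_solution]
  show ?thesis by blast
qed

end
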